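(* Let $n\in\mathbb{N}$, let $\mathbf{n}=(n_1,\dots,n_r)$ be a tuple of positive integers with $n_1+\dots+n_r=n$, and let $\mathbf{t}\in\mathbf{T}_{\mathbf{n}}$. Write $\bigwedge^{\mathbf{t}}(V)$ for $\bigotimes_{i\in\mathbb{Z},\,1\le j\le r}\bigwedge^{\mathbf{t}(i,j)}V_{n_j}$. (1) The set $\{\bigotimes_{i\in\mathbb{Z},1\le j\le r}v_{n_j,X_{i,j}} : X_{i,j}\in\mathfrak{P}_{n_j,\mathbf{t}(i,j)}\ \forall i,j\}$ is a basis for $\bigwedge^{\mathbf{t}}(V)$. (2) The map $\mathfrak{B}_{\mathbf{t}}\to\prod_{i\in\mathbb{Z},1\le j\le r}\mathfrak{P}_{n_j,\mathbf{t}(i,j)}$, $B\mapsto(X^{\mathbf{n}}_{i,j}(B))_{i,j}$, is bijective. (3) The $\mathbb{C}(q)$-linear map $\Theta_{\mathbf{t}}:\mathcal{F}_{\mathbf{t}}\to\bigwedge^{\mathbf{t}}(V)$ defined by $B\mapsto\bigotimes_{i\in\mathbb{Z},1\le j\le r}v_{n_j,X^{\mathbf{n}}_{i,j}(B)}$ for all $B\in\mathfrak{B}_{\mathbf{t}}$ is bijective, and is an isomorphism of $\mathbf{U}(\mathbf{n})$-modules if $\bigwedge^{\mathbf{t}}(V)$ is viewed as $$\cdots\otimes\textstyle\bigwedge^{\mathbf{t}_{-1}}_{\mathbf{n}}(V)\otimes\bigwedge^{\mathbf{t}_0}_{\mathbf{n}}(V)\otimes\bigwedge^{\mathbf{t}_1}_{\mathbf{n}}(V)\otimes\cdots,$$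 where $\mathbf{t}_i=(\mathbf{t}(i,1),\dots,\mathbf{t}(i,r))$ for all $i\in\mathbb{Z}$.
   Context: $\mathbb{N}=\{1,2,\dots\}$, $\mathbb{N}_0=\{0,1,\dots\}$. A set of $\beta$-numbers is a subset $B\subseteq\mathbb{Z}$ with $|\mathbb{N}_0\cap B|+|\mathbb{Z}_{<0}\setminus B|<\infty$; $\mathfrak{B}$ is the collection of all of them. **Sections.** $\sigma_j=n_1+\dots+n_j$ ($\sigma_0=0$). For $i\in\mathbb{Z}$, $1\le j\le r$: $\mathbb{Z}^{\mathbf{n}}_{i,j}=\{x\in\mathbb{Z}:\sigma_{j-1}\le x-in<\sigma_j\}$; for $B\subseteq\mathbb{Z}$, $X^{\mathbf{n}}_{i,j}(B)=\{x-in-\sigma_{j-1}:x\in B\cap\mathbb{Z}^{\mathbf{n}}_{i,j}\}$ and $\mathtt{t}^{\mathbf{n}}_B(i,j)=|B\cap\mathbb{Z}^{\mathbf{n}}_{i,j}|$. $\mathbf{T}_{\mathbf{n}}$ is the set of functions $\mathbf{t}:\mathbb{Z}\times\{1,\dots,r\}\to\mathbb{N}_0$ with $\mathbf{t}(i,j)\le n_j$ for all $i,j$ and $\sum_{i\ge0,j}\mathbf{t}(i,j)+\sum_{i<0,j}(n_j-\mathbf{t}(i,j))<\infty$. $\mathfrak{B}_{\mathbf{t}}=\{B\in\mathfrak{B}:\mathtt{t}^{\mathbf{n}}_B=\mathbf{t}\}$ and $\mathcal{F}_{\mathbf{t}}$ is the $\mathbb{C}(q)$-vector space with basis $\mathfrak{B}_{\mathbf{t}}$.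 **The algebra $\mathbf{U}(\mathbf{n})$** is $U_q(\mathfrak{sl}_{n_1})\otimes\cdots\otimes U_q(\mathfrak{sl}_{n_r})$ over $\mathbb{C}(q)$ with the usual Drinfeld–Jimbo generators $e_i,f_i,K_i^\pm$ for $0\le i<n$, $i\notin\{\sigma_0,\dots,\sigma_{r-1}\}$; those with $\sigma_{j-1}<i<\sigma_j$ generate $U_q(\mathfrak{sl}_{n_j})$, as its generators of index $i-\sigma_{j-1}$ ($U_q(\mathfrak{sl}_1)=\mathbb{C}(q)$). Normalisation: $K_i^+e_iK_i^-=q^2e_i$, $e_if_i-f_ie_i=(K_i^+-K_i^-)/(q-q^{-1})$. Tensor products of $\mathbf{U}(\mathbf{n})$-modules use the coproduct $\Delta(e_i)=e_i\otimes1+K_i^-\otimes e_i$, $\Delta(f_i)=f_i\otimes K_i^++1\otimes f_i$, $\Delta(K_i^\pm)=K_i^\pm\otimes K_i^\pm$. **Action on $\mathcal{F}_{\mathbf{t}}$.** For $B\in\mathfrak{B}$, $x-1\in B$, $x\notin B$, $C=B\setminus\{x-1\}\cup\{x\}$, put $N_>(B,C)=|\{y\in B:y>x,\,y\equiv x-1\}|-|\{y\in B:y>x,\,y\equiv x\}|$, $N_<(B,C)=|\{y\notin B:y<x-1,\,y\equiv x-1\}|-|\{y\notin B:y<x-1,\,y\equiv x\}|$ (congruences mod $n$), and $N_i(B)=|\{y\notin B: y-1\in B,y\equiv i\}|-|\{y\in B:y-1\notin B,y\equiv i\}|$. Then $f_i(B)=\sum_Cq^{N_>(B,C)}C$ over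 all $C=B\setminus\{x-1\}\cup\{x\}$ with $x\equiv i \pmod n$, $x-1\in B$, $x\notin B$; $e_i(C)=\sum_Bq^{N_<(B,C)}B$ over all $B=C\setminus\{x\}\cup\{x-1\}$ with $x\equiv i\pmod n$, $x\in C$, $x-1\notin C$; $K_i^+(B)=q^{N_i(B)}B$. For the indices $i$ occurring in $\mathbf{U}(\mathbf{n})$ this preserves $\mathcal{F}_{\mathbf{t}}$. **Exterior powers.** $\mathfrak{P}_{m,d}$ is the set of $d$-element subsets of $\{0,\dots,m-1\}$. $V_m$ is the natural module of $U_q(\mathfrak{sl}_m)$ with basis $v_{m,0},\dots,v_{m,m-1}$; $\bigwedge^dV_m$ is the $U_q(\mathfrak{sl}_m)$-module with basis $v_{m,X}$ ($=v_{m,i_1}\wedge\cdots\wedge v_{m,i_d}$ for $X=\{i_1<\dots<i_d\}$), $X\in\mathfrak{P}_{m,d}$, with $f_iv_{m,X}=v_{m,X\cup\{i\}\setminus\{i-1\}}$ if $i-1\in X,i\notin X$ and $0$ otherwise; $e_iv_{m,X}=v_{m,X\cup\{i-1\}\setminus\{i\}}$ if $i\in X,i-1\notin X$ and $0$ otherwise; $K_i^+v_{m,X}=qv_{m,X}$, $q^{-1}v_{m,X}$, $v_{m,X}$ in the first, second, remaining case respectively. For $\mathbf{d}=(d_1,\dots,d_r)$ with $0\le d_j\le n_j$, $\bigwedge^{\mathbf{d}}_{\mathbf{n}}(V)=\bigwedge^{d_1}V_{n_1}\otimes\cdots\otimes\bigwedge^{d_r}V_{n_r}$ as a $\mathbf{U}(\mathbf{n})$-module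 (external tensor product). **Infinite tensor products.** For all but finitely many $i$ the factors $\bigwedge^{\mathbf{t}(i,j)}V_{n_j}$ have $\mathbf{t}(i,j)\in\{0,n_j\}$ and are canonically identified with the trivial module $\mathbb{C}(q)$ (the unique basis vector $v_{n_j,X}$ being $1$), so the tensor product is essentially finite. *)

theory Defs
  imports
    "HOL-Computational_Algebra.Fraction_Field"
    "HOL-Library.Poly_Mapping"
    "HOL-Number_Theory.Cong"
    "HOL-Algebra.AbelCoset"
    "Jordan_Normal_Form.VS_Connect"
begin

section \<open>Vector spaces over the field of rational functions\<close>

type_synonym Cq = "complex poly fract"

definition qq :: Cq where
  "qq = Fract [:0, 1:] 1"

text \<open>Vector spaces are \<open>vectorspace\<close>s in the sense of the AFP entry VectorSpace, over the
  following copy of the field \<open>Cq\<close>. The fields \<open>mult\<close> and \<open>one\<close> of a \<open>module\<close> record carry no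
  meaning for a vector space and are left undefined.\<close>

abbreviation CqF :: "Cq ring" where
  "CqF \<equiv> class_ring"

definition scale :: "Cq \<Rightarrow> ('a \<Rightarrow>\<^sub>0 Cq) \<Rightarrow> ('a \<Rightarrow>\<^sub>0 Cq)" where
  "scale c x = Poly_Mapping.map ((*) c) x"

text \<open>The vector space with basis \<open>A\<close>; \<open>b \<in> A\<close> is identified with \<open>Poly_Mapping.single b 1\<close>.\<close>

definition free_space :: "'a set \<Rightarrow> (Cq, 'a \<Rightarrow>\<^sub>0 Cq) module" where
  "free_space A = \<lparr>carrier = {x. Poly_Mapping.keys x \<subseteq> A},
     mult = undefined, one = undefined, zero = 0, add = (+), smult = scale\<rparr>"

definition lin_ext :: "('a \<Rightarrow> ('b \<Rightarrow>\<^sub>0 Cq)) \<Rightarrow> ('a \<Rightarrow>\<^sub>0 Cq) \<Rightarrow> ('b \<Rightarrow>\<^sub>0 Cq)" where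
  "lin_ext \<phi> x = (\<Sum>b\<in>Poly_Mapping.keys x. scale (Poly_Mapping.lookup x b) (\<phi> b))"

definition quotient_space :: "(Cq, 'v) module \<Rightarrow> 'v set \<Rightarrow> (Cq, 'v set) module" where
  "quotient_space V N = \<lparr>carrier = A_RCOSETS V N,
     mult = undefined, one = undefined, zero = N, add = set_add V,
     smult = (\<lambda>c C. \<Union>x\<in>C. a_r_coset V N (c \<odot>\<^bsub>V\<^esub> x))\<rparr>"

subsection \<open>Tensor products\<close>

text \<open>The tensor product of the spaces \<open>W k\<close>, \<open>k \<in> I\<close>, with respect to reference vectors \<open>u k\<close>:
  the vector space on the families \<open>w\<close> with \<open>w k = u k\<close> for almost all \<open>k\<close>, modulo
  multilinearity. If \<open>W k\<close> is one-dimensional with basis vector \<open>u k\<close> for all but finitely many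
  \<open>k\<close>, this is the tensor product in which those \<open>W k\<close> are identified with the ground field by
  sending \<open>u k\<close> to \<open>1\<close>; the reference vectors of the other finitely many factors are then
  irrelevant.\<close>

definition tensor_families ::
    "'k set \<Rightarrow> ('k \<Rightarrow> (Cq, 'v) module) \<Rightarrow> ('k \<Rightarrow> 'v) \<Rightarrow> ('k \<Rightarrow> 'v) set" where
  "tensor_families I W u = {w \<in> (\<Pi>\<^sub>E k\<in>I. carrier (W k)). finite {k \<in> I. w k \<noteq> u k}}"

definition tensor_relations ::
    "'k set \<Rightarrow> ('k \<Rightarrow> (Cq, 'v) module) \<Rightarrow> ('k \<Rightarrow> 'v) \<Rightarrow> (('k \<Rightarrow> 'v) \<Rightarrow>\<^sub>0 Cq) set" where
  "tensor_relations I W u =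
     {Poly_Mapping.single (w(k := x \<oplus>\<^bsub>W k\<^esub> y)) 1
        - Poly_Mapping.single (w(k := x)) 1 - Poly_Mapping.single (w(k := y)) 1 | w k x y.
        w \<in> tensor_families I W u \<and> k \<in> I \<and> x \<in> carrier (W k) \<and> y \<in> carrier (W k)}
   \<union> {Poly_Mapping.single (w(k := c \<odot>\<^bsub>W k\<^esub> x)) 1
        - scale c (Poly_Mapping.single (w(k := x)) 1) | w k c x.
        w \<in> tensor_families I W u \<and> k \<in> I \<and> x \<in> carrier (W k)}"

definition tensor_null ::
    "'k set \<Rightarrow> ('k \<Rightarrow> (Cq, 'v) module) \<Rightarrow> ('k \<Rightarrow> 'v) \<Rightarrow> (('k \<Rightarrow> 'v) \<Rightarrow>\<^sub>0 Cq) set" where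
  "tensor_null I W u =
     LinearCombinations.module.span CqF (free_space (tensor_families I W u))
       (tensor_relations I W u)"

definition tensor_space ::
    "'k set \<Rightarrow> ('k \<Rightarrow> (Cq, 'v) module) \<Rightarrow> ('k \<Rightarrow> 'v) \<Rightarrow> (Cq, (('k \<Rightarrow> 'v) \<Rightarrow>\<^sub>0 Cq) set) module" where
  "tensor_space I W u =
     quotient_space (free_space (tensor_families I W u)) (tensor_null I W u)"

definition pure_tensor ::
    "'k set \<Rightarrow> ('k \<Rightarrow> (Cq, 'v) module) \<Rightarrow> ('k \<Rightarrow> 'v) \<Rightarrow> ('k \<Rightarrow> 'v) \<Rightarrow> (('k \<Rightarrow> 'v) \<Rightarrow>\<^sub>0 Cq) set" where
  "pure_tensor I W u w =
     a_r_coset (free_space (tensor_families I W u)) (tensor_null I W u) (Poly_Mapping.single w 1)"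


section \<open>Beta-sets and their sections\<close>

text \<open>The tuple \<open>(n\<^sub>1, \<dots>, n\<^sub>r)\<close> is a list \<open>ns\<close>; \<open>part ns j\<close> is \<open>n\<^sub>j\<close> for \<open>1 \<le> j \<le> length ns\<close>, and
  the ambient \<open>n\<close> is \<open>sum_list ns\<close>.\<close>

definition part :: "nat list \<Rightarrow> nat \<Rightarrow> nat" where
  "part ns j = ns ! (j - 1)"

definition psum :: "nat list \<Rightarrow> nat \<Rightarrow> nat" where
  "psum ns j = sum_list (take j ns)"

definition idx :: "nat list \<Rightarrow> (int \<times> nat) set" where
  "idx ns = UNIV \<times> {1..length ns}"

definition beta_sets :: "int set set" where
  "beta_sets = {B. finite ({0..} \<inter> B) \<and> finite ({..<0} - B)}"

definition section_ints :: "nat list \<Rightarrow> int \<Rightarrow> nat \<Rightarrow> int set" where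
  "section_ints ns i j =
     {x. int (psum ns (j - 1)) \<le> x - i * int (sum_list ns) \<and>
         x - i * int (sum_list ns) < int (psum ns j)}"

definition section_set :: "nat list \<Rightarrow> int \<Rightarrow> nat \<Rightarrow> int set \<Rightarrow> nat set" where
  "section_set ns i j B =
     (\<lambda>x. nat (x - i * int (sum_list ns) - int (psum ns (j - 1)))) ` (B \<inter> section_ints ns i j)"

definition section_type :: "nat list \<Rightarrow> int set \<Rightarrow> int \<times> nat \<Rightarrow> nat" where
  "section_type ns B = (\<lambda>(i, j)\<in>idx ns. card (B \<inter> section_ints ns i j))"

text \<open>A sum of non-negative integers is finite iff only finitely many terms are non-zero.\<close>

definition types :: "nat list \<Rightarrow> (int \<times> nat \<Rightarrow> nat) set" where
  "types ns = {t \<in> (\<Pi>\<^sub>E (i, j)\<in>idx ns. {..part ns j}).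
     finite {(i, j). (i, j) \<in> idx ns \<and> 0 \<le> i \<and> t (i, j) \<noteq> 0} \<and>
     finite {(i, j). (i, j) \<in> idx ns \<and> i < 0 \<and> part ns j - t (i, j) \<noteq> 0}}"

definition beta_sets_of_type :: "nat list \<Rightarrow> (int \<times> nat \<Rightarrow> nat) \<Rightarrow> int set set" where
  "beta_sets_of_type ns t = {B \<in> beta_sets. section_type ns B = t}"

abbreviation fock_space :: "nat list \<Rightarrow> (int \<times> nat \<Rightarrow> nat) \<Rightarrow> (Cq, int set \<Rightarrow>\<^sub>0 Cq) module" where
  "fock_space ns t \<equiv> free_space (beta_sets_of_type ns t)"


section \<open>Modules over the algebra U(n)\<close>

text \<open>Generators \<open>e\<close>, \<open>f\<close>, \<open>K\<^sup>+\<close>, \<open>K\<^sup>-\<close>. A module over a presented algebra is a vector space together with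
  operators \<open>act g a\<close>, one for each generator \<open>g\<close> of index \<open>a\<close>, satisfying the defining relations.\<close>

datatype generator = Egen | Fgen | Kgen | Kinv

definition cartan :: "nat \<Rightarrow> nat \<Rightarrow> int" where
  "cartan a b = (if a = b then 2 else if a = Suc b \<or> b = Suc a then - 1 else 0)"

definition Uq_sl_module ::
    "nat \<Rightarrow> (Cq, 'v) module \<Rightarrow> (generator \<Rightarrow> nat \<Rightarrow> 'v \<Rightarrow> 'v) \<Rightarrow> bool" where
  "Uq_sl_module m V act \<longleftrightarrow>
     vectorspace CqF V \<and>
     (\<forall>g. \<forall>a\<in>{1..<m}. act g a \<in> LinearCombinations.module_hom CqF V V) \<and>
     (\<forall>a\<in>{1..<m}. \<forall>x\<in>carrier V.
        act Kgen a (act Kinv a x) = x \<and> act Kinv a (act Kgen a x) = x) \<and>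
     (\<forall>a\<in>{1..<m}. \<forall>b\<in>{1..<m}. \<forall>x\<in>carrier V.
        act Kgen a (act Kgen b x) = act Kgen b (act Kgen a x) \<and>
        act Kgen a (act Egen b (act Kinv a x)) = (qq powi cartan a b) \<odot>\<^bsub>V\<^esub> act Egen b x \<and>
        act Kgen a (act Fgen b (act Kinv a x)) = (qq powi (- cartan a b)) \<odot>\<^bsub>V\<^esub> act Fgen b x \<and>
        act Egen a (act Fgen b x) \<ominus>\<^bsub>V\<^esub> act Fgen b (act Egen a x) =
          (if a = b
           then (1 / (qq - inverse qq)) \<odot>\<^bsub>V\<^esub> (act Kgen a x \<ominus>\<^bsub>V\<^esub> act Kinv a x)
           else \<zero>\<^bsub>V\<^esub>)) \<and>
     (\<forall>g\<in>{Egen, Fgen}. \<forall>a\<in>{1..<m}. \<forall>b\<in>{1..<m}. \<forall>x\<in>carrier V.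
        (cartan a b = 0 \<longrightarrow> act g a (act g b x) = act g b (act g a x)) \<and>
        (cartan a b = - 1 \<longrightarrow>
           act g a (act g a (act g b x))
             \<ominus>\<^bsub>V\<^esub> (qq + inverse qq) \<odot>\<^bsub>V\<^esub> act g a (act g b (act g a x))
             \<oplus>\<^bsub>V\<^esub> act g b (act g a (act g a x)) = \<zero>\<^bsub>V\<^esub>))"

text \<open>A module over a tensor product of algebras is a vector space with commuting actions of the
  tensor factors.\<close>

definition Un_module ::
    "nat list \<Rightarrow> (Cq, 'v) module \<Rightarrow> (generator \<Rightarrow> nat \<Rightarrow> 'v \<Rightarrow> 'v) \<Rightarrow> bool" where
  "Un_module ns V act \<longleftrightarrow>
     vectorspace CqF V \<and>
     (\<forall>j\<in>{1..length ns}. Uq_sl_module (part ns j) V (\<lambda>g a. act g (psum ns (j - 1) + a))) \<and>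
     (\<forall>j\<in>{1..length ns}. \<forall>j'\<in>{1..length ns}. j \<noteq> j' \<longrightarrow>
        (\<forall>a b g h. psum ns (j - 1) < a \<and> a < psum ns j \<and> psum ns (j' - 1) < b \<and> b < psum ns j' \<longrightarrow>
           (\<forall>x\<in>carrier V. act g a (act h b x) = act h b (act g a x))))"

definition Un_indices :: "nat list \<Rightarrow> nat set" where
  "Un_indices ns = {0..<sum_list ns} - psum ns ` {0..<length ns}"

definition Un_iso ::
    "nat list \<Rightarrow> (Cq, 'v) module \<Rightarrow> (generator \<Rightarrow> nat \<Rightarrow> 'v \<Rightarrow> 'v) \<Rightarrow>
     (Cq, 'w) module \<Rightarrow> (generator \<Rightarrow> nat \<Rightarrow> 'w \<Rightarrow> 'w) \<Rightarrow> ('v \<Rightarrow> 'w) \<Rightarrow> bool" where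
  "Un_iso ns V act W act' h \<longleftrightarrow>
     Un_module ns V act \<and> Un_module ns W act' \<and>
     linear_map CqF V W h \<and> bij_betw h (carrier V) (carrier W) \<and>
     (\<forall>g. \<forall>a\<in>Un_indices ns. \<forall>x\<in>carrier V. h (act g a x) = act' g a (h x))"


section \<open>The action on the Fock space\<close>

text \<open>For \<open>C = B - {x - 1} \<union> {x}\<close> the element \<open>x\<close> is determined by \<open>B\<close> and \<open>C\<close>, so the exponents
  \<open>N\<^sub>>(B, C)\<close> and \<open>N\<^sub><(B, C)\<close> are written as functions of \<open>B\<close> and \<open>x\<close>, and the sums over \<open>C\<close>
  (respectively \<open>B\<close>) as sums over \<open>x\<close>.\<close>

definition N_gt :: "nat \<Rightarrow> int set \<Rightarrow> int \<Rightarrow> int" where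
  "N_gt n B x =
     int (card {y. y \<in> B \<and> y > x \<and> [y = x - 1] (mod int n)})
     - int (card {y. y \<in> B \<and> y > x \<and> [y = x] (mod int n)})"

definition N_lt :: "nat \<Rightarrow> int set \<Rightarrow> int \<Rightarrow> int" where
  "N_lt n B x =
     int (card {y. y \<notin> B \<and> y < x - 1 \<and> [y = x - 1] (mod int n)})
     - int (card {y. y \<notin> B \<and> y < x - 1 \<and> [y = x] (mod int n)})"

definition N_idx :: "nat \<Rightarrow> nat \<Rightarrow> int set \<Rightarrow> int" where
  "N_idx n i B =
     int (card {y. y \<notin> B \<and> y - 1 \<in> B \<and> [y = int i] (mod int n)})
     - int (card {y. y \<in> B \<and> y - 1 \<notin> B \<and> [y = int i] (mod int n)})"

fun fock_basis_act :: "nat \<Rightarrow> generator \<Rightarrow> nat \<Rightarrow> int set \<Rightarrow> (int set \<Rightarrow>\<^sub>0 Cq)" where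
  "fock_basis_act n Fgen i B =
     (\<Sum>x | [x = int i] (mod int n) \<and> x - 1 \<in> B \<and> x \<notin> B.
        Poly_Mapping.single ((B - {x - 1}) \<union> {x}) (qq powi N_gt n B x))"
| "fock_basis_act n Egen i C =
     (\<Sum>x | [x = int i] (mod int n) \<and> x \<in> C \<and> x - 1 \<notin> C.
        Poly_Mapping.single ((C - {x}) \<union> {x - 1}) (qq powi N_lt n ((C - {x}) \<union> {x - 1}) x))"
| "fock_basis_act n Kgen i B = Poly_Mapping.single B (qq powi N_idx n i B)"
| "fock_basis_act n Kinv i B = Poly_Mapping.single B (qq powi (- N_idx n i B))"

definition fock_act ::
    "nat \<Rightarrow> generator \<Rightarrow> nat \<Rightarrow> (int set \<Rightarrow>\<^sub>0 Cq) \<Rightarrow> (int set \<Rightarrow>\<^sub>0 Cq)" where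
  "fock_act n g i = lin_ext (fock_basis_act n g i)"


section \<open>Exterior powers and their tensor product\<close>

definition dsubsets :: "nat \<Rightarrow> nat \<Rightarrow> nat set set" where
  "dsubsets m d = {X. X \<subseteq> {..<m} \<and> card X = d}"

abbreviation wedge_space :: "nat \<Rightarrow> nat \<Rightarrow> (Cq, nat set \<Rightarrow>\<^sub>0 Cq) module" where
  "wedge_space m d \<equiv> free_space (dsubsets m d)"

abbreviation wedge_vec :: "nat set \<Rightarrow> (nat set \<Rightarrow>\<^sub>0 Cq)" where
  "wedge_vec X \<equiv> Poly_Mapping.single X 1"

fun wedge_basis_act :: "generator \<Rightarrow> nat \<Rightarrow> nat set \<Rightarrow> (nat set \<Rightarrow>\<^sub>0 Cq)" where
  "wedge_basis_act Fgen i X =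
     (if i - 1 \<in> X \<and> i \<notin> X then wedge_vec ((X \<union> {i}) - {i - 1}) else 0)"
| "wedge_basis_act Egen i X =
     (if i \<in> X \<and> i - 1 \<notin> X then wedge_vec ((X \<union> {i - 1}) - {i}) else 0)"
| "wedge_basis_act Kgen i X =
     (if i - 1 \<in> X \<and> i \<notin> X then scale qq (wedge_vec X)
      else if i \<in> X \<and> i - 1 \<notin> X then scale (inverse qq) (wedge_vec X)
      else wedge_vec X)"
| "wedge_basis_act Kinv i X =
     (if i - 1 \<in> X \<and> i \<notin> X then scale (inverse qq) (wedge_vec X)
      else if i \<in> X \<and> i - 1 \<notin> X then scale qq (wedge_vec X)
      else wedge_vec X)"

definition wedge_act :: "generator \<Rightarrow> nat \<Rightarrow> (nat set \<Rightarrow>\<^sub>0 Cq) \<Rightarrow> (nat set \<Rightarrow>\<^sub>0 Cq)" where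
  "wedge_act g i = lin_ext (wedge_basis_act g i)"

text \<open>The factors of the tensor product, and the vectors identified with \<open>1\<close> in the factors with
  \<open>t (i, j) \<in> {0, n\<^sub>j}\<close> (where \<open>{..<t (i, j)}\<close> is the only \<open>t (i, j)\<close>-element subset).\<close>

definition wedge_factors :: "nat list \<Rightarrow> (int \<times> nat \<Rightarrow> nat) \<Rightarrow> int \<times> nat \<Rightarrow> (Cq, nat set \<Rightarrow>\<^sub>0 Cq) module" where
  "wedge_factors ns t = (\<lambda>(i, j). wedge_space (part ns j) (t (i, j)))"

definition wedge_units :: "(int \<times> nat \<Rightarrow> nat) \<Rightarrow> int \<times> nat \<Rightarrow> (nat set \<Rightarrow>\<^sub>0 Cq)" where
  "wedge_units t = (\<lambda>(i, j). wedge_vec {..<t (i, j)})"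

definition Wedge ::
    "nat list \<Rightarrow> (int \<times> nat \<Rightarrow> nat) \<Rightarrow> (Cq, ((int \<times> nat \<Rightarrow> (nat set \<Rightarrow>\<^sub>0 Cq)) \<Rightarrow>\<^sub>0 Cq) set) module" where
  "Wedge ns t = tensor_space (idx ns) (wedge_factors ns t) (wedge_units t)"

definition Wedge_basis_vec ::
    "nat list \<Rightarrow> (int \<times> nat \<Rightarrow> nat) \<Rightarrow> (int \<times> nat \<Rightarrow> nat set) \<Rightarrow>
     ((int \<times> nat \<Rightarrow> (nat set \<Rightarrow>\<^sub>0 Cq)) \<Rightarrow>\<^sub>0 Cq) set" where
  "Wedge_basis_vec ns t X =
     pure_tensor (idx ns) (wedge_factors ns t) (wedge_units t) (\<lambda>k\<in>idx ns. wedge_vec (X k))"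

definition subset_families :: "nat list \<Rightarrow> (int \<times> nat \<Rightarrow> nat) \<Rightarrow> (int \<times> nat \<Rightarrow> nat set) set" where
  "subset_families ns t = (\<Pi>\<^sub>E (i, j)\<in>idx ns. dsubsets (part ns j) (t (i, j)))"

subsection \<open>The action via the iterated coproduct\<close>

text \<open>\<open>None\<close> stands for the unit of the algebra. A list of pairs represents the sum of the
  corresponding tensors; the index of the generators is the same throughout.\<close>

fun coproduct :: "generator option \<Rightarrow> (generator option \<times> generator option) list" where
  "coproduct None = [(None, None)]"
| "coproduct (Some Egen) = [(Some Egen, None), (Some Kinv, Some Egen)]"
| "coproduct (Some Fgen) = [(Some Fgen, Some Kgen), (None, Some Fgen)]"
| "coproduct (Some Kgen) = [(Some Kgen, Some Kgen)]"
| "coproduct (Some Kinv) = [(Some Kinv, Some Kinv)]"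

text \<open>The iterated coproduct of a generator, for tensor factors labelled by the entries of a list
  from left to right, again as a sum of terms. The empty list is the trivial module, on which \<open>e\<close>
  and \<open>f\<close> act as \<open>0\<close> and \<open>K\<^sup>\<plusminus>\<close> as \<open>1\<close>.\<close>

fun iterated_coproduct :: "int list \<Rightarrow> generator option \<Rightarrow> (int \<Rightarrow> generator option) list" where
  "iterated_coproduct [] g = (if g = Some Egen \<or> g = Some Fgen then [] else [\<lambda>_. None])"
| "iterated_coproduct (l # ls) g =
     concat (map (\<lambda>(g1, g2). map (\<lambda>\<gamma>. \<gamma>(l := g1)) (iterated_coproduct ls g2)) (coproduct g))"

text \<open>The levels \<open>i\<close> at which the external tensor product over \<open>j\<close> of the exterior powers is not
  identified with the trivial module, in increasing order.\<close>

definition levels :: "nat list \<Rightarrow> (int \<times> nat \<Rightarrow> nat) \<Rightarrow> int list" where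
  "levels ns t =
     sorted_list_of_set {i. \<exists>j\<in>{1..length ns}. t (i, j) \<noteq> 0 \<and> t (i, j) \<noteq> part ns j}"

text \<open>At each level \<open>i\<close>, the generator \<open>\<gamma> i\<close> of index \<open>a\<close> acts on the external tensor product over
  \<open>j\<close> through the factor with \<open>\<sigma>\<^bsub>j-1\<^esub> < a < \<sigma>\<^sub>j\<close>, as the generator of index
  \<open>a - \<sigma>\<^bsub>j-1\<^esub>\<close>.\<close>

definition family_act ::
    "nat list \<Rightarrow> nat \<Rightarrow> (int \<Rightarrow> generator option) \<Rightarrow> (int \<times> nat \<Rightarrow> (nat set \<Rightarrow>\<^sub>0 Cq)) \<Rightarrow>
     (int \<times> nat \<Rightarrow> (nat set \<Rightarrow>\<^sub>0 Cq))" where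
  "family_act ns a \<gamma> w =
     (\<lambda>(i, j)\<in>idx ns.
        if psum ns (j - 1) < a \<and> a < psum ns j
        then (case \<gamma> i of None \<Rightarrow> w (i, j) | Some g \<Rightarrow> wedge_act g (a - psum ns (j - 1)) (w (i, j)))
        else w (i, j))"

text \<open>The action on the quotient: \<open>C\<close> is a coset, and all its elements yield the same coset.\<close>

definition Wedge_act ::
    "nat list \<Rightarrow> (int \<times> nat \<Rightarrow> nat) \<Rightarrow> generator \<Rightarrow> nat \<Rightarrow>
     ((int \<times> nat \<Rightarrow> (nat set \<Rightarrow>\<^sub>0 Cq)) \<Rightarrow>\<^sub>0 Cq) set \<Rightarrow> ((int \<times> nat \<Rightarrow> (nat set \<Rightarrow>\<^sub>0 Cq)) \<Rightarrow>\<^sub>0 Cq) set" where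
  "Wedge_act ns t g a C =
     (\<Union>x\<in>C. a_r_coset
        (free_space (tensor_families (idx ns) (wedge_factors ns t) (wedge_units t)))
        (tensor_null (idx ns) (wedge_factors ns t) (wedge_units t))
        (lin_ext (\<lambda>w. \<Sum>\<gamma>\<leftarrow>iterated_coproduct (levels ns t) (Some g).
                        Poly_Mapping.single (family_act ns a \<gamma> w) 1) x))"


section \<open>The map Theta\<close>

definition sections :: "nat list \<Rightarrow> int set \<Rightarrow> (int \<times> nat \<Rightarrow> nat set)" where
  "sections ns B = (\<lambda>(i, j)\<in>idx ns. section_set ns i j B)"

definition Theta ::
    "nat list \<Rightarrow> (int \<times> nat \<Rightarrow> nat) \<Rightarrow> (int set \<Rightarrow>\<^sub>0 Cq) \<Rightarrow>
     ((int \<times> nat \<Rightarrow> (nat set \<Rightarrow>\<^sub>0 Cq)) \<Rightarrow>\<^sub>0 Cq) set" where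
  "Theta ns t x =
     (\<Oplus>\<^bsub>Wedge ns t\<^esub>B\<in>Poly_Mapping.keys x.
        Poly_Mapping.lookup x B \<odot>\<^bsub>Wedge ns t\<^esub> Wedge_basis_vec ns t (sections ns B))"

end

theory Submission
  imports Defs
begin

text \<open>Cut \<open>\<int>\<close> into the intervals belonging to the pairs \<open>(i, j)\<close>. A set of integers is the same
  thing as the family of its sections, and any family of subsets with cardinalities \<open>t (i, j)\<close>
  glues to a \<open>\<beta>\<close>-set, because the type \<open>t\<close> forces almost all sections of level \<open>i \<ge> 0\<close> to be empty
  and almost all sections of level \<open>i < 0\<close> to be full. This is the bijection
  (\<open>bij_betw_sections\<close>).

  The tensor product is a quotient of the free space on families of vectors by the
  multilinearity relations. Multiplying coefficients gives a linear map \<open>ev\<close> from that free space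
  to the free space on families of basis labels. It kills the relations, and modulo the relations
  every family equals the combination of basis families that \<open>ev\<close> prescribes, as one sees by
  expanding one entry at a time (\<open>single_minus_lift\<close>). Hence the span of the relations is exactly
  the kernel of \<open>ev\<close> (\<open>null_eq_kernel\<close>), an element of the tensor product is a fibre of \<open>ev\<close>, and the
  pure tensors of basis vectors form a basis. Through this description \<open>Theta\<close> is the linear
  extension of a bijection of bases (\<open>lin_bij_Theta\<close>).

  For the actions, let \<open>a\<close> be the index of a generator. Moving \<open>x - 1\<close> to \<open>x \<equiv> a\<close> changes a single
  section, say at level \<open>l\<close>, in the way \<open>f\<close> acts on an exterior power. The iterated coproduct of \<open>f\<close>
  is a sum over the level \<open>l\<close> at which \<open>f\<close> acts, with \<open>K\<^sup>+\<close> acting on all higher levels; the product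
  of the resulting scalars is \<open>q\<close> to the sum of the local weights above \<open>l\<close>, and this sum is the
  difference of cardinalities \<open>N\<^sub>>\<close>, since the weight at a level is \<open>\<plusminus>1\<close> or \<open>0\<close> according to which of
  the two sites congruent to \<open>a - 1\<close> and \<open>a\<close> is occupied (\<open>N_gt_eq\<close>, \<open>ev_one_move\<close>). The
  generator \<open>e\<close> is the mirror image with \<open>K\<^sup>-\<close> on the lower levels.

  It remains that both spaces are modules. The relations are verified on the Fock space and carried
  over by \<open>Theta\<close>. There \<open>e\<close> and \<open>f\<close> are finite sums of hopping operators, one for each level.
  Hopping operators at different levels commute up to an explicit power of \<open>q\<close> (\<open>hop_commute\<close>), and
  all relations reduce to this rule and to easy facts about one level: in the Serre relation the
  terms belonging to the levels \<open>l\<^sub>1, l\<^sub>2\<close> of the two equal generators cancel against those with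
  \<open>l\<^sub>1\<close> and \<open>l\<^sub>2\<close> exchanged (\<open>serre_term_hop\<close>), and in \<open>e f - f e\<close> only the diagonal terms survive
  and telescope to \<open>K\<^sup>+ - K\<^sup>-\<close> (\<open>telescope_powers\<close>).\<close>

section \<open>Linear maps between free spaces\<close>

abbreviation single :: "'a \<Rightarrow> 'b \<Rightarrow> ('a \<Rightarrow>\<^sub>0 'b::zero)" where
  "single \<equiv> Poly_Mapping.single"

abbreviation lookup :: "('a \<Rightarrow>\<^sub>0 'b::zero) \<Rightarrow> 'a \<Rightarrow> 'b" where
  "lookup \<equiv> Poly_Mapping.lookup"

abbreviation keys :: "('a \<Rightarrow>\<^sub>0 'b::zero) \<Rightarrow> 'a set" where
  "keys \<equiv> Poly_Mapping.keys"

lemma lookup_scale [simp]: "lookup (scale c x) k = c * lookup x k"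
  by (cases "lookup x k = 0") (auto simp: scale_def map.rep_eq when_def)

lemma scale_simps [simp]:
  "scale c 0 = 0" "scale 0 x = 0" "scale 1 x = x"
  "scale c (scale d x) = scale (c * d) x" "scale c (single b d) = single b (c * d)"
  by (auto intro!: poly_mapping_eqI simp: lookup_single when_def)

lemma scale_add: "scale c (x + y) = scale c x + scale c y"
  and scale_diff: "scale c (x - y) = scale c x - scale c y"
  and scale_add_left: "scale (c + d) x = scale c x + scale d x"
  by (auto intro!: poly_mapping_eqI simp: lookup_add lookup_minus algebra_simps)

lemma scale_sum: "scale c (sum f A) = (\<Sum>a\<in>A. scale c (f a))"
  by (rule poly_mapping_eqI) (simp add: lookup_sum sum_distrib_left)

lemma keys_scale: "keys (scale c x) \<subseteq> keys x"
  by (auto simp: in_keys_iff)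

lemma keys_subset:
  "keys x \<subseteq> A \<Longrightarrow> keys y \<subseteq> A \<Longrightarrow> keys (x + y) \<subseteq> A"
  "keys x \<subseteq> A \<Longrightarrow> keys y \<subseteq> A \<Longrightarrow> keys (x - y) \<subseteq> A"
  "keys x \<subseteq> A \<Longrightarrow> keys (scale c x) \<subseteq> A"
  by (rule subset_trans[OF keys_add] subset_trans[OF keys_diff] subset_trans[OF keys_scale];
      simp)+

lemma sum_single_lookup: "(\<Sum>b\<in>keys x. single b (lookup x b)) = x"
  by (rule poly_mapping_eqI)
    (auto simp: lookup_sum lookup_single when_def in_keys_iff sum.delta)

lemma keys_single_subset: "e \<in> A \<Longrightarrow> keys (single e c) \<subseteq> A"
  by simp

lemma lin_ext_superset:
  assumes "finite A" "keys x \<subseteq> A"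
  shows "lin_ext \<phi> x = (\<Sum>b\<in>A. scale (lookup x b) (\<phi> b))"
  unfolding lin_ext_def
  by (rule sum.mono_neutral_left) (use assms in \<open>auto simp: in_keys_iff\<close>)

lemma lin_ext_add: "lin_ext \<phi> (x + y) = lin_ext \<phi> x + lin_ext \<phi> y"
  using keys_add[of x y]
  by (simp add: lin_ext_superset[of "keys x \<union> keys y"] lookup_add scale_add_left sum.distrib)

lemma lin_ext_scale: "lin_ext \<phi> (scale c x) = scale c (lin_ext \<phi> x)"
  using keys_scale[of c x]
  by (simp add: lin_ext_superset[of "keys x"] scale_sum)

lemma lin_ext_zero [simp]: "lin_ext \<phi> 0 = 0"
  by (simp add: lin_ext_def)

lemma lin_ext_single [simp]: "lin_ext \<phi> (single b c) = scale c (\<phi> b)"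
  by (simp add: lin_ext_superset[of "{b}"])

lemma lin_ext_diff: "lin_ext \<phi> (x - y) = lin_ext \<phi> x - lin_ext \<phi> y"
  using lin_ext_add[of \<phi> "x - y" y] by simp

lemma lin_ext_sum: "lin_ext \<phi> (sum f A) = (\<Sum>a\<in>A. lin_ext \<phi> (f a))"
  by (induction A rule: infinite_finite_induct) (auto simp: lin_ext_add)

lemma lin_ext_lin_ext: "lin_ext \<phi> (lin_ext \<psi> x) = lin_ext (\<lambda>b. lin_ext \<phi> (\<psi> b)) x"
  by (simp add: lin_ext_def[of _ x] lin_ext_def[of \<psi> x] lin_ext_sum lin_ext_scale)

lemma lin_ext_cong: "(\<And>b. b \<in> keys x \<Longrightarrow> \<phi> b = \<psi> b) \<Longrightarrow> lin_ext \<phi> x = lin_ext \<psi> x"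
  by (simp add: lin_ext_def)

lemma lin_ext_id [simp]: "lin_ext (\<lambda>b. single b 1) x = x"
  by (simp add: lin_ext_def sum_single_lookup)

lemma lin_ext_sum_fun: "lin_ext (\<lambda>b. \<Sum>a\<in>A. \<phi> a b) x = (\<Sum>a\<in>A. lin_ext (\<phi> a) x)"
  unfolding lin_ext_def scale_sum by (rule sum.swap)

lemma lin_ext_diff_fun: "lin_ext (\<lambda>b. \<phi> b - \<psi> b) x = lin_ext \<phi> x - lin_ext \<psi> x"
  by (simp add: lin_ext_def scale_diff sum_subtractf)

lemma lin_ext_eqI:
  assumes "\<And>b. lin_ext \<phi> (\<psi> b) = scale c (lin_ext \<phi>' (\<psi>' b))"
  shows "lin_ext \<phi> (lin_ext \<psi> x) = scale c (lin_ext \<phi>' (lin_ext \<psi>' x))"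
proof -
  have "lin_ext \<phi> (lin_ext \<psi> x) = lin_ext (\<lambda>b. scale c (lin_ext \<phi>' (\<psi>' b))) x"
    by (simp add: lin_ext_lin_ext assms)
  also have "\<dots> = scale c (lin_ext (\<lambda>b. lin_ext \<phi>' (\<psi>' b)) x)"
    by (simp only: lin_ext_def[of _ x] scale_sum scale_simps ac_simps)
  also have "\<dots> = scale c (lin_ext \<phi>' (lin_ext \<psi>' x))"
    by (simp only: lin_ext_lin_ext)
  finally show ?thesis .
qed

lemma lin_ext_zero_fun [simp]: "lin_ext (\<lambda>b. 0) x = 0"
  by (simp add: lin_ext_def)

lemma lin_ext_add_fun: "lin_ext (\<lambda>b. \<phi> b + \<psi> b) x = lin_ext \<phi> x + lin_ext \<psi> x"
  by (simp add: lin_ext_def scale_add sum.distrib)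

lemma single_sum: "single b (\<Sum>i\<in>I. f i) = (\<Sum>i\<in>I. single b (f i))"
  by (induction I rule: infinite_finite_induct) (simp_all add: single_add)

lemma keys_lin_ext:
  assumes "\<And>b. b \<in> keys x \<Longrightarrow> keys (\<phi> b) \<subseteq> S"
  shows "keys (lin_ext \<phi> x) \<subseteq> S"
proof -
  have "keys (scale (lookup x b) (\<phi> b)) \<subseteq> S" if "b \<in> keys x" for b
    using keys_scale assms[OF that] by (rule subset_trans)
  then show ?thesis
    unfolding lin_ext_def by (intro subset_trans[OF keys_sum]) auto
qed

lemma free_space_sel [simp]:
  "carrier (free_space A) = {x. keys x \<subseteq> A}" "x \<oplus>\<^bsub>free_space A\<^esub> y = x + y"
  "\<zero>\<^bsub>free_space A\<^esub> = 0" "c \<odot>\<^bsub>free_space A\<^esub> x = scale c x"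
  by (simp_all add: free_space_def)

lemma vectorspace_free_space: "vectorspace CqF (free_space A)"
proof (rule vs_criteria)
  show "\<forall>v\<in>carrier (free_space A). \<exists>w\<in>carrier (free_space A).
      v \<oplus>\<^bsub>free_space A\<^esub> w = \<zero>\<^bsub>free_space A\<^esub>"
  proof
    fix v assume "v \<in> carrier (free_space A)"
    then show "\<exists>w\<in>carrier (free_space A). v \<oplus>\<^bsub>free_space A\<^esub> w = \<zero>\<^bsub>free_space A\<^esub>"
      by (intro bexI[of _ "- v"]) auto
  qed
  show "\<forall>v w. v \<in> carrier (free_space A) \<and> w \<in> carrier (free_space A) \<longrightarrow>
      v \<oplus>\<^bsub>free_space A\<^esub> w \<in> carrier (free_space A)"
    by (simp add: keys_subset)
  show "\<forall>c v. c \<in> carrier CqF \<and> v \<in> carrier (free_space A) \<longrightarrow>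
      c \<odot>\<^bsub>free_space A\<^esub> v \<in> carrier (free_space A)"
    by (simp add: keys_subset)
  show "field CqF" by (rule class_field)
qed (simp_all only: free_space_sel ring_record_simps monoid.simps ring.simps partial_object.simps scale_simps scale_add scale_add_left add_0_right keys_zero mem_Collect_eq, simp_all add: ac_simps)

lemma free_space_minus [simp]:
  assumes "keys x \<subseteq> A" "keys y \<subseteq> A"
  shows "x \<ominus>\<^bsub>free_space A\<^esub> y = x - y"
proof -
  interpret vectorspace CqF "free_space A" by (rule vectorspace_free_space)
  have "\<ominus>\<^bsub>free_space A\<^esub> y = - y"
    by (rule minus_equality) (use assms in simp_all)
  then show ?thesis by (simp add: a_minus_def)
qed

lemma finsum_free_space:
  assumes "\<And>a. a \<in> I \<Longrightarrow> keys (f a) \<subseteq> A"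
  shows "(\<Oplus>\<^bsub>free_space A\<^esub>a\<in>I. f a) = (\<Sum>a\<in>I. f a)"
proof -
  interpret vectorspace CqF "free_space A" by (rule vectorspace_free_space)
  show ?thesis using assms
    by (induction I rule: infinite_finite_induct) (auto simp: Pi_def)
qed

lemma qq_neq_0 [simp]: "qq \<noteq> 0"
proof -
  have "Fract [:0, 1:] 1 \<noteq> Fract (0 :: complex poly) 1"
    by (subst eq_fract) auto
  then show ?thesis by (simp only: qq_def Zero_fract_def simp_thms)
qed

lemma qq_minus_inverse: "qq - inverse qq \<noteq> 0"
proof -
  have "Fract ([:0, 1:] * [:0, 1:]) 1 \<noteq> Fract (1 :: complex poly) 1"
    by (subst eq_fract) (auto simp: one_pCons)
  then have "qq * qq \<noteq> 1"
    by (simp only: qq_def One_fract_def mult_fract mult_1_right simp_thms)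
  then show ?thesis
    by (metis eq_iff_diff_eq_0 qq_neq_0 right_inverse)
qed


section \<open>Transport of vector space structures\<close>

text \<open>A linear bijection onto a structure \<open>W\<close> that need not be known to be a vector space: the quotient
  spaces below acquire their vector space axioms through such a map.\<close>

definition lin_bij :: "(Cq, 'v) module \<Rightarrow> (Cq, 'w) module \<Rightarrow> ('v \<Rightarrow> 'w) \<Rightarrow> bool" where
  "lin_bij V W h \<longleftrightarrow> bij_betw h (carrier V) (carrier W) \<and> h \<zero>\<^bsub>V\<^esub> = \<zero>\<^bsub>W\<^esub> \<and>
     (\<forall>x\<in>carrier V. \<forall>y\<in>carrier V. h (x \<oplus>\<^bsub>V\<^esub> y) = h x \<oplus>\<^bsub>W\<^esub> h y) \<and>
     (\<forall>c. \<forall>x\<in>carrier V. h (c \<odot>\<^bsub>V\<^esub> x) = c \<odot>\<^bsub>W\<^esub> h x)"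

lemma lin_bijD:
  assumes "lin_bij V W h"
  shows "carrier W = h ` carrier V" "inj_on h (carrier V)" "\<zero>\<^bsub>W\<^esub> = h \<zero>\<^bsub>V\<^esub>"
    "\<And>x y. x \<in> carrier V \<Longrightarrow> y \<in> carrier V \<Longrightarrow> h x \<oplus>\<^bsub>W\<^esub> h y = h (x \<oplus>\<^bsub>V\<^esub> y)"
    "\<And>c x. x \<in> carrier V \<Longrightarrow> c \<odot>\<^bsub>W\<^esub> h x = h (c \<odot>\<^bsub>V\<^esub> x)"
  using assms by (auto simp: lin_bij_def bij_betw_def)

lemma vectorspace_transport:
  assumes V: "vectorspace CqF V" and h: "lin_bij V W h"
  shows "vectorspace CqF W"
proof -
  interpret vectorspace CqF V by (rule V)
  note h' = lin_bijD[OF h]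
  have smult: "(a * b) \<odot>\<^bsub>V\<^esub> x = a \<odot>\<^bsub>V\<^esub> (b \<odot>\<^bsub>V\<^esub> x)" "1 \<odot>\<^bsub>V\<^esub> x = x"
    "(a + b) \<odot>\<^bsub>V\<^esub> x = a \<odot>\<^bsub>V\<^esub> x \<oplus>\<^bsub>V\<^esub> b \<odot>\<^bsub>V\<^esub> x" if "x \<in> carrier V" for a b x
    using smult_assoc1[of a b x] smult_l_distr[of a b x] smult_one[of x] that by simp_all
  show ?thesis
  proof (rule vs_criteria)
    show "\<forall>v\<in>carrier W. \<exists>w\<in>carrier W. v \<oplus>\<^bsub>W\<^esub> w = \<zero>\<^bsub>W\<^esub>"
    proof
      fix v assume "v \<in> carrier W"
      then obtain x where "x \<in> carrier V" "v = h x" by (auto simp: h'(1))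
      then show "\<exists>w\<in>carrier W. v \<oplus>\<^bsub>W\<^esub> w = \<zero>\<^bsub>W\<^esub>"
        by (intro bexI[of _ "h (\<ominus>\<^bsub>V\<^esub> x)"]) (auto simp: h' r_neg)
    qed
    show "field CqF" by (rule class_field)
  qed (auto simp: h' a_ac smult smult_r_distr)
qed

lemma linear_map_transport:
  assumes V: "vectorspace CqF V" and h: "lin_bij V W h"
  shows "linear_map CqF V W h"
proof -
  interpret V: vectorspace CqF V by (rule V)
  interpret W: vectorspace CqF W by (rule vectorspace_transport[OF V h])
  have "h \<in> LinearCombinations.module_hom CqF V W"
    using h by (auto simp: LinearCombinations.module_hom_def lin_bij_def bij_betw_def)
  then show ?thesis by unfold_locales
qed


lemma finsum_transport:
  assumes V: "vectorspace CqF V" and h: "lin_bij V W h" and f: "f \<in> I \<rightarrow> carrier V"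
  shows "(\<Oplus>\<^bsub>W\<^esub>i\<in>I. h (f i)) = h (\<Oplus>\<^bsub>V\<^esub>i\<in>I. f i)"
proof -
  interpret V: vectorspace CqF V by (rule V)
  interpret W: vectorspace CqF W by (rule vectorspace_transport[OF V h])
  note h' = lin_bijD[OF h]
  show ?thesis using f
  proof (induction I rule: infinite_finite_induct)
    case (insert i I)
    then have "f \<in> I \<rightarrow> carrier V" "f i \<in> carrier V" "(\<lambda>i. h (f i)) \<in> I \<rightarrow> carrier W" "h (f i) \<in> carrier W"
      by (auto simp: h'(1))
    then show ?case using insert by (simp add: h'(4))
  qed (simp_all add: h'(3))
qed

text \<open>Linear combinations correspond under a linear bijection, so independence and spanning are
  inherited from the unit vectors.\<close>

lemma basis_transport:
  assumes h: "lin_bij (free_space E) W h"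
  shows "vectorspace.basis CqF W ((\<lambda>e. h (single e 1)) ` E)"
proof -
  interpret W: vectorspace CqF W by (rule vectorspace_transport[OF vectorspace_free_space h])
  note h' = lin_bijD[OF h]
  let ?g = "\<lambda>e. h (single e 1)"
  have inj: "inj_on ?g E"
  proof (rule inj_onI)
    fix e e' assume e: "e \<in> E" "e' \<in> E" and eq: "?g e = ?g e'"
    have "single e (1 :: Cq) = single e' 1"
      by (rule inj_onD[OF h'(2) eq]) (use e in simp_all)
    then have "lookup (single e (1 :: Cq)) e = lookup (single e' 1) e" by simp
    then show "e = e'" by (simp add: lookup_single when_def split: if_splits)
  qed
  have sub: "?g ` E \<subseteq> carrier W" by (auto simp: h'(1))
  have lincomb: "W.lincomb a (?g ` J) = h (\<Sum>e\<in>J. single e (a (?g e)))" if J: "J \<subseteq> E" for a J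
  proof -
    have "W.lincomb a (?g ` J) = (\<Oplus>\<^bsub>W\<^esub>e\<in>J. a (?g e) \<odot>\<^bsub>W\<^esub> ?g e)"
      unfolding W.lincomb_def
      by (rule W.finsum_reindex) (use J inj_on_subset[OF inj J] sub in \<open>auto intro!: W.smult_closed\<close>)
    also have "\<dots> = (\<Oplus>\<^bsub>W\<^esub>e\<in>J. h (single e (a (?g e))))"
      by (rule W.finsum_cong') (use J in \<open>auto simp: h'(5) h'(1)\<close>)
    also have "\<dots> = h (\<Oplus>\<^bsub>free_space E\<^esub>e\<in>J. single e (a (?g e)))"
      by (rule finsum_transport[OF vectorspace_free_space h]) (use J in \<open>simp add: subset_iff\<close>)
    also have "\<dots> = h (\<Sum>e\<in>J. single e (a (?g e)))"
      by (subst finsum_free_space[OF keys_single_subset]) (use J in blast, rule refl)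
    finally show ?thesis .
  qed
  have in_free: "(\<Sum>e\<in>J. single e (a e)) \<in> carrier (free_space E)" if "J \<subseteq> E" for a J
    unfolding free_space_sel mem_Collect_eq
    by (intro subset_trans[OF keys_sum] UN_least keys_single_subset) (rule subsetD[OF that])
  show ?thesis
    unfolding W.basis_def
  proof (intro conjI sub)
    \<comment> \<open>A vanishing combination is the image of a vector of the free space, whose coefficients can be read off.\<close>
    show "\<not> W.lin_dep (?g ` E)"
    proof
      assume "W.lin_dep (?g ` E)"
      then obtain A a v where A: "finite A" "A \<subseteq> ?g ` E" "W.lincomb a A = \<zero>\<^bsub>W\<^esub>" "v \<in> A" "a v \<noteq> 0"
        unfolding W.lin_dep_def by auto
      then obtain J where J: "J \<subseteq> E" "A = ?g ` J" by (auto simp: subset_image_iff)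
      have finJ: "finite J" using A(1) J inj by (simp add: finite_image_iff inj_on_subset)
      from A(4) J obtain e where e: "e \<in> J" "v = ?g e" by auto
      have "h (\<Sum>e\<in>J. single e (a (?g e))) = h 0"
        using A(3) lincomb[OF J(1), of a] h'(3) by (simp add: J)
      then have "(\<Sum>e\<in>J. single e (a (?g e))) = 0"
        by (rule inj_onD[OF h'(2)]) (use in_free[OF J(1)] in simp_all)
      then have "lookup (\<Sum>e\<in>J. single e (a (?g e))) e = 0" by simp
      then have "a v = 0" using e finJ by (simp add: lookup_sum lookup_single when_def)
      then show False using A by simp
    qed
    show "W.span (?g ` E) = carrier W"
    proof
      show "W.span (?g ` E) \<subseteq> carrier W"
        using sub by (auto simp: W.span_def intro!: W.lincomb_closed)
      show "carrier W \<subseteq> W.span (?g ` E)"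
      proof
        fix w assume "w \<in> carrier W"
        then obtain x where x: "keys x \<subseteq> E" "w = h x" by (auto simp: h'(1))
        let ?a = "\<lambda>v. lookup x (inv_into E ?g v)"
        have "W.lincomb ?a (?g ` keys x) = h (\<Sum>e\<in>keys x. single e (lookup x e))"
          unfolding lincomb[OF x(1)]
          by (intro arg_cong[of _ _ h] sum.cong refl) (use x(1) in \<open>simp add: inv_into_f_f[OF inj] subset_iff\<close>)
        then have "w = W.lincomb ?a (?g ` keys x)" by (simp add: x(2) sum_single_lookup)
        then show "w \<in> W.span (?g ` E)"
          unfolding W.span_def using x(1) by (intro CollectI exI[of _ ?a] exI[of _ "?g ` keys x"]) auto
      qed
    qed
  qed
qed

section \<open>Quotients by the kernel of a linear map\<close>

definition fiber :: "'a set \<Rightarrow> ('a \<Rightarrow> ('e \<Rightarrow>\<^sub>0 Cq)) \<Rightarrow> ('e \<Rightarrow>\<^sub>0 Cq) \<Rightarrow> ('a \<Rightarrow>\<^sub>0 Cq) set" where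
  "fiber A p y = {x. keys x \<subseteq> A \<and> lin_ext p x = y}"

text \<open>A coset of the kernel is a fibre, so the quotient by the kernel can be described without
  choosing representatives.\<close>

lemma coset_kernel:
  assumes "keys x \<subseteq> A"
  shows "a_r_coset (free_space A) (fiber A p 0) x = fiber A p (lin_ext p x)"
proof (intro equalityI subsetI)
  fix z assume "z \<in> a_r_coset (free_space A) (fiber A p 0) x"
  then show "z \<in> fiber A p (lin_ext p x)"
    using assms unfolding a_r_coset_def'
    by (simp add: fiber_def) (elim exE conjE, simp add: lin_ext_add keys_subset)
next
  fix z assume "z \<in> fiber A p (lin_ext p x)"
  then show "z \<in> a_r_coset (free_space A) (fiber A p 0) x"
    using assms unfolding a_r_coset_def'
    by (simp add: fiber_def) (rule exI[of _ "z - x"], simp add: lin_ext_diff keys_subset)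
qed

lemma UN_fiber:
  assumes "x \<in> fiber A p y" "\<And>x. x \<in> fiber A p y \<Longrightarrow> f x = z"
  shows "(\<Union>x\<in>fiber A p y. f x) = z"
  using assms by auto

text \<open>The map induced by \<open>p\<close> on the quotient by its kernel is inverted by sending a vector to its
  fibre. The section \<open>s\<close> of \<open>p\<close> on basis elements makes all fibres nonempty.\<close>

lemma lin_bij_fiber:
  assumes p: "\<And>a. a \<in> A \<Longrightarrow> keys (p a) \<subseteq> E"
    and s: "\<And>e. e \<in> E \<Longrightarrow> s e \<in> A" and ps: "\<And>e. e \<in> E \<Longrightarrow> p (s e) = single e 1"
  shows "lin_bij (free_space E) (quotient_space (free_space A) (fiber A p 0)) (fiber A p)"
proof -
  let ?lift = "lin_ext (\<lambda>e. single (s e) 1)"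
  have lift: "keys (?lift y) \<subseteq> A" "lin_ext p (?lift y) = y" if "keys y \<subseteq> E" for y
  proof -
    show "keys (?lift y) \<subseteq> A" by (rule keys_lin_ext) (use that s in auto)
    have "lin_ext p (?lift y) = lin_ext (\<lambda>e. single e 1) y"
      unfolding lin_ext_lin_ext by (rule lin_ext_cong) (use that ps in auto)
    then show "lin_ext p (?lift y) = y" by simp
  qed
  have lift_in: "?lift y \<in> fiber A p y" if "keys y \<subseteq> E" for y
    using lift[OF that] by (simp add: fiber_def)
  have p_in: "keys (lin_ext p x) \<subseteq> E" if "keys x \<subseteq> A" for x
    by (rule keys_lin_ext) (use that p in auto)
  have carrier: "carrier (quotient_space (free_space A) (fiber A p 0)) = fiber A p ` carrier (free_space E)"
  proof (intro equalityI subsetI)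
    fix C assume "C \<in> carrier (quotient_space (free_space A) (fiber A p 0))"
    then obtain x where "keys x \<subseteq> A" "C = a_r_coset (free_space A) (fiber A p 0) x"
      by (auto simp: quotient_space_def A_RCOSETS_def')
    then show "C \<in> fiber A p ` carrier (free_space E)"
      using p_in by (auto simp: coset_kernel)
  next
    fix C assume "C \<in> fiber A p ` carrier (free_space E)"
    then obtain y where y: "keys y \<subseteq> E" "C = fiber A p y" by auto
    then have "C = a_r_coset (free_space A) (fiber A p 0) (?lift y)"
      using lift by (simp add: coset_kernel)
    then show "C \<in> carrier (quotient_space (free_space A) (fiber A p 0))"
      using lift(1)[OF y(1)] by (auto simp: quotient_space_def A_RCOSETS_def')
  qed
  have add: "set_add (free_space A) (fiber A p y) (fiber A p z) = fiber A p (y + z)"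
    if "keys y \<subseteq> E" "keys z \<subseteq> E" for y z
  proof (intro equalityI subsetI)
    \<comment> \<open>The lift of \<open>z\<close> splits off the second summand.\<close>
    fix x assume "x \<in> fiber A p (y + z)"
    moreover have "x = (x - ?lift z) + ?lift z" by simp
    ultimately show "x \<in> set_add (free_space A) (fiber A p y) (fiber A p z)"
      using lift[OF that(2)] unfolding set_add_def'
      by (intro UN_I[of "x - ?lift z"] UN_I[of "?lift z"]) (simp_all add: fiber_def lin_ext_diff keys_subset)
  next
    fix x assume "x \<in> set_add (free_space A) (fiber A p y) (fiber A p z)"
    then obtain a b where "a \<in> fiber A p y" "b \<in> fiber A p z" "x = a + b"
      by (auto simp: set_add_def')
    then show "x \<in> fiber A p (y + z)"
      by (simp add: fiber_def lin_ext_add keys_subset)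
  qed
  have smult: "(\<Union>x\<in>fiber A p y. a_r_coset (free_space A) (fiber A p 0) (scale c x)) = fiber A p (scale c y)"
    if "keys y \<subseteq> E" for c y
    by (rule UN_fiber[OF lift_in[OF that]]) (auto simp: fiber_def coset_kernel[unfolded fiber_def] keys_subset lin_ext_scale)
  have inj: "inj_on (fiber A p) (carrier (free_space E))"
  proof (rule inj_onI)
    fix y z assume "y \<in> carrier (free_space E)" "z \<in> carrier (free_space E)" "fiber A p y = fiber A p z"
    then have "?lift y \<in> fiber A p z" using lift_in[of y] by simp
    then show "y = z" using lift(2)[of y] \<open>y \<in> carrier _\<close> by (simp add: fiber_def)
  qed
  show ?thesis
    unfolding lin_bij_def bij_betw_def carrier
    using inj add smult by (simp add: quotient_space_def)
qed


section \<open>Tensor products of free spaces\<close>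

abbreviation span_free :: "'a set \<Rightarrow> ('a \<Rightarrow>\<^sub>0 Cq) set \<Rightarrow> ('a \<Rightarrow>\<^sub>0 Cq) set" where
  "span_free A \<equiv> LinearCombinations.module.span CqF (free_space A)"

lemma span_free_closed:
  assumes S: "S \<subseteq> carrier (free_space A)"
  shows "x \<in> S \<Longrightarrow> x \<in> span_free A S" "0 \<in> span_free A S"
    "x \<in> span_free A S \<Longrightarrow> y \<in> span_free A S \<Longrightarrow> x + y \<in> span_free A S"
    "x \<in> span_free A S \<Longrightarrow> scale c x \<in> span_free A S"
    "x \<in> span_free A S \<Longrightarrow> keys x \<subseteq> A"
proof -
  interpret vectorspace CqF "free_space A" by (rule vectorspace_free_space)
  interpret sm: submodule CqF "span S" "free_space A" by (rule span_is_submodule[OF S])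
  show "x \<in> S \<Longrightarrow> x \<in> span S" by (rule subsetD[OF in_own_span[OF S]])
  show "0 \<in> span S" using sm.zero_closed by (simp only: free_space_sel)
  show "x \<in> span S \<Longrightarrow> y \<in> span S \<Longrightarrow> x + y \<in> span S"
    using sm.m_closed[of x y] by (simp only: free_space_sel)
  show "x \<in> span S \<Longrightarrow> scale c x \<in> span S"
    using sm.smult_closed[of c x] by simp
  show "x \<in> span S \<Longrightarrow> keys x \<subseteq> A" using subsetD[OF span_is_subset2[OF S], of x] by simp
qed

lemma span_free_sum:
  assumes "S \<subseteq> carrier (free_space A)" "\<And>i. i \<in> I \<Longrightarrow> f i \<in> span_free A S"
  shows "sum f I \<in> span_free A S"
  using assms(2)
  by (induction I rule: infinite_finite_induct) (simp_all add: span_free_closed[OF assms(1)])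

lemma span_free_le_kernel:
  assumes "S \<subseteq> carrier (free_space A)" "\<And>x. x \<in> S \<Longrightarrow> lin_ext p x = 0"
  shows "span_free A S \<subseteq> fiber A p 0"
proof -
  interpret vectorspace CqF "free_space A" by (rule vectorspace_free_space)
  show ?thesis
  proof (rule span_is_subset)
    show "S \<subseteq> fiber A p 0" using assms by (auto simp: fiber_def)
    show "submodule CqF (fiber A p 0) (free_space A)"
    proof (rule submodule.intro)
      show "Module.module CqF (free_space A)" by (rule module_axioms)
      show "fiber A p 0 \<subseteq> carrier (free_space A)" by (auto simp: fiber_def)
    qed (simp_all add: fiber_def keys_subset lin_ext_add lin_ext_scale)
  qed
qed

text \<open>The tensor product in the case that all factors are free and the reference vectors are chosen
  among the basis vectors. The exterior powers with their distinguished vectors are of this form.\<close>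

locale free_tensor =
  fixes I :: "'k set" and S :: "'k \<Rightarrow> 'b set" and ref :: "'k \<Rightarrow> 'b"
  assumes ref_in: "k \<in> I \<Longrightarrow> ref k \<in> S k"
begin

abbreviation W :: "'k \<Rightarrow> (Cq, 'b \<Rightarrow>\<^sub>0 Cq) module" where "W k \<equiv> free_space (S k)"
abbreviation u :: "'k \<Rightarrow> ('b \<Rightarrow>\<^sub>0 Cq)" where "u k \<equiv> single (ref k) 1"
abbreviation fams :: "('k \<Rightarrow> ('b \<Rightarrow>\<^sub>0 Cq)) set" where "fams \<equiv> tensor_families I W u"
abbreviation null :: "(('k \<Rightarrow> ('b \<Rightarrow>\<^sub>0 Cq)) \<Rightarrow>\<^sub>0 Cq) set" where "null \<equiv> tensor_null I W u"

definition choices :: "('k \<Rightarrow> 'b) set" where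
  "choices = {X \<in> (\<Pi>\<^sub>E k\<in>I. S k). finite {k \<in> I. X k \<noteq> ref k}}"

definition basis_family :: "('k \<Rightarrow> 'b) \<Rightarrow> 'k \<Rightarrow> ('b \<Rightarrow>\<^sub>0 Cq)" where
  "basis_family X = (\<lambda>k\<in>I. single (X k) 1)"

text \<open>The coefficient of the basis family \<open>X\<close> in the expansion of the family \<open>w\<close> over the places in
  \<open>J\<close>. Only finitely many of its factors differ from \<open>1\<close> (\<open>finite_coef\<close>); restricting the product to
  these gives a value to a product over an infinite index set.\<close>

definition coef :: "'k set \<Rightarrow> ('k \<Rightarrow> ('b \<Rightarrow>\<^sub>0 Cq)) \<Rightarrow> ('k \<Rightarrow> 'b) \<Rightarrow> Cq" where
  "coef J w X = (\<Prod>k | k \<in> J \<and> lookup (w k) (X k) \<noteq> 1. lookup (w k) (X k))"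

definition ev :: "('k \<Rightarrow> ('b \<Rightarrow>\<^sub>0 Cq)) \<Rightarrow> (('k \<Rightarrow> 'b) \<Rightarrow>\<^sub>0 Cq)" where
  "ev w = Abs_poly_mapping (\<lambda>X. if X \<in> choices then coef I w X else 0)"

lemma single_eq_iff: "single b (1 :: Cq) = single b' 1 \<longleftrightarrow> b = b'"
  by (metis lookup_single_eq lookup_single_not_eq zero_neq_one)

lemma fams_upd:
  assumes "w \<in> fams" "k \<in> I" "keys x \<subseteq> S k"
  shows "w(k := x) \<in> fams"
proof -
  have "{i \<in> I. (w(k := x)) i \<noteq> u i} \<subseteq> insert k {i \<in> I. w i \<noteq> u i}" by auto
  then have "finite {i \<in> I. (w(k := x)) i \<noteq> u i}"
    using assms(1) by (simp add: tensor_families_def finite_subset)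
  then show ?thesis using assms by (auto simp: tensor_families_def PiE_iff extensional_def)
qed

lemma basis_family_in: "X \<in> choices \<Longrightarrow> basis_family X \<in> fams"
  by (auto simp: tensor_families_def choices_def basis_family_def single_eq_iff cong: conj_cong)

lemma finite_coef:
  assumes "w \<in> fams" "X \<in> choices"
  shows "finite {k \<in> I. lookup (w k) (X k) \<noteq> 1}"
proof (rule finite_subset)
  show "{k \<in> I. lookup (w k) (X k) \<noteq> 1} \<subseteq> {k \<in> I. w k \<noteq> u k} \<union> {k \<in> I. X k \<noteq> ref k}"
    by auto
qed (use assms in \<open>auto simp: tensor_families_def choices_def\<close>)

text \<open>A basis family with nonzero coefficient picks at every place an element of the support of \<open>w k\<close>,
  and at almost all places this support is a singleton.\<close>

lemma finite_choices_support:
  assumes "w \<in> fams"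
  shows "finite {X. (if X \<in> choices then coef I w X else 0) \<noteq> 0}"
proof (rule finite_subset)
  let ?D = "{k \<in> I. w k \<noteq> u k}"
  show "{X. (if X \<in> choices then coef I w X else 0) \<noteq> 0} \<subseteq> (\<Pi>\<^sub>E k\<in>I. keys (w k))"
  proof
    fix X assume "X \<in> {X. (if X \<in> choices then coef I w X else 0) \<noteq> 0}"
    then have X: "X \<in> choices" "coef I w X \<noteq> 0" by (auto split: if_splits)
    have "X k \<in> keys (w k)" if "k \<in> I" for k
      using X finite_coef[OF assms X(1)] that
      by (cases "lookup (w k) (X k) = 1") (auto simp: coef_def in_keys_iff)
    then show "X \<in> (\<Pi>\<^sub>E k\<in>I. keys (w k))" using X(1) by (auto simp: choices_def PiE_iff)
  qed
  show "finite (\<Pi>\<^sub>E k\<in>I. keys (w k))"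
  proof (rule finite_imageD)
    have "(\<lambda>X. restrict X ?D) ` (\<Pi>\<^sub>E k\<in>I. keys (w k)) \<subseteq> (\<Pi>\<^sub>E k\<in>?D. keys (w k))"
      by auto
    moreover have "finite (\<Pi>\<^sub>E k\<in>?D. keys (w k))"
      using assms by (intro finite_PiE) (auto simp: tensor_families_def)
    ultimately show "finite ((\<lambda>X. restrict X ?D) ` (\<Pi>\<^sub>E k\<in>I. keys (w k)))"
      by (rule finite_subset)
    show "inj_on (\<lambda>X. restrict X ?D) (\<Pi>\<^sub>E k\<in>I. keys (w k))"
    proof (rule inj_onI)
      fix X Y assume XY: "X \<in> (\<Pi>\<^sub>E k\<in>I. keys (w k))" "Y \<in> (\<Pi>\<^sub>E k\<in>I. keys (w k))"
        and eq: "restrict X ?D = restrict Y ?D"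
      show "X = Y"
      proof (rule PiE_ext[OF XY])
        fix k assume k: "k \<in> I"
        show "X k = Y k"
        proof (cases "w k = u k")
          case True
          then show ?thesis using PiE_mem[OF XY(1) k] PiE_mem[OF XY(2) k] by simp
        next
          case False
          then show ?thesis using fun_cong[OF eq, of k] k by simp
        qed
      qed
    qed
  qed
qed

lemma lookup_ev:
  assumes "w \<in> fams"
  shows "lookup (ev w) X = (if X \<in> choices then coef I w X else 0)"
  unfolding ev_def using finite_choices_support[OF assms]
  by (subst lookup_Abs_poly_mapping) simp_all

lemma keys_ev: "w \<in> fams \<Longrightarrow> keys (ev w) \<subseteq> choices"
  by (auto simp: in_keys_iff lookup_ev split: if_splits)

text \<open>Multilinearity of the coefficients is visible once the factor at the place \<open>k\<close> is split off.\<close>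

lemma coef_upd:
  assumes "w \<in> fams" "k \<in> I" "X \<in> choices"
  shows "coef I (w(k := x)) X = lookup x (X k) * coef (I - {k}) w X"
proof -
  have fin: "finite {i \<in> I - {k}. lookup (w i) (X i) \<noteq> 1}"
    by (rule finite_subset[OF _ finite_coef[OF assms(1,3)]]) auto
  have "coef I (w(k := x)) X = (\<Prod>i | i \<in> I \<and> lookup ((w(k := x)) i) (X i) \<noteq> 1. lookup ((w(k := x)) i) (X i))"
    by (simp add: coef_def)
  also have "\<dots> = (\<Prod>i\<in>insert k {i \<in> I - {k}. lookup (w i) (X i) \<noteq> 1}. lookup ((w(k := x)) i) (X i))"
    by (rule prod.mono_neutral_left) (use fin assms(2) in auto)
  also have "\<dots> = lookup x (X k) * coef (I - {k}) w X"
    unfolding coef_def using fin by (subst prod.insert) (auto intro!: prod.cong)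
  finally show ?thesis .
qed

lemma ev_add:
  assumes "w \<in> fams" "k \<in> I" "keys x \<subseteq> S k" "keys y \<subseteq> S k"
  shows "ev (w(k := x + y)) = ev (w(k := x)) + ev (w(k := y))"
  by (rule poly_mapping_eqI)
    (simp add: lookup_add lookup_ev fams_upd keys_subset coef_upd assms distrib_right)

lemma ev_scale:
  assumes "w \<in> fams" "k \<in> I" "keys x \<subseteq> S k"
  shows "ev (w(k := scale c x)) = scale c (ev (w(k := x)))"
  by (rule poly_mapping_eqI) (simp add: lookup_ev fams_upd keys_subset coef_upd assms)

text \<open>All families met in computing the action consist of scaled basis vectors, and for these the
  scalars multiply.\<close>

lemma ev_scaled_basis:
  assumes Y: "Y \<in> choices" and D: "finite D" "D \<subseteq> I" "\<And>k. k \<in> I - D \<Longrightarrow> c k = 1"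
  shows "ev (\<lambda>k\<in>I. single (Y k) (c k)) = single Y (\<Prod>k\<in>D. c k)"
proof (rule poly_mapping_eqI)
  fix Z
  let ?w = "\<lambda>k\<in>I. single (Y k) (c k)"
  have "{k \<in> I. ?w k \<noteq> u k} \<subseteq> D \<union> {k \<in> I. Y k \<noteq> ref k}" using D(3) by auto
  moreover have "finite (D \<union> {k \<in> I. Y k \<noteq> ref k})" using D(1) Y by (simp add: choices_def)
  ultimately have "finite {k \<in> I. ?w k \<noteq> u k}" by (rule finite_subset)
  then have w: "?w \<in> fams" using Y by (auto simp: tensor_families_def choices_def PiE_iff)
  note ev = lookup_ev[OF w, of Z]
  consider "Y = Z" | "Y \<noteq> Z" "Z \<in> choices" | "Y \<noteq> Z" "Z \<notin> choices" by blast
  then show "lookup (ev ?w) Z = lookup (single Y (\<Prod>k\<in>D. c k)) Z"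
  proof cases
    case 1
    have "coef I ?w Y = (\<Prod>k | k \<in> I \<and> c k \<noteq> 1. c k)"
      unfolding coef_def by (rule prod.cong) auto
    also have "\<dots> = (\<Prod>k\<in>D. c k)"
      by (rule prod.mono_neutral_left) (use D in auto)
    finally show ?thesis using ev Y 1 by simp
  next
    case 2
    then obtain k where k: "k \<in> I" "Y k \<noteq> Z k"
      using PiE_ext[of Y I S Z] Y unfolding choices_def by blast
    have "k \<in> {k \<in> I. lookup (?w k) (Z k) \<noteq> 1}" "lookup (?w k) (Z k) = 0"
      using k by (simp_all add: lookup_single_not_eq)
    then have "coef I ?w Z = 0"
      unfolding coef_def using finite_coef[OF w 2(2)] by (intro prod_zero bexI[of _ k])
    then show ?thesis using ev 2 by (simp add: lookup_single_not_eq)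
  next
    case 3
    then show ?thesis using ev by (simp add: lookup_single_not_eq)
  qed
qed

lemma ev_basis_family:
  assumes "X \<in> choices"
  shows "ev (basis_family X) = single X 1"
  using ev_scaled_basis[OF assms, of "{}" "\<lambda>_. 1"] by (simp add: basis_family_def)

lemma relation_cases:
  assumes "x \<in> tensor_relations I W u"
  obtains (add) w k a b where "w \<in> fams" "k \<in> I" "keys a \<subseteq> S k" "keys b \<subseteq> S k"
      "x = single (w(k := a + b)) 1 - single (w(k := a)) 1 - single (w(k := b)) 1"
  | (scale) w k c a where "w \<in> fams" "k \<in> I" "keys a \<subseteq> S k"
      "x = single (w(k := scale c a)) 1 - scale c (single (w(k := a)) 1)"
  using assms unfolding tensor_relations_def free_space_sel mem_Collect_eq
  by (elim UnE CollectE exE conjE)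
    (rule add[rotated 4], assumption, assumption, assumption, assumption, assumption,
     rule scale[rotated 3], assumption, assumption, assumption, assumption)

lemma relation_add:
  assumes "w \<in> fams" "k \<in> I" "keys a \<subseteq> S k" "keys b \<subseteq> S k"
  shows "single (w(k := a + b)) 1 - single (w(k := a)) 1 - single (w(k := b)) 1
    \<in> tensor_relations I W u"
  unfolding tensor_relations_def
  by (rule UnI1, rule CollectI, intro exI[of _ w] exI[of _ k] exI[of _ a] exI[of _ b]) (use assms in simp)

lemma relation_scale:
  assumes "w \<in> fams" "k \<in> I" "keys a \<subseteq> S k"
  shows "single (w(k := scale c a)) 1 - scale c (single (w(k := a)) 1) \<in> tensor_relations I W u"
  unfolding tensor_relations_def
  by (rule UnI2, rule CollectI, intro exI[of _ w] exI[of _ k] exI[of _ c] exI[of _ a]) (use assms in simp)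

lemma relations_in: "tensor_relations I W u \<subseteq> carrier (free_space fams)"
proof
  fix x assume "x \<in> tensor_relations I W u"
  then show "x \<in> carrier (free_space fams)"
  proof (cases rule: relation_cases)
    case (add w k a b)
    have "w(k := a + b) \<in> fams" "w(k := a) \<in> fams" "w(k := b) \<in> fams"
      by (rule fams_upd[OF add(1,2)], simp add: add(3,4) keys_subset)+
    then show ?thesis unfolding add(5) free_space_sel mem_Collect_eq
      by (intro keys_subset keys_single_subset)
  next
    case (scale w k c a)
    have "w(k := Defs.scale c a) \<in> fams" "w(k := a) \<in> fams"
      by (rule fams_upd[OF scale(1,2)], simp add: scale(3) keys_subset)+
    then show ?thesis unfolding scale(4) free_space_sel mem_Collect_eq
      by (intro keys_subset keys_single_subset)
  qed
qed

lemmas null_closed = span_free_closed[OF relations_in, folded tensor_null_def]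
lemmas null_sum = span_free_sum[OF relations_in, folded tensor_null_def]

lemma null_le_kernel: "null \<subseteq> fiber fams ev 0"
  unfolding tensor_null_def
proof (rule span_free_le_kernel[OF relations_in])
  fix x assume "x \<in> tensor_relations I W u"
  then show "lin_ext ev x = 0"
    by (cases rule: relation_cases) (simp_all add: lin_ext_diff lin_ext_scale ev_add ev_scale del: scale_simps(5))
qed

text \<open>One entry of a family is expanded into basis vectors modulo the relations. The empty sum is the
  relation for the scalar \<open>0\<close>.\<close>

lemma null_expand:
  assumes "w \<in> fams" "k \<in> I" "finite J" "J \<subseteq> S k"
  shows "single (w(k := \<Sum>b\<in>J. single b (c b))) 1
    - (\<Sum>b\<in>J. scale (c b) (single (w(k := single b 1)) 1)) \<in> null"
  using assms(3,4)
proof (induction J)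
  case empty
  show ?case
    using null_closed(1)[OF relation_scale[OF assms(1,2), of 0 0]] by (simp add: fun_upd_def)
next
  case (insert b J)
  let ?y = "\<Sum>b\<in>J. single b (c b)" and ?x = "single b (c b)"
  have keys: "keys ?y \<subseteq> S k" "keys ?x \<subseteq> S k" "keys (single b (1::Cq)) \<subseteq> S k"
    using insert.prems by (auto intro!: subset_trans[OF keys_sum] UN_least keys_single_subset simp del: keys_single)
  have "(single (w(k := ?x + ?y)) 1 - single (w(k := ?x)) 1 - single (w(k := ?y)) 1)
      + (single (w(k := scale (c b) (single b 1))) 1 - scale (c b) (single (w(k := single b 1)) 1))
      + (single (w(k := ?y)) 1 - (\<Sum>b\<in>J. scale (c b) (single (w(k := single b 1)) 1))) \<in> null"
    using insert.IH insert.prems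
    by (intro null_closed(3) null_closed(1)[OF relation_add] null_closed(1)[OF relation_scale] assms keys) (auto simp: fun_upd_def)
  then show ?case using insert.hyps by (simp add: algebra_simps fun_upd_def)
qed

definition lift :: "(('k \<Rightarrow> 'b) \<Rightarrow>\<^sub>0 Cq) \<Rightarrow> (('k \<Rightarrow> ('b \<Rightarrow>\<^sub>0 Cq)) \<Rightarrow>\<^sub>0 Cq)" where
  "lift = lin_ext (\<lambda>X. single (basis_family X) 1)"

text \<open>Induction on the number of places that do not hold a basis vector. Expanding one such place
  produces families with fewer of them, and \<open>ev\<close> respects the expansion because it kills the
  relations. When no such place is left, the family is a basis family and the difference is \<open>0\<close>.\<close>

lemma single_minus_lift:
  assumes "w \<in> fams"
  shows "single w 1 - lift (ev w) \<in> null"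
proof -
  have "finite {k \<in> I. \<nexists>b. b \<in> S k \<and> w k = single b 1}"
    by (rule finite_subset[of _ "{k \<in> I. w k \<noteq> u k}"])
      (use assms ref_in in \<open>auto simp: tensor_families_def\<close>)
  then show ?thesis using assms
  proof (induction "{k \<in> I. \<nexists>b. b \<in> S k \<and> w k = single b 1}" arbitrary: w rule: finite_psubset_induct)
    case psubset
    show ?case
    proof (cases "{k \<in> I. \<nexists>b. b \<in> S k \<and> w k = single b 1} = {}")
      case True
      then have "\<forall>k\<in>I. \<exists>b. b \<in> S k \<and> w k = single b 1" by auto
      then obtain X where X: "\<And>k. k \<in> I \<Longrightarrow> X k \<in> S k \<and> w k = single (X k) 1" by metis
      have "restrict X I \<in> choices" "basis_family (restrict X I) = w"
        using X psubset.prems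
        by (auto simp: choices_def tensor_families_def basis_family_def single_eq_iff PiE_iff extensional_def
            fun_eq_iff cong: conj_cong)
      then have "single w 1 - lift (ev w) = 0"
        using ev_basis_family[of "restrict X I"] by (simp add: lift_def)
      then show ?thesis using null_closed(2) by simp
    next
      case False
      then obtain k where k: "k \<in> I" "\<nexists>b. b \<in> S k \<and> w k = single b 1" by auto
      have wk: "keys (w k) \<subseteq> S k" using psubset.prems k by (auto simp: tensor_families_def)
      let ?w = "\<lambda>b. w(k := single b 1)"
      have IH: "single (?w b) 1 - lift (ev (?w b)) \<in> null" if "b \<in> S k" for b
      proof (rule psubset.hyps(2))
        show "?w b \<in> fams" by (rule fams_upd[OF psubset.prems k(1)]) (use that in simp)
        show "{i \<in> I. \<nexists>b'. b' \<in> S i \<and> (?w b) i = single b' 1} \<subset> {i \<in> I. \<nexists>b. b \<in> S i \<and> w i = single b 1}"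
          using k that by (auto split: if_splits)
      qed
      let ?d = "single w 1 - (\<Sum>b\<in>keys (w k). scale (lookup (w k) b) (single (?w b) 1))"
      have d: "?d \<in> null"
        using null_expand[OF psubset.prems k(1) finite_keys wk, of "lookup (w k)"] by (simp add: sum_single_lookup)
      then have "lin_ext ev ?d = 0" using null_le_kernel by (auto simp: fiber_def)
      then have ev_w: "ev w = (\<Sum>b\<in>keys (w k). scale (lookup (w k) b) (ev (?w b)))"
        by (simp add: lin_ext_diff lin_ext_sum lin_ext_scale del: scale_simps(5))
      have "?d + (\<Sum>b\<in>keys (w k). scale (lookup (w k) b) (single (?w b) 1 - lift (ev (?w b)))) \<in> null"
        by (intro null_closed(3)[OF d] null_sum null_closed(4) IH) (use wk in auto)
      also have "?d + (\<Sum>b\<in>keys (w k). scale (lookup (w k) b) (single (?w b) 1 - lift (ev (?w b)))) =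
          single w 1 - lift (ev w)"
        by (simp add: ev_w lift_def lin_ext_sum lin_ext_scale scale_diff sum_subtractf del: scale_simps(5))
      finally show ?thesis .
    qed
  qed
qed

lemma minus_lift:
  assumes "keys x \<subseteq> fams"
  shows "x - lift (lin_ext ev x) \<in> null"
proof -
  have "(\<Sum>w\<in>keys x. scale (lookup x w) (single w 1 - lift (ev w))) \<in> null"
    by (intro null_sum null_closed(4) single_minus_lift) (use assms in auto)
  also have "(\<Sum>w\<in>keys x. scale (lookup x w) (single w 1 - lift (ev w))) = x - lift (lin_ext ev x)"
    by (simp add: scale_diff sum_subtractf sum_single_lookup lift_def lin_ext_lin_ext)
      (simp add: lin_ext_def)
  finally show ?thesis .
qed

text \<open>A vector in the kernel of \<open>ev\<close> has lift \<open>0\<close>, so it equals its own difference to the lift.\<close>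

lemma null_eq_kernel: "null = fiber fams ev 0"
proof
  show "fiber fams ev 0 \<subseteq> null"
  proof
    fix x assume "x \<in> fiber fams ev 0"
    then show "x \<in> null" using minus_lift[of x] by (simp add: fiber_def lift_def)
  qed
qed (rule null_le_kernel)

lemma lin_bij_tensor: "lin_bij (free_space choices) (tensor_space I W u) (fiber fams ev)"
  unfolding tensor_space_def null_eq_kernel
  by (rule lin_bij_fiber[where s = basis_family]) (auto simp: ev_basis_family basis_family_in intro: keys_ev[THEN subsetD])

lemma coset_null:
  assumes "keys x \<subseteq> fams"
  shows "a_r_coset (free_space fams) null x = fiber fams ev (lin_ext ev x)"
  unfolding null_eq_kernel using assms by (rule coset_kernel)

lemma pure_tensor_basis_family:
  assumes "X \<in> choices"
  shows "pure_tensor I W u (basis_family X) = fiber fams ev (single X 1)"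
  unfolding pure_tensor_def using basis_family_in[OF assms]
  by (simp add: coset_null ev_basis_family assms)

lemma lift_in_fiber:
  assumes "keys y \<subseteq> choices"
  shows "lift y \<in> fiber fams ev y"
proof -
  have "lin_ext ev (lift y) = lin_ext (\<lambda>X. single X 1) y"
    unfolding lift_def lin_ext_lin_ext by (rule lin_ext_cong) (use assms ev_basis_family in auto)
  moreover have "keys (lift y) \<subseteq> fams"
    unfolding lift_def by (rule keys_lin_ext) (use assms basis_family_in in auto)
  ultimately show ?thesis by (simp add: fiber_def)
qed

text \<open>An operation defined on cosets by the union over all representatives is computed on basis
  families alone, as soon as the operation on representatives preserves the relations: then any
  representative may be replaced by the combination of basis families in its class.\<close>

lemma coset_action:
  assumes T: "\<And>w. w \<in> fams \<Longrightarrow> keys (T w) \<subseteq> fams"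
    and rel: "\<And>x. x \<in> tensor_relations I W u \<Longrightarrow> lin_ext T x \<in> null"
    and y: "keys y \<subseteq> choices"
  shows "(\<Union>x\<in>fiber fams ev y. a_r_coset (free_space fams) null (lin_ext T x)) =
    fiber fams ev (lin_ext (\<lambda>X. lin_ext ev (T (basis_family X))) y)"
proof (rule UN_fiber[OF lift_in_fiber[OF y]])
  fix x assume x: "x \<in> fiber fams ev y"
  have T_in: "keys (lin_ext T z) \<subseteq> fams" if "keys z \<subseteq> fams" for z
    by (rule keys_lin_ext) (use that T in auto)
  have "null \<subseteq> fiber fams (\<lambda>w. lin_ext ev (T w)) 0"
    unfolding tensor_null_def
  proof (rule span_free_le_kernel[OF relations_in])
    fix x assume "x \<in> tensor_relations I W u"
    then show "lin_ext (\<lambda>w. lin_ext ev (T w)) x = 0"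
      using subsetD[OF null_le_kernel rel] by (simp add: fiber_def lin_ext_lin_ext)
  qed
  moreover have "x - lift y \<in> null" using minus_lift[of x] x by (simp add: fiber_def)
  ultimately have "lin_ext (\<lambda>w. lin_ext ev (T w)) (x - lift y) = 0" by (auto simp: fiber_def)
  then have "lin_ext ev (lin_ext T x) = lin_ext (\<lambda>X. lin_ext ev (T (basis_family X))) y"
    by (simp add: lin_ext_diff lin_ext_lin_ext lift_def)
  then show "a_r_coset (free_space fams) null (lin_ext T x) =
      fiber fams ev (lin_ext (\<lambda>X. lin_ext ev (T (basis_family X))) y)"
    using x T_in by (simp add: coset_null fiber_def)
qed


text \<open>Operators acting on the places separately and as the identity at almost all places. The terms of
  an iterated coproduct act on the tensor product in this way.\<close>

definition local_ops :: "('k \<Rightarrow> ('b \<Rightarrow>\<^sub>0 Cq) \<Rightarrow> ('b \<Rightarrow>\<^sub>0 Cq)) \<Rightarrow> bool" where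
  "local_ops A \<longleftrightarrow> finite {k \<in> I. A k \<noteq> id} \<and>
     (\<forall>k\<in>I. (\<forall>x y. A k (x + y) = A k x + A k y) \<and> (\<forall>c x. A k (scale c x) = scale c (A k x)) \<and>
       (\<forall>x. keys x \<subseteq> S k \<longrightarrow> keys (A k x) \<subseteq> S k))"

definition apply_ops ::
    "('k \<Rightarrow> ('b \<Rightarrow>\<^sub>0 Cq) \<Rightarrow> ('b \<Rightarrow>\<^sub>0 Cq)) \<Rightarrow> ('k \<Rightarrow> ('b \<Rightarrow>\<^sub>0 Cq)) \<Rightarrow> 'k \<Rightarrow> ('b \<Rightarrow>\<^sub>0 Cq)" where
  "apply_ops A w = (\<lambda>k\<in>I. A k (w k))"

lemma apply_ops_in:
  assumes "local_ops A" "w \<in> fams"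
  shows "apply_ops A w \<in> fams"
proof -
  have "{k \<in> I. apply_ops A w k \<noteq> u k} \<subseteq> {k \<in> I. A k \<noteq> id} \<union> {k \<in> I. w k \<noteq> u k}"
    by (auto simp: apply_ops_def)
  moreover have "finite ({k \<in> I. A k \<noteq> id} \<union> {k \<in> I. w k \<noteq> u k})"
    using assms by (auto simp: local_ops_def tensor_families_def)
  ultimately have "finite {k \<in> I. apply_ops A w k \<noteq> u k}" by (rule finite_subset)
  moreover have "apply_ops A w \<in> (\<Pi>\<^sub>E k\<in>I. carrier (W k))"
    using assms by (simp add: apply_ops_def local_ops_def tensor_families_def PiE_iff)
  ultimately show ?thesis by (simp add: tensor_families_def)
qed

lemma apply_ops_upd:
  assumes "k \<in> I"
  shows "apply_ops A (w(k := x)) = (apply_ops A w)(k := A k x)"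
  using assms by (auto simp: apply_ops_def fun_eq_iff)

lemma null_sum_list: "(\<And>A. A \<in> set As \<Longrightarrow> f A \<in> null) \<Longrightarrow> (\<Sum>A\<leftarrow>As. f A) \<in> null"
  by (induction As) (simp_all add: null_closed)

text \<open>Since the operator acts linearly on the entry at \<open>k\<close>, it sends a relation at the place \<open>k\<close> to a
  relation at the same place.\<close>

lemma apply_ops_relation:
  assumes A: "local_ops A" and x: "x \<in> tensor_relations I W u"
  shows "lin_ext (\<lambda>w. single (apply_ops A w) 1) x \<in> tensor_relations I W u"
  using x
proof (cases rule: relation_cases)
  case (add w k a b)
  note lin = lin_ext_diff lin_ext_single scale_simps(3)
  have "A k (a + b) = A k a + A k b" "keys (A k a) \<subseteq> S k" "keys (A k b) \<subseteq> S k"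
    using A add by (simp_all add: local_ops_def)
  then show ?thesis
    unfolding add(5) lin apply_ops_upd[OF add(2)]
    using relation_add[OF apply_ops_in[OF A add(1)] add(2)] by simp
next
  case (scale w k c a)
  note lin = lin_ext_diff lin_ext_scale lin_ext_single scale_simps(3)
  have "A k (Defs.scale c a) = Defs.scale c (A k a)" "keys (A k a) \<subseteq> S k"
    using A scale by (simp_all add: local_ops_def)
  then show ?thesis
    unfolding scale(4) lin apply_ops_upd[OF scale(2)]
    using relation_scale[OF apply_ops_in[OF A scale(1)] scale(2)] by simp
qed

lemma lin_ext_sum_list: "lin_ext (\<lambda>b. \<Sum>A\<leftarrow>As. \<phi> A b) x = (\<Sum>A\<leftarrow>As. lin_ext (\<phi> A) x)"
  by (induction As) (simp_all add: lin_ext_add_fun)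

lemma coset_action_ops:
  assumes A: "\<And>A. A \<in> set As \<Longrightarrow> local_ops A" and y: "keys y \<subseteq> choices"
  shows "(\<Union>x\<in>fiber fams ev y. a_r_coset (free_space fams) null
      (lin_ext (\<lambda>w. \<Sum>A\<leftarrow>As. single (apply_ops A w) 1) x)) =
    fiber fams ev (lin_ext (\<lambda>X. \<Sum>A\<leftarrow>As. ev (apply_ops A (basis_family X))) y)"
proof -
  have ev_sum: "lin_ext ev (\<Sum>A\<leftarrow>As. single (apply_ops A w) 1) = (\<Sum>A\<leftarrow>As. ev (apply_ops A w))" for w
    by (induction As) (simp_all add: lin_ext_add)
  have keys_sum: "keys (\<Sum>A\<leftarrow>As. single (apply_ops A w) (1 :: Cq)) \<subseteq> fams" if w: "w \<in> fams" for w
    using A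
  proof (induction As)
    case (Cons A As)
    have "keys (single (apply_ops A w) (1 :: Cq)) \<subseteq> fams"
      by (rule keys_single_subset, rule apply_ops_in[OF _ w]) (simp add: Cons.prems)
    then show ?case using Cons unfolding list.map sum_list.Cons by (intro keys_subset(1)) simp_all
  qed simp
  have null_rel: "lin_ext (\<lambda>w. \<Sum>A\<leftarrow>As. single (apply_ops A w) 1) x \<in> null"
    if "x \<in> tensor_relations I W u" for x
    unfolding lin_ext_sum_list
    by (intro null_sum_list null_closed(1) apply_ops_relation A that)
  show ?thesis
    using coset_action[OF keys_sum null_rel y] unfolding ev_sum .
qed

end


section \<open>Hopping operators\<close>

text \<open>The integers are arranged on levels of length \<open>n\<close>; \<open>site n l a\<close> is the place with residue \<open>a\<close> on
  level \<open>l\<close>. For \<open>1 \<le> a < n\<close> the sites \<open>a - 1\<close> and \<open>a\<close> lie on the same level.\<close>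

definition site :: "nat \<Rightarrow> int \<Rightarrow> nat \<Rightarrow> int" where
  "site n l a = int a + l * int n"

lemma site_div: "a < n \<Longrightarrow> site n l a div int n = l"
  by (auto simp: site_def)

lemma site_eq_iff:
  assumes "a < n" "b < n"
  shows "site n l a = site n m b \<longleftrightarrow> l = m \<and> a = b"
proof
  assume eq: "site n l a = site n m b"
  then have "l = m" using assms site_div[of a n l] site_div[of b n m] by simp
  then show "l = m \<and> a = b" using eq by (simp add: site_def)
qed auto

text \<open>The generators \<open>f\<close> and \<open>e\<close> are treated together, distinguished by a sign: for \<open>\<epsilon> = 1\<close> the
  particle hops from \<open>a - 1\<close> to \<open>a\<close>, for \<open>\<epsilon> = -1\<close> it hops from \<open>a\<close> to \<open>a - 1\<close>.\<close>

definition hop_from :: "int \<Rightarrow> nat \<Rightarrow> nat" where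
  "hop_from \<epsilon> a = (if \<epsilon> = 1 then a - 1 else a)"

definition hop_to :: "int \<Rightarrow> nat \<Rightarrow> nat" where
  "hop_to \<epsilon> a = (if \<epsilon> = 1 then a else a - 1)"

definition movable :: "nat \<Rightarrow> int \<Rightarrow> nat \<Rightarrow> int \<Rightarrow> int set \<Rightarrow> bool" where
  "movable n \<epsilon> a l B \<longleftrightarrow> site n l (hop_from \<epsilon> a) \<in> B \<and> site n l (hop_to \<epsilon> a) \<notin> B"

definition moved :: "nat \<Rightarrow> int \<Rightarrow> nat \<Rightarrow> int \<Rightarrow> int set \<Rightarrow> int set" where
  "moved n \<epsilon> a l B = (B - {site n l (hop_from \<epsilon> a)}) \<union> {site n l (hop_to \<epsilon> a)}"

text \<open>The exponent of \<open>q\<close> by which \<open>K\<^sup>+\<close> of index \<open>a\<close> acts at level \<open>l\<close>.\<close>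

definition wt :: "nat \<Rightarrow> nat \<Rightarrow> int \<Rightarrow> int set \<Rightarrow> int" where
  "wt n a l B = of_bool (site n l (a - 1) \<in> B) - of_bool (site n l a \<in> B)"

text \<open>The levels on which the coproduct of \<open>f\<close> (\<open>\<epsilon> = 1\<close>) or \<open>e\<close> (\<open>\<epsilon> = -1\<close>) puts a factor \<open>K\<^sup>+\<close> or \<open>K\<^sup>-\<close> when the
  generator itself acts on level \<open>l\<close>: the higher ones for \<open>f\<close> and the lower ones for \<open>e\<close>.\<close>

definition beyond :: "int set \<Rightarrow> int \<Rightarrow> int \<Rightarrow> int set" where
  "beyond L \<epsilon> l = {m \<in> L. \<epsilon> * (m - l) > 0}"

definition hop_exp :: "nat \<Rightarrow> int set \<Rightarrow> int \<Rightarrow> nat \<Rightarrow> int \<Rightarrow> int set \<Rightarrow> int" where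
  "hop_exp n L \<epsilon> a l B = \<epsilon> * (\<Sum>m\<in>beyond L \<epsilon> l. wt n a m B)"

definition hop_basis :: "nat \<Rightarrow> int set \<Rightarrow> int \<Rightarrow> nat \<Rightarrow> int \<Rightarrow> int set \<Rightarrow> (int set \<Rightarrow>\<^sub>0 Cq)" where
  "hop_basis n L \<epsilon> a l B =
     (if movable n \<epsilon> a l B then single (moved n \<epsilon> a l B) (qq powi hop_exp n L \<epsilon> a l B) else 0)"

text \<open>The part of the action of \<open>f\<close> or \<open>e\<close> in which the hop takes place at level \<open>l\<close>. With the finite set
  \<open>L\<close> of levels fixed, these operators make sense on the free space on all sets of integers, and
  their relations hold there.\<close>

definition hop :: "nat \<Rightarrow> int set \<Rightarrow> int \<Rightarrow> nat \<Rightarrow> int \<Rightarrow> (int set \<Rightarrow>\<^sub>0 Cq) \<Rightarrow> (int set \<Rightarrow>\<^sub>0 Cq)" where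
  "hop n L \<epsilon> a l = lin_ext (hop_basis n L \<epsilon> a l)"

lemma cartan_commute: "cartan a b = cartan b a"
  by (auto simp: cartan_def)

text \<open>This is where the Cartan matrix enters: a hop of index \<open>b\<close> changes the occupation of two neighbouring sites.\<close>

lemma wt_moved:
  assumes "a \<in> {1..<n}" "b \<in> {1..<n}" "\<delta> \<in> {1, -1}" "movable n \<delta> b m B"
  shows "wt n a l (moved n \<delta> b m B) = wt n a l B - (if l = m then \<delta> * cartan a b else 0)"
proof -
  have b: "0 < a" "0 < b" "a < n" "b < n" "a - 1 < n" "b - 1 < n"
    using assms by auto
  consider "a = b" | "a = Suc b" | "b = Suc a" | "a \<noteq> b" "a \<noteq> Suc b" "b \<noteq> Suc a"
    by blast
  then show ?thesis
    using assms(3,4) b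
    by cases (auto simp: wt_def moved_def movable_def hop_from_def hop_to_def site_eq_iff cartan_def)
qed

lemma finite_beyond [simp]: "finite L \<Longrightarrow> finite (beyond L \<epsilon> l)"
  by (simp add: beyond_def)

lemma hop_exp_moved:
  assumes "finite L" "m \<in> L" "a \<in> {1..<n}" "b \<in> {1..<n}" "\<delta> \<in> {1, -1}" "movable n \<delta> b m B"
  shows "hop_exp n L \<epsilon> a l (moved n \<delta> b m B) =
    hop_exp n L \<epsilon> a l B - \<epsilon> * \<delta> * cartan a b * of_bool (\<epsilon> * (m - l) > 0)"
  using assms
  by (auto simp: hop_exp_def wt_moved sum_subtractf sum.delta algebra_simps)
    (auto simp: beyond_def algebra_simps)

text \<open>The two hops use disjoint pairs of sites and can be carried out in either order. Their scalars
  differ because the earlier hop changes the weights that the later one sees, which happens when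
  the earlier level lies beyond the later one.\<close>

lemma hop_commute_basis:
  assumes L: "finite L" "l \<in> L" "m \<in> L" and ab: "a \<in> {1..<n}" "b \<in> {1..<n}"
    and sgn: "\<epsilon> \<in> {1, -1}" "\<delta> \<in> {1, -1}" and apart: "l \<noteq> m \<or> cartan a b = 0"
  shows "hop n L \<epsilon> a l (hop_basis n L \<delta> b m B) =
    scale (qq powi (- \<epsilon> * \<delta> * cartan a b *
        (of_bool (\<epsilon> * (m - l) > 0) - of_bool (\<delta> * (l - m) > 0))))
      (hop n L \<delta> b m (hop_basis n L \<epsilon> a l B))"
proof -
  have ne: "site n l a \<noteq> site n m b" "site n l (a - 1) \<noteq> site n m b"
    "site n l a \<noteq> site n m (b - 1)" "site n l (a - 1) \<noteq> site n m (b - 1)"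
    using apart ab by (auto simp: site_eq_iff cartan_def split: if_splits)
  have mov: "movable n \<epsilon> a l (moved n \<delta> b m B) = movable n \<epsilon> a l B"
    "movable n \<delta> b m (moved n \<epsilon> a l B) = movable n \<delta> b m B"
    using ne by (auto simp: movable_def moved_def hop_from_def hop_to_def split: if_splits)
  have comm: "moved n \<epsilon> a l (moved n \<delta> b m B) = moved n \<delta> b m (moved n \<epsilon> a l B)"
    using ne by (auto simp: moved_def hop_from_def hop_to_def split: if_splits)
  show ?thesis
  proof (cases "movable n \<epsilon> a l B \<and> movable n \<delta> b m B")
    case True
    then show ?thesis
      using hop_exp_moved[OF L(1,3) ab sgn(2), of B \<epsilon> l]
        hop_exp_moved[OF L(1,2) ab(2,1) sgn(1), of B \<delta> m]
      by (simp add: hop_def hop_basis_def mov comm cartan_commute[of b a]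
          flip: power_int_add)
        (simp add: algebra_simps)
  next
    case False
    then show ?thesis by (auto simp: hop_def hop_basis_def mov)
  qed
qed

lemma hop_commute:
  assumes "finite L" "l \<in> L" "m \<in> L" "a \<in> {1..<n}" "b \<in> {1..<n}"
    and "\<epsilon> \<in> {1, -1}" "\<delta> \<in> {1, -1}" "l \<noteq> m \<or> cartan a b = 0"
  shows "hop n L \<epsilon> a l (hop n L \<delta> b m x) =
    scale (qq powi (- \<epsilon> * \<delta> * cartan a b *
        (of_bool (\<epsilon> * (m - l) > 0) - of_bool (\<delta> * (l - m) > 0))))
      (hop n L \<delta> b m (hop n L \<epsilon> a l x))"
  using hop_commute_basis[OF assms] unfolding hop_def by (rule lin_ext_eqI)

lemma hop_hop_same:
  assumes "a \<in> {1..<n}"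
  shows "hop n L \<epsilon> a l (hop n L \<epsilon> a l x) = 0"
proof -
  have "site n l (a - 1) \<noteq> site n l a" using assms by (auto simp: site_eq_iff)
  then have "hop n L \<epsilon> a l (hop_basis n L \<epsilon> a l B) = 0" for B
    by (auto simp: hop_def hop_basis_def movable_def moved_def hop_from_def hop_to_def)
  then show ?thesis by (simp add: hop_def lin_ext_lin_ext)
qed

text \<open>The hops of index \<open>a\<close> and \<open>b\<close> share one site. If it is the target of the hop of index \<open>a\<close>, the
  particle moves on and the second hop of index \<open>a\<close> finds its source empty. If it is the source, the
  hop of index \<open>b\<close> refills it, but the target is still occupied.\<close>

lemma hop_hop_hop_same:
  assumes "a \<in> {1..<n}" "b \<in> {1..<n}" "cartan a b = -1"
  shows "hop n L \<epsilon> a l (hop n L \<epsilon> b l (hop n L \<epsilon> a l x)) = 0"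
proof -
  have ne: "site n l (a - 1) \<noteq> site n l a" "site n l (b - 1) \<noteq> site n l b"
    "site n l a \<noteq> site n l b"
    "(site n l (a - 1) = site n l b) \<noteq> (site n l a = site n l (b - 1))"
    using assms by (auto simp: site_eq_iff cartan_def split: if_splits)
  then have "hop n L \<epsilon> a l (hop n L \<epsilon> b l (hop_basis n L \<epsilon> a l B)) = 0" for B
    by (auto simp: hop_def hop_basis_def movable_def moved_def hop_from_def hop_to_def)
  then show ?thesis by (simp add: hop_def lin_ext_lin_ext)
qed

text \<open>The site shared by the two hops is the source of both or the target of both, so the first hop
  blocks the second.\<close>

lemma hop_hop_opposite:
  assumes "a \<in> {1..<n}" "b \<in> {1..<n}" "cartan a b = -1"
  shows "hop n L (-1) a l (hop n L 1 b l x) = 0" "hop n L 1 b l (hop n L (-1) a l x) = 0"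
proof -
  have ne: "site n l (a - 1) \<noteq> site n l a" "site n l (b - 1) \<noteq> site n l b"
    "site n l (a - 1) = site n l b \<or> site n l a = site n l (b - 1)"
    using assms by (auto simp: site_eq_iff cartan_def split: if_splits)
  then have "hop n L (-1) a l (hop_basis n L 1 b l B) = 0"
    "hop n L 1 b l (hop_basis n L (-1) a l B) = 0" for B
    by (auto simp: hop_def hop_basis_def movable_def moved_def hop_from_def hop_to_def)
  then show "hop n L (-1) a l (hop n L 1 b l x) = 0" "hop n L 1 b l (hop n L (-1) a l x) = 0"
    by (simp_all add: hop_def lin_ext_lin_ext)
qed

lemma hop_linear:
  "hop n L \<epsilon> a l (scale c x) = scale c (hop n L \<epsilon> a l x)"
  "hop n L \<epsilon> a l (x + y) = hop n L \<epsilon> a l x + hop n L \<epsilon> a l y"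
  "hop n L \<epsilon> a l (sum f I) = (\<Sum>i\<in>I. hop n L \<epsilon> a l (f i))"
  "hop n L \<epsilon> a l 0 = 0"
  by (simp_all add: hop_def lin_ext_scale lin_ext_add lin_ext_sum)

section \<open>The Serre relation for hopping operators\<close>

text \<open>When an index is added, its row and its column cancel, except for the diagonal entry.\<close>

lemma sum_antisymmetric:
  fixes T :: "'i \<Rightarrow> 'i \<Rightarrow> 'a::ab_group_add"
  assumes "finite I" "\<And>i j. i \<in> I \<Longrightarrow> j \<in> I \<Longrightarrow> i \<noteq> j \<Longrightarrow> T i j + T j i = 0"
    and "\<And>i. i \<in> I \<Longrightarrow> T i i = 0"
  shows "(\<Sum>i\<in>I. \<Sum>j\<in>I. T i j) = 0"
  using assms
proof (induction I)
  case (insert k I)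
  have "(\<Sum>i\<in>I. T k i) + (\<Sum>i\<in>I. T i k) = 0"
    unfolding sum.distrib[symmetric]
    by (rule sum.neutral) (use insert in auto)
  moreover have "(\<Sum>i\<in>I. \<Sum>j\<in>I. T i j) = 0"
    using insert by simp
  ultimately show ?case
    using insert.hyps insert.prems(2)[of k] by (simp add: sum.distrib add.commute)
qed simp

text \<open>The Serre expression with its two equal generators replaced by operators \<open>X\<close> and \<open>Y\<close>, which will
  be hops of the same index at two levels.\<close>

definition serre_term :: "(('a \<Rightarrow>\<^sub>0 Cq) \<Rightarrow> ('a \<Rightarrow>\<^sub>0 Cq)) \<Rightarrow> (('a \<Rightarrow>\<^sub>0 Cq) \<Rightarrow> ('a \<Rightarrow>\<^sub>0 Cq)) \<Rightarrow>
    (('a \<Rightarrow>\<^sub>0 Cq) \<Rightarrow> ('a \<Rightarrow>\<^sub>0 Cq)) \<Rightarrow> ('a \<Rightarrow>\<^sub>0 Cq) \<Rightarrow> ('a \<Rightarrow>\<^sub>0 Cq)" where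
  "serre_term X Y Z v = X (Y (Z v)) - scale (qq + inverse qq) (X (Z (Y v))) + Z (X (Y v))"


text \<open>Everything is written in terms of \<open>Z (Y (X v))\<close>. The remaining identity between scalars is
  \<open>(1 + q\<^sup>-\<^sup>2) (s t + 1) = (q + q\<^sup>-\<^sup>1) (q\<^sup>-\<^sup>2 s + t)\<close>. It fails for \<open>s = q\<^sup>-\<^sup>1\<close>, \<open>t = q\<close>; the three admissible
  pairs correspond to the positions of a third level relative to two ordered ones.\<close>

lemma serre_term_distinct:
  assumes lin: "\<And>c v. X (scale c v) = scale c (X v)" "\<And>c v. Y (scale c v) = scale c (Y v)"
      "\<And>c v. Z (scale c v) = scale c (Z v)"
    and comm: "\<And>v. X (Y v) = scale (inverse qq * inverse qq) (Y (X v))"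
      "\<And>v. X (Z v) = scale s (Z (X v))" "\<And>v. Y (Z v) = scale t (Z (Y v))"
    and st: "s = qq \<and> t = qq \<or> s = qq \<and> t = inverse qq \<or> s = inverse qq \<and> t = inverse qq"
  shows "serre_term X Y Z v + serre_term Y X Z v = 0"
proof (rule poly_mapping_eqI)
  fix k
  show "lookup (serre_term X Y Z v + serre_term Y X Z v) k = lookup 0 k"
    using st
    by (auto simp: serre_term_def lin comm lookup_add lookup_minus)
      (auto simp: field_simps)
qed

text \<open>The operators \<open>X\<close> and \<open>Z\<close> live on one level and satisfy no commutation rule, so \<open>Y\<close> is moved to the
  right of both. The coefficients of \<open>X (Z (Y v))\<close> and \<open>Z (X (Y v))\<close> then vanish separately.\<close>

lemma serre_term_one_level:
  assumes lin: "\<And>c v. X (scale c v) = scale c (X v)" "\<And>c v. Y (scale c v) = scale c (Y v)"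
      "\<And>c v. Z (scale c v) = scale c (Z v)"
    and comm: "\<And>v. Y (X v) = scale (r * r) (X (Y v))"
      "\<And>v. Y (Z v) = scale (inverse r) (Z (Y v))"
    and r: "r = qq \<or> r = inverse qq"
  shows "serre_term X Y Z v + serre_term Y X Z v = 0"
proof (rule poly_mapping_eqI)
  fix k
  show "lookup (serre_term X Y Z v + serre_term Y X Z v) k = lookup 0 k"
    using r
    by (auto simp: serre_term_def lin comm lookup_add lookup_minus)
      (auto simp: field_simps)
qed

lemma hop_commute_powers:
  assumes L: "finite L" "l \<in> L" "m \<in> L" and ab: "a \<in> {1..<n}" "b \<in> {1..<n}"
    and sgn: "\<epsilon> \<in> {1, -1}" and before: "\<epsilon> * (m - l) > 0"
  shows "hop n L \<epsilon> a l (hop n L \<epsilon> b m x) =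
      scale (qq powi - cartan a b) (hop n L \<epsilon> b m (hop n L \<epsilon> a l x))"
    "hop n L \<epsilon> b m (hop n L \<epsilon> a l x) =
      scale (qq powi cartan a b) (hop n L \<epsilon> a l (hop n L \<epsilon> b m x))"
proof -
  have ee: "\<epsilon> * \<epsilon> = 1" using sgn by auto
  have after: "\<not> \<epsilon> * (l - m) > 0" using before sgn by auto
  show *: "hop n L \<epsilon> a l (hop n L \<epsilon> b m x) =
      scale (qq powi - cartan a b) (hop n L \<epsilon> b m (hop n L \<epsilon> a l x))"
    using hop_commute[OF L ab sgn sgn, of x] before after by (auto simp: ee)
  show "hop n L \<epsilon> b m (hop n L \<epsilon> a l x) =
      scale (qq powi cartan a b) (hop n L \<epsilon> a l (hop n L \<epsilon> b m x))"
    by (simp add: * flip: power_int_add)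
qed

text \<open>The levels are ordered increasingly for \<open>f\<close> and decreasingly for \<open>e\<close>; with respect to this order both
  generators obey the same commutation rule. The third level is either new or one of the two.\<close>

lemma serre_term_hop:
  assumes L: "finite L" "l\<^sub>1 \<in> L" "l\<^sub>2 \<in> L" "l\<^sub>3 \<in> L" and ab: "a \<in> {1..<n}" "b \<in> {1..<n}"
    and sgn: "\<epsilon> \<in> {1, -1}" and cartan: "cartan a b = -1" and before: "\<epsilon> * (l\<^sub>2 - l\<^sub>1) > 0"
  shows "serre_term (hop n L \<epsilon> a l\<^sub>1) (hop n L \<epsilon> a l\<^sub>2) (hop n L \<epsilon> b l\<^sub>3) x
    + serre_term (hop n L \<epsilon> a l\<^sub>2) (hop n L \<epsilon> a l\<^sub>1) (hop n L \<epsilon> b l\<^sub>3) x = 0"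
proof -
  let ?X = "hop n L \<epsilon> a l\<^sub>1" and ?Y = "hop n L \<epsilon> a l\<^sub>2" and ?Z = "hop n L \<epsilon> b l\<^sub>3"
  have [simp]: "cartan a a = 2" "cartan b a = -1"
    using cartan by (auto simp: cartan_def split: if_splits)
  have pow: "qq powi 2 = qq * qq" "qq powi -2 = inverse qq * inverse qq"
    by (simp_all add: power_int_minus power2_eq_square)
  note [simp] = cartan pow
  note comm = hop_commute_powers[OF L(1) _ _ _ _ sgn]
  have XY: "?X (?Y v) = scale (inverse qq * inverse qq) (?Y (?X v))"
    for v using comm(1)[OF L(2,3) ab(1,1) before, of v] by simp
  have YX: "?Y (?X v) = scale (qq * qq) (?X (?Y v))" for v
    using comm(2)[OF L(2,3) ab(1,1) before, of v] by (simp add: power2_eq_square)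
  have X3: "?X (?Z v) = scale (if \<epsilon> * (l\<^sub>3 - l\<^sub>1) > 0 then qq else inverse qq) (?Z (?X v))"
    if "l\<^sub>3 \<noteq> l\<^sub>1" for v
  proof (cases "\<epsilon> * (l\<^sub>3 - l\<^sub>1) > 0")
    case True
    then show ?thesis using comm(1)[OF L(2,4) ab True, of v] by simp
  next
    case False
    then have "\<epsilon> * (l\<^sub>1 - l\<^sub>3) > 0" using that sgn by auto
    then show ?thesis using comm(2)[OF L(4,2) ab(2,1), of v] False by simp
  qed
  have Y3: "?Y (?Z v) = scale (if \<epsilon> * (l\<^sub>3 - l\<^sub>2) > 0 then qq else inverse qq) (?Z (?Y v))"
    if "l\<^sub>3 \<noteq> l\<^sub>2" for v
  proof (cases "\<epsilon> * (l\<^sub>3 - l\<^sub>2) > 0")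
    case True
    then show ?thesis using comm(1)[OF L(3,4) ab True, of v] by simp
  next
    case False
    then have "\<epsilon> * (l\<^sub>2 - l\<^sub>3) > 0" using that sgn by auto
    then show ?thesis using comm(2)[OF L(4,3) ab(2,1), of v] False by simp
  qed
  note lin = hop_linear(1)
  consider "l\<^sub>3 = l\<^sub>1" "l\<^sub>3 \<noteq> l\<^sub>2" | "l\<^sub>3 = l\<^sub>2" "l\<^sub>3 \<noteq> l\<^sub>1" | "l\<^sub>3 \<noteq> l\<^sub>1" "l\<^sub>3 \<noteq> l\<^sub>2"
    using before by fastforce
  then show ?thesis
  proof cases
    case 1
    have "\<not> \<epsilon> * (l\<^sub>3 - l\<^sub>2) > 0" using before 1 sgn by auto
    then have "?Y (?Z v) = scale (inverse qq) (?Z (?Y v))" for v using Y3[OF 1(2)] by simp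
    then show ?thesis
      by (intro serre_term_one_level[where r = qq] lin YX) simp_all
  next
    \<comment> \<open>The roles of the two levels are exchanged, which inverts the parameter \<open>r\<close>.\<close>
    case 2
    have "\<epsilon> * (l\<^sub>3 - l\<^sub>1) > 0" using before 2 sgn by auto
    then have "?X (?Z v) = scale (inverse (inverse qq)) (?Z (?X v))" for v using X3[OF 2(2)] by simp
    then have "serre_term ?Y ?X ?Z x + serre_term ?X ?Y ?Z x = 0"
      by (intro serre_term_one_level[where r = "inverse qq"] lin XY) simp_all
    then show ?thesis by (simp only: add.commute)
  next
    case 3
    show ?thesis
      by (rule serre_term_distinct[OF lin lin lin XY X3[OF 3(1)] Y3[OF 3(2)]])
        (use before sgn in auto)
  qed
qed

text \<open>On the diagonal all three terms vanish: two hops of index \<open>a\<close> on one level compose to \<open>0\<close>, even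
  with a hop of index \<open>b\<close> in between, which commutes up to a scalar if it is on a different level and
  is covered by \<open>hop_hop_hop_same\<close> otherwise.\<close>

lemma serre_term_hop_sum:
  assumes L: "finite L" "l\<^sub>3 \<in> L" and ab: "a \<in> {1..<n}" "b \<in> {1..<n}"
    and sgn: "\<epsilon> \<in> {1, -1}" and cartan: "cartan a b = -1"
  shows "(\<Sum>l\<^sub>1\<in>L. \<Sum>l\<^sub>2\<in>L.
    serre_term (hop n L \<epsilon> a l\<^sub>1) (hop n L \<epsilon> a l\<^sub>2) (hop n L \<epsilon> b l\<^sub>3) x) = 0"
proof (rule sum_antisymmetric[OF L(1)])
  fix i j assume ij: "i \<in> L" "j \<in> L" "i \<noteq> j"
  then consider "\<epsilon> * (j - i) > 0" | "\<epsilon> * (i - j) > 0" using sgn by fastforce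
  then show "serre_term (hop n L \<epsilon> a i) (hop n L \<epsilon> a j) (hop n L \<epsilon> b l\<^sub>3) x
    + serre_term (hop n L \<epsilon> a j) (hop n L \<epsilon> a i) (hop n L \<epsilon> b l\<^sub>3) x = 0"
    using serre_term_hop[OF L(1) ij(1,2) L(2) ab sgn cartan]
      serre_term_hop[OF L(1) ij(2,1) L(2) ab sgn cartan]
    by cases (simp_all add: add.commute)
next
  fix i assume i: "i \<in> L"
  have "hop n L \<epsilon> a i (hop n L \<epsilon> b l\<^sub>3 (hop n L \<epsilon> a i x)) = 0"
  proof (cases "i = l\<^sub>3")
    case False
    then show ?thesis
      using hop_commute[OF L(1) i L(2) ab sgn sgn, of "hop n L \<epsilon> a i x"] ab(1)
      by (simp add: hop_hop_same hop_linear)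
  qed (use hop_hop_hop_same ab cartan in simp)
  then show "serre_term (hop n L \<epsilon> a i) (hop n L \<epsilon> a i) (hop n L \<epsilon> b l\<^sub>3) x = 0"
    using ab(1) by (simp add: serre_term_def hop_hop_same hop_linear)
qed

section \<open>The quantum group relations\<close>

definition ladder :: "nat \<Rightarrow> int set \<Rightarrow> int \<Rightarrow> nat \<Rightarrow> (int set \<Rightarrow>\<^sub>0 Cq) \<Rightarrow> (int set \<Rightarrow>\<^sub>0 Cq)" where
  "ladder n L \<epsilon> a x = (\<Sum>l\<in>L. hop n L \<epsilon> a l x)"

definition tot_wt :: "nat \<Rightarrow> int set \<Rightarrow> nat \<Rightarrow> int set \<Rightarrow> int" where
  "tot_wt n L a B = (\<Sum>l\<in>L. wt n a l B)"

definition torus :: "nat \<Rightarrow> int set \<Rightarrow> int \<Rightarrow> nat \<Rightarrow> (int set \<Rightarrow>\<^sub>0 Cq) \<Rightarrow> (int set \<Rightarrow>\<^sub>0 Cq)" where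
  "torus n L \<kappa> a = lin_ext (\<lambda>B. single B (qq powi (\<kappa> * tot_wt n L a B)))"

lemma ladder_serre:
  assumes L: "finite L" and ab: "a \<in> {1..<n}" "b \<in> {1..<n}"
    and sgn: "\<epsilon> \<in> {1, -1}" and cartan: "cartan a b = -1"
  shows "serre_term (ladder n L \<epsilon> a) (ladder n L \<epsilon> a) (ladder n L \<epsilon> b) x = 0"
proof -
  have "serre_term (ladder n L \<epsilon> a) (ladder n L \<epsilon> a) (ladder n L \<epsilon> b) x =
    (\<Sum>l\<^sub>1\<in>L. \<Sum>l\<^sub>2\<in>L. \<Sum>l\<^sub>3\<in>L.
      serre_term (hop n L \<epsilon> a l\<^sub>1) (hop n L \<epsilon> a l\<^sub>2) (hop n L \<epsilon> b l\<^sub>3) x)"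
  proof -
    let ?S = "\<lambda>T. \<Sum>l\<^sub>1\<in>L. \<Sum>l\<^sub>2\<in>L. \<Sum>l\<^sub>3\<in>L. T (hop n L \<epsilon> a l\<^sub>1) (hop n L \<epsilon> a l\<^sub>2) (hop n L \<epsilon> b l\<^sub>3)"
    have 1: "ladder n L \<epsilon> a (ladder n L \<epsilon> a (ladder n L \<epsilon> b x)) = ?S (\<lambda>X Y Z. X (Y (Z x)))"
      by (simp add: ladder_def hop_linear)
    have 2: "ladder n L \<epsilon> a (ladder n L \<epsilon> b (ladder n L \<epsilon> a x)) = ?S (\<lambda>X Y Z. X (Z (Y x)))"
      by (simp add: ladder_def hop_linear) (rule sum.cong[OF refl], rule sum.swap)
    have 3: "ladder n L \<epsilon> b (ladder n L \<epsilon> a (ladder n L \<epsilon> a x)) = ?S (\<lambda>X Y Z. Z (X (Y x)))"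
      by (simp add: ladder_def hop_linear)
        (rule trans[OF sum.swap], rule sum.cong[OF refl], rule sum.swap)
    show ?thesis
      by (simp add: serre_term_def 1 2 3 sum.distrib sum_subtractf scale_sum)
  qed
  also have "\<dots> = (\<Sum>l\<^sub>3\<in>L. \<Sum>l\<^sub>1\<in>L. \<Sum>l\<^sub>2\<in>L.
      serre_term (hop n L \<epsilon> a l\<^sub>1) (hop n L \<epsilon> a l\<^sub>2) (hop n L \<epsilon> b l\<^sub>3) x)"
    by (rule sym, rule trans[OF sum.swap], rule sum.cong[OF refl], rule sum.swap)
  also have "\<dots> = 0"
    by (rule sum.neutral) (use serre_term_hop_sum[OF L _ ab sgn cartan] in blast)
  finally show ?thesis .
qed

lemma ladder_commute:
  assumes L: "finite L" and ab: "a \<in> {1..<n}" "b \<in> {1..<n}"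
    and sgn: "\<epsilon> \<in> {1, -1}" "\<delta> \<in> {1, -1}" and cartan: "cartan a b = 0"
  shows "ladder n L \<epsilon> a (ladder n L \<delta> b x) = ladder n L \<delta> b (ladder n L \<epsilon> a x)"
proof -
  have "hop n L \<epsilon> a l (hop n L \<delta> b m x) = hop n L \<delta> b m (hop n L \<epsilon> a l x)"
    if "l \<in> L" "m \<in> L" for l m
    using hop_commute[OF L that ab sgn, of x] cartan by simp
  then show ?thesis
    by (simp add: ladder_def hop_linear cong: sum.cong) (rule sum.swap)
qed

text \<open>With \<open>E l\<close> the sum of \<open>h\<close> over the levels from \<open>l\<close> on minus the sum over those before, the summand
  is \<open>q\<close> to the power \<open>E l\<close> minus \<open>q\<close> to the power \<open>E l'\<close> with \<open>l'\<close> the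
  next level. The induction adds a new largest level.\<close>

lemma telescope_powers:
  fixes q :: "'a::field" and h :: "int \<Rightarrow> int"
  assumes "finite L" "q \<noteq> 0"
  shows "(\<Sum>l\<in>L. (q powi h l - q powi - h l) *
      q powi (sum h {m \<in> L. m > l} - sum h {m \<in> L. m < l})) = q powi sum h L - q powi - sum h L"
  using assms(1)
proof (induction L rule: finite_linorder_max_induct)
  case (insert k L)
  have k: "k \<notin> L" "{m \<in> insert k L. m > k} = {}" "{m \<in> insert k L. m < k} = L"
    using insert.hyps by (auto dest: less_asym)
  have l: "{m \<in> insert k L. m > l} = insert k {m \<in> L. m > l}" "{m \<in> insert k L. m < l} = {m \<in> L. m < l}"
    if "l \<in> L" for l using insert.hyps that by (auto dest: less_asym)
  have "(\<Sum>l\<in>L. (q powi h l - q powi - h l) *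
      q powi (sum h {m \<in> insert k L. m > l} - sum h {m \<in> insert k L. m < l})) =
    (\<Sum>l\<in>L. q powi h k * ((q powi h l - q powi - h l) *
      q powi (sum h {m \<in> L. m > l} - sum h {m \<in> L. m < l})))"
      (is "?S = _")
    using insert.hyps(1) k(1) assms(2)
    by (intro sum.cong refl)
      (simp only: l, simp add: power_int_add power_int_diff algebra_simps)
  also have "\<dots> = q powi h k * (q powi sum h L - q powi - sum h L)"
    by (simp only: insert.IH flip: sum_distrib_left)
  finally have eq: "?S = q powi h k * (q powi sum h L - q powi - sum h L)" .
  show ?case
    unfolding sum.insert[OF insert.hyps(1) k(1)] k(2,3) eq
    using assms(2) by (simp add: power_int_add power_int_diff power_int_minus field_simps)
qed simp

lemma ladder_commutator_distinct:
  assumes L: "finite L" and ab: "a \<in> {1..<n}" "b \<in> {1..<n}" "a \<noteq> b"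
  shows "ladder n L (-1) a (ladder n L 1 b x) = ladder n L 1 b (ladder n L (-1) a x)"
proof -
  have "hop n L (-1) a l (hop n L 1 b m x) = hop n L 1 b m (hop n L (-1) a l x)"
    if lm: "l \<in> L" "m \<in> L" for l m
  proof (cases "l = m \<and> cartan a b \<noteq> 0")
    case True
    then have "cartan a b = -1" using ab by (simp add: cartan_def split: if_splits)
    then show ?thesis using True hop_hop_opposite[OF ab(1,2)] by simp
  next
    case False
    then show ?thesis using hop_commute[OF L lm ab(1,2), of "-1" 1 x] by auto
  qed
  then show ?thesis
    by (simp add: ladder_def hop_linear cong: sum.cong) (rule sum.swap)
qed

text \<open>At one level either exactly one of the two orders of hopping is possible, or none is. The weight
  is then \<open>1\<close>, \<open>-1\<close> or \<open>0\<close>, and for these values \<open>q\<^sup>w - q\<^sup>-\<^sup>w\<close> equals \<open>w (q - q\<^sup>-\<^sup>1)\<close>.\<close>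

lemma hop_commutator_basis:
  assumes L: "finite L" "l \<in> L" and a: "a \<in> {1..<n}"
  shows "scale (qq - inverse qq)
      (hop n L (-1) a l (hop_basis n L 1 a l B) - hop n L 1 a l (hop_basis n L (-1) a l B)) =
    single B ((qq powi wt n a l B - qq powi - wt n a l B) *
      qq powi ((\<Sum>m | m \<in> L \<and> m > l. wt n a m B) - (\<Sum>m | m \<in> L \<and> m < l. wt n a m B)))"
proof -
  have ne: "site n l (a - 1) \<noteq> site n l a" using a by (auto simp: site_eq_iff)
  let ?e = "(\<Sum>m | m \<in> L \<and> m > l. wt n a m B) - (\<Sum>m | m \<in> L \<and> m < l. wt n a m B)"
  have exp: "hop_exp n L 1 a l B + hop_exp n L (-1) a l B = ?e"
    by (simp add: hop_exp_def beyond_def)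
  consider "movable n 1 a l B" "\<not> movable n (-1) a l B" "wt n a l B = 1" |
    "movable n (-1) a l B" "\<not> movable n 1 a l B" "wt n a l B = -1" |
    "\<not> movable n 1 a l B" "\<not> movable n (-1) a l B" "wt n a l B = 0"
    by atomize_elim (auto simp: movable_def wt_def hop_from_def hop_to_def)
  then show ?thesis
  proof cases
    case 1
    then have inv: "movable n (-1) a l (moved n 1 a l B)" "moved n (-1) a l (moved n 1 a l B) = B"
      using ne by (auto simp: movable_def moved_def hop_from_def hop_to_def)
    have "hop_exp n L (-1) a l (moved n 1 a l B) = hop_exp n L (-1) a l B"
      using hop_exp_moved[OF L a a, of 1 B "-1" l] 1 by simp
    then have "hop n L (-1) a l (hop_basis n L 1 a l B) = single B (qq powi ?e)"
      using 1 inv by (simp add: hop_def hop_basis_def flip: power_int_add exp)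
    then show ?thesis
      using 1 by (simp add: hop_def hop_basis_def)
  next
    case 2
    then have inv: "movable n 1 a l (moved n (-1) a l B)" "moved n 1 a l (moved n (-1) a l B) = B"
      using ne by (auto simp: movable_def moved_def hop_from_def hop_to_def)
    have "hop_exp n L 1 a l (moved n (-1) a l B) = hop_exp n L 1 a l B"
      using hop_exp_moved[OF L a a, of "-1" B 1 l] 2 by simp
    then have "hop n L 1 a l (hop_basis n L (-1) a l B) = single B (qq powi ?e)"
      using 2 inv by (simp add: hop_def hop_basis_def add.commute flip: power_int_add exp)
    then show ?thesis
      using 2 by (simp add: hop_def hop_basis_def scale_diff flip: single_uminus)
        (simp add: algebra_simps)
  qed (simp_all add: hop_def hop_basis_def)
qed

lemma hop_hop:
  "hop n L \<epsilon> a l (hop n L \<delta> b m x) = lin_ext (\<lambda>B. hop n L \<epsilon> a l (hop_basis n L \<delta> b m B)) x"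
  by (simp add: hop_def lin_ext_lin_ext)

lemma ladder_commutator_same:
  assumes L: "finite L" and a: "a \<in> {1..<n}"
  shows "ladder n L (-1) a (ladder n L 1 a x) - ladder n L 1 a (ladder n L (-1) a x) =
    scale (1 / (qq - inverse qq)) (torus n L 1 a x - torus n L (-1) a x)"
proof -
  let ?d = "\<lambda>l B. hop n L (-1) a l (hop_basis n L 1 a l B) - hop n L 1 a l (hop_basis n L (-1) a l B)"
  have EF: "ladder n L (-1) a (ladder n L 1 a x) =
      (\<Sum>l\<in>L. \<Sum>m\<in>L. hop n L (-1) a l (hop n L 1 a m x))"
    by (simp add: ladder_def hop_linear)
  have FE: "ladder n L 1 a (ladder n L (-1) a x) =
      (\<Sum>l\<in>L. \<Sum>m\<in>L. hop n L 1 a m (hop n L (-1) a l x))"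
    by (simp add: ladder_def hop_linear) (rule sum.swap)
  \<comment> \<open>Hops in opposite directions at different levels commute exactly.\<close>
  have "hop n L (-1) a l (hop n L 1 a m x) - hop n L 1 a m (hop n L (-1) a l x) =
      (if l = m then hop n L (-1) a l (hop n L 1 a l x) - hop n L 1 a l (hop n L (-1) a l x) else 0)"
    if "l \<in> L" "m \<in> L" for l m
    using hop_commute[OF L that a a, of "-1" 1 x] by auto
  then have "ladder n L (-1) a (ladder n L 1 a x) - ladder n L 1 a (ladder n L (-1) a x) =
      (\<Sum>l\<in>L. \<Sum>m\<in>L.
        if l = m then hop n L (-1) a l (hop n L 1 a l x) - hop n L 1 a l (hop n L (-1) a l x) else 0)"
    unfolding EF FE by (simp flip: sum_subtractf)
  also have "\<dots> = (\<Sum>l\<in>L. lin_ext (?d l) x)"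
    using L by (simp add: lin_ext_diff_fun hop_hop)
  also have "\<dots> = lin_ext (\<lambda>B. \<Sum>l\<in>L. ?d l B) x"
    by (simp add: lin_ext_sum_fun)
  also have "\<dots> = lin_ext (\<lambda>B. scale (1 / (qq - inverse qq))
      (single B (qq powi tot_wt n L a B) - single B (qq powi - tot_wt n L a B))) x"
  proof (rule lin_ext_cong)
    fix B
    have "scale (qq - inverse qq) (\<Sum>l\<in>L. ?d l B) =
        single B (qq powi tot_wt n L a B - qq powi - tot_wt n L a B)"
      unfolding tot_wt_def
      unfolding telescope_powers[OF L qq_neq_0, symmetric] scale_sum single_sum
      by (rule sum.cong[OF refl], rule hop_commutator_basis[OF L _ a])
    then have "scale (1 / (qq - inverse qq)) (scale (qq - inverse qq) (\<Sum>l\<in>L. ?d l B)) =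
        scale (1 / (qq - inverse qq)) (single B (qq powi tot_wt n L a B - qq powi - tot_wt n L a B))"
      by (rule arg_cong)
    then show "(\<Sum>l\<in>L. ?d l B) = scale (1 / (qq - inverse qq))
      (single B (qq powi tot_wt n L a B) - single B (qq powi - tot_wt n L a B))"
      using qq_minus_inverse by (simp add: single_diff)
  qed
  also have "\<dots> = scale (1 / (qq - inverse qq)) (torus n L 1 a x - torus n L (-1) a x)"
    by (simp add: torus_def lin_ext_def scale_sum scale_diff sum_subtractf mult.commute)
  finally show ?thesis .
qed

lemma torus_torus:
  "torus n L \<kappa> a (torus n L \<mu> b x) = torus n L \<mu> b (torus n L \<kappa> a x)"
  by (simp add: torus_def lin_ext_lin_ext mult.commute)

lemma torus_inverse:
  "torus n L 1 a (torus n L (-1) a x) = x" "torus n L (-1) a (torus n L 1 a x) = x"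
  by (simp_all add: torus_def lin_ext_lin_ext flip: power_int_add)

lemma torus_linear:
  "torus n L \<kappa> a (scale c x) = scale c (torus n L \<kappa> a x)"
  "torus n L \<kappa> a (sum f I) = (\<Sum>i\<in>I. torus n L \<kappa> a (f i))"
  by (simp_all add: torus_def lin_ext_scale lin_ext_sum)

lemma torus_hop:
  assumes "finite L" "m \<in> L" "a \<in> {1..<n}" "b \<in> {1..<n}" "\<delta> \<in> {1, -1}"
  shows "torus n L \<kappa> a (hop n L \<delta> b m x) =
    scale (qq powi (- \<kappa> * \<delta> * cartan a b)) (hop n L \<delta> b m (torus n L \<kappa> a x))"
  unfolding torus_def hop_def
proof (rule lin_ext_eqI)
  fix B
  have tot: "tot_wt n L a (moved n \<delta> b m B) = tot_wt n L a B - \<delta> * cartan a b" if "movable n \<delta> b m B"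
    using assms that by (simp add: tot_wt_def wt_moved sum_subtractf sum.delta)
  show "lin_ext (\<lambda>B. single B (qq powi (\<kappa> * tot_wt n L a B))) (hop_basis n L \<delta> b m B) =
      scale (qq powi (- \<kappa> * \<delta> * cartan a b))
        (lin_ext (hop_basis n L \<delta> b m) (single B (qq powi (\<kappa> * tot_wt n L a B))))"
    by (auto simp: hop_basis_def tot simp flip: power_int_add) (simp add: algebra_simps)
qed

lemma torus_ladder:
  assumes "finite L" "a \<in> {1..<n}" "b \<in> {1..<n}" "\<delta> \<in> {1, -1}"
  shows "torus n L \<kappa> a (ladder n L \<delta> b x) =
    scale (qq powi (- \<kappa> * \<delta> * cartan a b)) (ladder n L \<delta> b (torus n L \<kappa> a x))"
  using torus_hop[OF assms(1) _ assms(2-4)]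
  by (simp add: ladder_def torus_linear scale_sum cong: sum.cong)


section \<open>Beta-sets and their sections\<close>

lemma psum_Suc: "j \<in> {1..length ns} \<Longrightarrow> psum ns j = psum ns (j - 1) + part ns j"
  by (cases j) (auto simp: psum_def part_def take_Suc_conv_app_nth)

lemma psum_mono: "i \<le> j \<Longrightarrow> psum ns i \<le> psum ns j"
proof -
  assume "i \<le> j"
  then have "take j ns = take i ns @ take (j - i) (drop i ns)"
    by (metis take_add le_add_diff_inverse)
  then show ?thesis by (simp add: psum_def)
qed

lemma psum_le: "psum ns j \<le> sum_list ns"
  using psum_mono[of j "max j (length ns)" ns] by (simp add: psum_def)

lemma block_exists:
  assumes "a < sum_list ns"
  shows "\<exists>j\<in>{1..length ns}. psum ns (j - 1) \<le> a \<and> a < psum ns j"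
proof -
  define j where "j = (LEAST j. a < psum ns j)"
  have ex: "a < psum ns (length ns)" using assms by (simp add: psum_def)
  have j: "a < psum ns j" unfolding j_def using ex by (rule LeastI)
  have "j \<noteq> 0" using j by (intro notI) (simp add: psum_def)
  moreover have "\<not> a < psum ns (j - 1)" using \<open>j \<noteq> 0\<close> unfolding j_def by (intro not_less_Least) simp
  moreover have "j \<le> length ns" unfolding j_def using ex by (rule Least_le)
  ultimately show ?thesis using j by (intro bexI[of _ j]) auto
qed

lemma block_unique:
  assumes "psum ns (j - 1) \<le> a" "a < psum ns j" "psum ns (j' - 1) \<le> a" "a < psum ns j'"
  shows "j = j'"
proof (rule ccontr)
  assume "j \<noteq> j'"
  then consider "j \<le> j' - 1" | "j' \<le> j - 1" by linarith
  then show False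
    using assms psum_mono[of j "j' - 1" ns] psum_mono[of j' "j - 1" ns] by cases auto
qed

text \<open>The element of the interval belonging to \<open>k = (i, j)\<close> whose coordinate in the section is \<open>y\<close>.\<close>

definition pos :: "nat list \<Rightarrow> int \<times> nat \<Rightarrow> nat \<Rightarrow> int" where
  "pos ns k y = site (sum_list ns) (fst k) (psum ns (snd k - 1) + y)"

lemma pos_bound:
  assumes "k \<in> idx ns" "y < part ns (snd k)"
  shows "psum ns (snd k - 1) + y < psum ns (snd k)" "psum ns (snd k - 1) + y < sum_list ns"
proof -
  show "psum ns (snd k - 1) + y < psum ns (snd k)"
    using assms psum_Suc[of "snd k" ns] by (auto simp: idx_def)
  then show "psum ns (snd k - 1) + y < sum_list ns" using psum_le[of ns "snd k"] by linarith
qed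

lemma pos_eq_iff:
  assumes "k \<in> idx ns" "y < part ns (snd k)" "k' \<in> idx ns" "y' < part ns (snd k')"
  shows "pos ns k y = pos ns k' y' \<longleftrightarrow> k = k' \<and> y = y'"
proof
  note b = pos_bound[OF assms(1,2)] pos_bound[OF assms(3,4)]
  assume "pos ns k y = pos ns k' y'"
  then have eq: "fst k = fst k'" "psum ns (snd k - 1) + y = psum ns (snd k' - 1) + y'"
    using b by (simp_all add: pos_def site_eq_iff)
  moreover have "snd k = snd k'"
    by (rule block_unique[of ns _ "psum ns (snd k - 1) + y"]) (use b eq in auto)
  ultimately show "k = k' \<and> y = y'" by (auto simp: prod_eq_iff)
qed auto

lemma pos_cases:
  assumes "sum_list ns > 0"
  obtains k y where "k \<in> idx ns" "y < part ns (snd k)" "x = pos ns k y"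
proof -
  let ?n = "int (sum_list ns)"
  have m: "0 \<le> x mod ?n" "x mod ?n < ?n" using assms by auto
  then have "nat (x mod ?n) < sum_list ns" by linarith
  then obtain j where j: "j \<in> {1..length ns}" "psum ns (j - 1) \<le> nat (x mod ?n)" "nat (x mod ?n) < psum ns j"
    using block_exists by blast
  show thesis
  proof
    show "(x div ?n, j) \<in> idx ns" using j by (simp add: idx_def)
    show "nat (x mod ?n) - psum ns (j - 1) < part ns (snd (x div ?n, j))"
      using j psum_Suc[OF j(1)] by simp
    show "x = pos ns (x div ?n, j) (nat (x mod ?n) - psum ns (j - 1))"
      using j m by (simp add: pos_def site_def)
  qed
qed

lemma section_set_eq:
  assumes "(i, j) \<in> idx ns"
  shows "section_set ns i j B = {y. y < part ns j \<and> pos ns (i, j) y \<in> B}"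
proof -
  have p: "int (psum ns j) = int (psum ns (j - 1)) + int (part ns j)"
    using psum_Suc[of j ns] assms by (simp add: idx_def)
  show ?thesis
  proof (intro equalityI subsetI)
    fix y assume "y \<in> section_set ns i j B"
    then show "y \<in> {y. y < part ns j \<and> pos ns (i, j) y \<in> B}"
      using p by (auto simp: section_set_def section_ints_def pos_def site_def)
  next
    fix y assume "y \<in> {y. y < part ns j \<and> pos ns (i, j) y \<in> B}"
    then show "y \<in> section_set ns i j B"
      unfolding section_set_def using p
      by (intro image_eqI[of _ _ "pos ns (i, j) y"]) (auto simp: section_ints_def pos_def site_def)
  qed
qed

lemma card_section_set: "card (section_set ns i j B) = card (B \<inter> section_ints ns i j)"
  unfolding section_set_def by (rule card_image) (auto simp: inj_on_def section_ints_def)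

lemma sections_apply: "k \<in> idx ns \<Longrightarrow> sections ns B k = {y. y < part ns (snd k) \<and> pos ns k y \<in> B}"
  by (cases k) (simp add: sections_def section_set_eq)

lemma mem_sections: "k \<in> idx ns \<Longrightarrow> y < part ns (snd k) \<Longrightarrow> y \<in> sections ns B k \<longleftrightarrow> pos ns k y \<in> B"
  by (simp add: sections_apply)

lemma section_type_eq: "section_type ns B = (\<lambda>k\<in>idx ns. card (sections ns B k))"
  by (auto simp: section_type_def sections_def card_section_set fun_eq_iff)

lemma subset_families_iff:
  "X \<in> subset_families ns t \<longleftrightarrow>
    X \<in> extensional (idx ns) \<and> (\<forall>k\<in>idx ns. X k \<subseteq> {..<part ns (snd k)} \<and> card (X k) = t k)"
  by (simp add: subset_families_def case_prod_beta dsubsets_def PiE_iff) blast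

lemma types_iff:
  "t \<in> types ns \<longleftrightarrow> t \<in> extensional (idx ns) \<and> (\<forall>k\<in>idx ns. t k \<le> part ns (snd k)) \<and>
    finite {k \<in> idx ns. 0 \<le> fst k \<and> t k \<noteq> 0} \<and> finite {k \<in> idx ns. fst k < 0 \<and> t k \<noteq> part ns (snd k)}"
  (is "_ \<longleftrightarrow> ?r")
proof -
  have "{(i, j). (i, j) \<in> idx ns \<and> 0 \<le> i \<and> t (i, j) \<noteq> 0} = {k \<in> idx ns. 0 \<le> fst k \<and> t k \<noteq> 0}"
    by auto
  moreover have neg: "{(i, j). (i, j) \<in> idx ns \<and> i < 0 \<and> part ns j - t (i, j) \<noteq> 0} =
      {k \<in> idx ns. fst k < 0 \<and> t k \<noteq> part ns (snd k)}" if "\<forall>k\<in>idx ns. t k \<le> part ns (snd k)"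
    using that by (fastforce simp: not_less)
  moreover have "t \<in> (\<Pi>\<^sub>E (i, j)\<in>idx ns. {..part ns j}) \<longleftrightarrow>
      t \<in> extensional (idx ns) \<and> (\<forall>k\<in>idx ns. t k \<le> part ns (snd k))"
    by (simp add: PiE_iff case_prod_beta) blast
  ultimately show ?thesis
    unfolding types_def mem_Collect_eq
    by (cases "\<forall>k\<in>idx ns. t k \<le> part ns (snd k)") (simp_all only: simp_thms conj_assoc)
qed

lemma sections_eq_iff:
  assumes "sum_list ns > 0"
  shows "sections ns B = sections ns C \<longleftrightarrow> B = C"
proof
  assume eq: "sections ns B = sections ns C"
  have "x \<in> B \<longleftrightarrow> x \<in> C" for x
    using pos_cases[OF assms, of x] mem_sections eq by metis
  then show "B = C" by blast
qed simp

definition unsections :: "nat list \<Rightarrow> (int \<times> nat \<Rightarrow> nat set) \<Rightarrow> int set" where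
  "unsections ns X = (\<Union>k\<in>idx ns. pos ns k ` X k)"

lemma pos_mem_unsections:
  assumes "\<And>k. k \<in> idx ns \<Longrightarrow> X k \<subseteq> {..<part ns (snd k)}" "k \<in> idx ns" "y < part ns (snd k)"
  shows "pos ns k y \<in> unsections ns X \<longleftrightarrow> y \<in> X k"
  using assms by (auto simp: unsections_def pos_eq_iff subset_iff)

lemma sections_unsections:
  assumes "X \<in> subset_families ns t"
  shows "sections ns (unsections ns X) = X"
proof (rule extensionalityI)
  show "sections ns (unsections ns X) \<in> extensional (idx ns)" by (simp add: sections_def)
  show "X \<in> extensional (idx ns)" using assms by (simp add: subset_families_iff)
  fix k assume "k \<in> idx ns"
  then show "sections ns (unsections ns X) k = X k"
    using assms pos_mem_unsections[of ns X k] by (auto simp: sections_apply subset_families_iff)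
qed

lemma pos_nonneg_iff:
  assumes "k \<in> idx ns" "y < part ns (snd k)"
  shows "0 \<le> pos ns k y \<longleftrightarrow> 0 \<le> fst k"
proof -
  let ?n = "int (sum_list ns)"
  have "pos ns k y div ?n = fst k" unfolding pos_def by (rule site_div[OF pos_bound(2)[OF assms]])
  moreover have "?n > 0" using pos_bound[OF assms] by simp
  ultimately show ?thesis by (metis pos_imp_zdiv_nonneg_iff)
qed

text \<open>Only finitely many intervals with nonnegative elements meet \<open>B\<close>, and only finitely many
  intervals with negative elements are not contained in \<open>B\<close>.\<close>

lemma beta_set_if_type:
  assumes n: "sum_list ns > 0" and t: "t \<in> types ns" and B: "section_type ns B = t"
  shows "B \<in> beta_sets"
proof -
  have card: "card (sections ns B k) = t k" if "k \<in> idx ns" for k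
    using fun_cong[OF B, of k] that by (simp add: section_type_eq)
  have "{0..} \<inter> B \<subseteq> (\<Union>k\<in>{k \<in> idx ns. 0 \<le> fst k \<and> t k \<noteq> 0}. pos ns k ` {..<part ns (snd k)})"
  proof
    fix x assume x: "x \<in> {0..} \<inter> B"
    obtain k y where k: "k \<in> idx ns" "y < part ns (snd k)" "x = pos ns k y"
      using pos_cases[OF n] by blast
    have "y \<in> sections ns B k" "finite (sections ns B k)" using k x by (auto simp: sections_apply)
    then have "card (sections ns B k) \<noteq> 0" by auto
    then have "t k \<noteq> 0" using card[OF k(1)] by simp
    then show "x \<in> (\<Union>k\<in>{k \<in> idx ns. 0 \<le> fst k \<and> t k \<noteq> 0}. pos ns k ` {..<part ns (snd k)})"
      using k x by (intro UN_I[of k]) (auto simp: pos_nonneg_iff)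
  qed
  moreover have "{..<0} - B \<subseteq> (\<Union>k\<in>{k \<in> idx ns. fst k < 0 \<and> t k \<noteq> part ns (snd k)}. pos ns k ` {..<part ns (snd k)})"
  proof
    fix x assume x: "x \<in> {..<0} - B"
    obtain k y where k: "k \<in> idx ns" "y < part ns (snd k)" "x = pos ns k y"
      using pos_cases[OF n] by blast
    have "sections ns B k \<subset> {..<part ns (snd k)}" using k x by (auto simp: sections_apply)
    then have "card (sections ns B k) < part ns (snd k)" using psubset_card_mono[of "{..<part ns (snd k)}"] by simp
    then have "t k \<noteq> part ns (snd k)" using card[OF k(1)] by simp
    then show "x \<in> (\<Union>k\<in>{k \<in> idx ns. fst k < 0 \<and> t k \<noteq> part ns (snd k)}. pos ns k ` {..<part ns (snd k)})"
      using k x pos_nonneg_iff[OF k(1,2)] by (intro UN_I[of k]) auto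
  qed
  ultimately show ?thesis
    using t unfolding types_iff beta_sets_def by (auto elim!: finite_subset)
qed

lemma sections_in:
  assumes "B \<in> beta_sets_of_type ns t"
  shows "sections ns B \<in> subset_families ns t"
proof -
  have "section_type ns B = t" using assms by (simp add: beta_sets_of_type_def)
  then have "card (sections ns B k) = t k" if "k \<in> idx ns" for k
    using that by (auto simp: section_type_eq)
  then show ?thesis by (auto simp: subset_families_iff sections_apply) (simp add: sections_def)
qed

lemma type_if_sections:
  assumes n: "sum_list ns > 0" and t: "t \<in> types ns" and B: "sections ns B \<in> subset_families ns t"
  shows "B \<in> beta_sets_of_type ns t"
proof -
  have "section_type ns B = t"
    unfolding section_type_eq using B t
    by (intro extensionalityI[where A = "idx ns"]) (simp_all add: subset_families_iff types_iff)
  then show ?thesis using beta_set_if_type[OF n t] by (simp add: beta_sets_of_type_def)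
qed

lemma bij_betw_sections:
  assumes n: "sum_list ns > 0" and t: "t \<in> types ns"
  shows "bij_betw (sections ns) (beta_sets_of_type ns t) (subset_families ns t)"
  unfolding bij_betw_def
proof (intro conjI equalityI subsetI)
  show "inj_on (sections ns) (beta_sets_of_type ns t)"
    by (simp add: inj_on_def sections_eq_iff[OF n])
  fix X assume X: "X \<in> subset_families ns t"
  then have "unsections ns X \<in> beta_sets_of_type ns t"
    by (intro type_if_sections[OF n t]) (simp add: sections_unsections)
  then show "X \<in> sections ns ` beta_sets_of_type ns t"
    using sections_unsections[OF X] by (metis imageI)
qed (auto intro: sections_in)


section \<open>The action on the Fock space as a sum over levels\<close>

text \<open>Outside these finitely many levels every section is empty or full, so that no hop inside a block is
  possible and the corresponding weights vanish.\<close>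

definition level_set :: "nat list \<Rightarrow> (int \<times> nat \<Rightarrow> nat) \<Rightarrow> int set" where
  "level_set ns t = {i. \<exists>j\<in>{1..length ns}. t (i, j) \<noteq> 0 \<and> t (i, j) \<noteq> part ns j}"

lemma finite_level_set:
  assumes "t \<in> types ns"
  shows "finite (level_set ns t)"
proof (rule finite_subset)
  let ?A = "{k \<in> idx ns. 0 \<le> fst k \<and> t k \<noteq> 0} \<union> {k \<in> idx ns. fst k < 0 \<and> t k \<noteq> part ns (snd k)}"
  show "finite (fst ` ?A)" using assms by (auto simp: types_iff)
  show "level_set ns t \<subseteq> fst ` ?A"
  proof
    fix i assume "i \<in> level_set ns t"
    then obtain j where "j \<in> {1..length ns}" "t (i, j) \<noteq> 0" "t (i, j) \<noteq> part ns j"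
      by (auto simp: level_set_def)
    then show "i \<in> fst ` ?A"
      by (intro image_eqI[of _ _ "(i, j)"]) (auto simp: idx_def)
  qed
qed

lemma set_levels: "t \<in> types ns \<Longrightarrow> set (levels ns t) = level_set ns t"
  using finite_level_set[of t ns] by (simp add: levels_def level_set_def)

lemma Un_index_block:
  assumes "a \<in> Un_indices ns"
  obtains j where "j \<in> {1..length ns}" "psum ns (j - 1) < a" "a < psum ns j" "a \<in> {1..<sum_list ns}"
proof -
  have a: "a < sum_list ns" "a \<notin> psum ns ` {0..<length ns}"
    using assms by (auto simp: Un_indices_def)
  obtain j where j: "j \<in> {1..length ns}" "psum ns (j - 1) \<le> a" "a < psum ns j"
    using block_exists[OF a(1)] by blast
  have "psum ns (j - 1) \<noteq> a" using a(2) j(1) by auto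
  then show thesis using that[of j] j a(1) by auto
qed

lemma full_or_empty_level:
  assumes t: "t \<in> types ns" and B: "B \<in> beta_sets_of_type ns t" and k: "k \<in> idx ns"
    and l: "fst k \<notin> level_set ns t"
  shows "sections ns B k = {} \<or> sections ns B k = {..<part ns (snd k)}"
proof -
  have X: "sections ns B k \<subseteq> {..<part ns (snd k)}" "card (sections ns B k) = t k"
    using sections_in[OF B] k by (simp_all add: subset_families_iff)
  then have fin: "finite (sections ns B k)" by (auto intro: finite_subset)
  have "t k = 0 \<or> t k = part ns (snd k)"
    using l k by (cases k) (auto simp: level_set_def idx_def)
  then show ?thesis using X fin card_subset_eq[OF finite_lessThan X(1)] by auto
qed

lemma site_pos:
  assumes "psum ns (j - 1) < a" "a < psum ns j" "j \<in> {1..length ns}"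
  shows "site (sum_list ns) l a = pos ns (l, j) (a - psum ns (j - 1))"
    "site (sum_list ns) l (a - 1) = pos ns (l, j) (a - psum ns (j - 1) - 1)"
    "a - psum ns (j - 1) < part ns j" "a - psum ns (j - 1) - 1 < part ns j" "0 < a - psum ns (j - 1)"
  using assms psum_Suc[OF assms(3)] by (auto simp: pos_def)

lemma site_off_level:
  assumes t: "t \<in> types ns" and B: "B \<in> beta_sets_of_type ns t" and a: "a \<in> Un_indices ns"
    and l: "l \<notin> level_set ns t"
  shows "site (sum_list ns) l (a - 1) \<in> B \<longleftrightarrow> site (sum_list ns) l a \<in> B"
proof -
  obtain j where j: "j \<in> {1..length ns}" "psum ns (j - 1) < a" "a < psum ns j"
    using Un_index_block[OF a] by blast
  have k: "(l, j) \<in> idx ns" using j(1) by (simp add: idx_def)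
  note s = site_pos[OF j(2,3,1)]
  show ?thesis
    using full_or_empty_level[OF t B k] l s mem_sections[OF k, of _ B] by auto
qed

lemma cong_site_cases:
  assumes "a < n" "[y = int a] (mod int n)"
  obtains l where "y = site n l a"
proof -
  obtain m where "y = int a + int n * m"
    using assms(2) by (metis cong_iff_lin cong_sym)
  then show thesis using that[of m] by (simp add: site_def mult.commute)
qed

lemma cong_site: "[site n l a = int a] (mod int n)"
  by (simp add: site_def cong_def)

text \<open>The exponents in the action on the Fock space are differences of two cardinalities, taken over
  infinitely many levels. Where the two sets agree, a level contributes nothing.\<close>

lemma card_diff_eq_sum:
  assumes "finite A" "finite B" "finite M" "\<And>m. m \<notin> M \<Longrightarrow> m \<in> A \<longleftrightarrow> m \<in> B"
  shows "int (card A) - int (card B) = (\<Sum>m\<in>M. of_bool (m \<in> A) - of_bool (m \<in> B))"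
proof -
  have c: "int (card C) = (\<Sum>m\<in>M \<union> A \<union> B. of_bool (m \<in> C))" if "C \<subseteq> A \<union> B" for C
    using that assms(1-3) by (simp add: sum.If_cases of_bool_def Int_absorb1 le_supI1 subset_iff)
  have "int (card A) - int (card B) = (\<Sum>m\<in>M \<union> A \<union> B. of_bool (m \<in> A) - of_bool (m \<in> B))"
    by (simp add: c sum_subtractf)
  also have "\<dots> = (\<Sum>m\<in>M. of_bool (m \<in> A) - of_bool (m \<in> B))"
    by (rule sum.mono_neutral_right) (use assms in auto)
  finally show ?thesis .
qed

lemma site_less_iff:
  assumes "a < n" "b < n" "l \<noteq> m"
  shows "site n l a < site n m b \<longleftrightarrow> l < m"
proof
  assume "site n l a < site n m b"
  then have "site n l a div int n \<le> site n m b div int n" using assms by (intro zdiv_mono1) auto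
  then show "l < m" using assms by (simp add: site_div)
next
  assume lm: "l < m"
  show "site n l a < site n m b"
  proof (rule ccontr)
    assume "\<not> site n l a < site n m b"
    then have "site n m b div int n \<le> site n l a div int n" using assms by (intro zdiv_mono1) auto
    then show False using assms lm by (simp add: site_div)
  qed
qed

text \<open>Almost all nonnegative integers are missing from a \<open>\<beta>\<close>-set and almost all negative ones belong to it.\<close>

lemma finite_sites:
  assumes B: "B \<in> beta_sets" and n: "a < n"
  shows "finite {m. m > l \<and> site n m a \<in> B}" "finite {m. m < l \<and> site n m a \<notin> B}"
proof -
  have sgn: "0 \<le> site n m a \<longleftrightarrow> 0 \<le> m" for m
    using n by (metis site_div of_nat_0_less_iff pos_imp_zdiv_nonneg_iff gr_implies_not0 neq0_conv)
  have inj: "inj (\<lambda>m. site n m a)" using n by (auto simp: inj_def site_eq_iff)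
  have "{m. m > l \<and> site n m a \<in> B} \<subseteq> {l..<0} \<union> (\<lambda>m. site n m a) -` ({0..} \<inter> B)"
    using sgn by auto
  moreover have "finite ({l..<0} \<union> (\<lambda>m. site n m a) -` ({0..} \<inter> B))"
    using B inj by (intro finite_UnI finite_vimageI) (auto simp: beta_sets_def)
  ultimately show "finite {m. m > l \<and> site n m a \<in> B}" by (rule finite_subset)
  have "{m. m < l \<and> site n m a \<notin> B} \<subseteq> {0..<l} \<union> (\<lambda>m. site n m a) -` ({..<0} - B)"
    using sgn by (auto simp: not_le[symmetric])
  moreover have "finite ({0..<l} \<union> (\<lambda>m. site n m a) -` ({..<0} - B))"
    using B inj by (intro finite_UnI finite_vimageI) (auto simp: beta_sets_def)
  ultimately show "finite {m. m < l \<and> site n m a \<notin> B}" by (rule finite_subset)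
qed

lemma card_sites:
  assumes "a < n"
  shows "card {y. [y = int a] (mod int n) \<and> P y} = card {m. P (site n m a)}"
proof -
  have "{y. [y = int a] (mod int n) \<and> P y} = (\<lambda>m. site n m a) ` {m. P (site n m a)}"
    using cong_site cong_site_cases[OF assms] by (auto simp: image_iff) metis
  then show ?thesis
    using assms by (simp add: card_image inj_on_def site_eq_iff)
qed

lemma cong_site_shift:
  "[y = site n l a] (mod int n) \<longleftrightarrow> [y = int a] (mod int n)"
  by (simp add: site_def cong_def)

lemma site_minus_one: "0 < a \<Longrightarrow> site n l a - 1 = site n l (a - 1)"
  by (simp add: site_def of_nat_diff)


lemma site_greater_iff:
  assumes "a \<in> {1..<n}"
  shows "site n m (a - 1) > site n l a \<longleftrightarrow> l < m" "site n m a > site n l a \<longleftrightarrow> l < m"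
    "site n m (a - 1) < site n l (a - 1) \<longleftrightarrow> m < l" "site n m a < site n l (a - 1) \<longleftrightarrow> m < l"
proof -
  have a: "a < n" "a - 1 < n" using assms by auto
  have "site n l (a - 1) < site n l a" for l using assms by (simp add: site_def)
  then have s: "\<not> site n l a < site n l (a - 1)" "site n l (a - 1) < site n l a" for l
    by (simp_all add: not_less less_imp_le)
  show "site n m (a - 1) > site n l a \<longleftrightarrow> l < m"
    using site_less_iff[OF a(1,2), of l m] s(1)[of l] by (cases "l = m") simp_all
  show "site n m a > site n l a \<longleftrightarrow> l < m"
    using site_less_iff[OF a(1,1), of l m] by (cases "l = m") simp_all
  show "site n m (a - 1) < site n l (a - 1) \<longleftrightarrow> m < l"
    using site_less_iff[OF a(2,2), of m l] by (cases "l = m") simp_all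
  show "site n m a < site n l (a - 1) \<longleftrightarrow> m < l"
    using site_less_iff[OF a(1,2), of m l] s(1)[of l] by (cases "l = m") simp_all
qed

context
  fixes ns :: "nat list" and t :: "int \<times> nat \<Rightarrow> nat" and a :: nat and B :: "int set" and n :: nat
    and L :: "int set"
  assumes t: "t \<in> types ns" and a: "a \<in> Un_indices ns" and B: "B \<in> beta_sets_of_type ns t"
  defines "n \<equiv> sum_list ns" and "L \<equiv> level_set ns t"
begin

private lemma a_range: "a \<in> {1..<n}" "a < n" "a - 1 < n" "0 < a"
proof -
  show "a \<in> {1..<n}" unfolding n_def by (rule Un_index_block[OF a])
  then show "a < n" "a - 1 < n" "0 < a" by auto
qed

private lemma finite_L: "finite L"
  unfolding L_def by (rule finite_level_set[OF t])

private lemma off_L: "l \<notin> L \<Longrightarrow> site n l (a - 1) \<in> B \<longleftrightarrow> site n l a \<in> B"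
  unfolding n_def L_def by (rule site_off_level[OF t B a])

private lemma beta: "B \<in> beta_sets" using B by (simp add: beta_sets_of_type_def)

private lemma movable_level: "movable n \<epsilon> a l B \<Longrightarrow> l \<in> L"
  using off_L[of l] by (auto simp: movable_def hop_from_def hop_to_def split: if_splits)

lemma N_gt_eq: "N_gt n B (site n l a) = hop_exp n L 1 a l B"
proof -
  have "N_gt n B (site n l a) =
      int (card {y. [y = int (a - 1)] (mod int n) \<and> (y \<in> B \<and> y > site n l a)})
      - int (card {y. [y = int a] (mod int n) \<and> (y \<in> B \<and> y > site n l a)})"
    unfolding N_gt_def site_minus_one[OF a_range(4)] cong_site_shift by (simp add: conj_ac)
  also have "\<dots> = int (card {m. m > l \<and> site n m (a - 1) \<in> B}) - int (card {m. m > l \<and> site n m a \<in> B})"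
    unfolding card_sites[OF a_range(3)] card_sites[OF a_range(2)] site_greater_iff[OF a_range(1)]
    by (simp add: conj_ac)
  also have "\<dots> = (\<Sum>m\<in>beyond L 1 l. of_bool (m \<in> {m. m > l \<and> site n m (a - 1) \<in> B})
      - of_bool (m \<in> {m. m > l \<and> site n m a \<in> B}))"
    by (rule card_diff_eq_sum)
      (use finite_sites[OF beta] a_range finite_L off_L in \<open>auto simp: beyond_def\<close>)
  also have "\<dots> = hop_exp n L 1 a l B"
    unfolding hop_exp_def by (simp, rule sum.cong) (auto simp: beyond_def wt_def)
  finally show ?thesis .
qed

text \<open>Exchanging \<open>x\<close> and \<open>x - 1\<close> does not matter for the elements below \<open>x - 1\<close>. Counting missing elements
  instead of present ones reverses the sign of the weights, in accordance with \<open>K\<^sup>-\<close>.\<close>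

lemma N_lt_eq: "N_lt n ((B - {site n l a}) \<union> {site n l a - 1}) (site n l a) = hop_exp n L (-1) a l B"
proof -
  have "N_lt n ((B - {site n l a}) \<union> {site n l a - 1}) (site n l a) =
      int (card {y. [y = int (a - 1)] (mod int n) \<and> (y \<notin> B \<and> y < site n l (a - 1))})
      - int (card {y. [y = int a] (mod int n) \<and> (y \<notin> B \<and> y < site n l (a - 1))})"
    unfolding N_lt_def site_minus_one[OF a_range(4)] cong_site_shift
    by (intro arg_cong2[where f = "(-)"] arg_cong[where f = int] arg_cong[where f = card])
      (use site_greater_iff(4)[OF a_range(1), of l l] in auto)
  also have "\<dots> = int (card {m. m < l \<and> site n m (a - 1) \<notin> B}) - int (card {m. m < l \<and> site n m a \<notin> B})"
    unfolding card_sites[OF a_range(3)] card_sites[OF a_range(2)] site_greater_iff[OF a_range(1)]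
    by (simp add: conj_ac)
  also have "\<dots> = (\<Sum>m\<in>beyond L (-1) l. of_bool (m \<in> {m. m < l \<and> site n m (a - 1) \<notin> B})
      - of_bool (m \<in> {m. m < l \<and> site n m a \<notin> B}))"
    by (rule card_diff_eq_sum)
      (use finite_sites[OF beta] a_range finite_L off_L in \<open>auto simp: beyond_def\<close>)
  also have "\<dots> = hop_exp n L (-1) a l B"
    unfolding hop_exp_def by (simp add: sum_negf[symmetric], rule sum.cong) (auto simp: beyond_def wt_def)
  finally show ?thesis .
qed

lemma N_idx_eq: "N_idx n a B = tot_wt n L a B"
proof -
  let ?A = "{m. site n m a \<notin> B \<and> site n m (a - 1) \<in> B}" and ?C = "{m. site n m a \<in> B \<and> site n m (a - 1) \<notin> B}"
  have "N_idx n a B =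
      int (card {y. [y = int a] (mod int n) \<and> (y \<notin> B \<and> y - 1 \<in> B)})
      - int (card {y. [y = int a] (mod int n) \<and> (y \<in> B \<and> y - 1 \<notin> B)})"
    unfolding N_idx_def by (simp add: conj_ac)
  also have "\<dots> = int (card ?A) - int (card ?C)"
    unfolding card_sites[OF a_range(2)] site_minus_one[OF a_range(4)] by simp
  also have "\<dots> = (\<Sum>m\<in>L. of_bool (m \<in> ?A) - of_bool (m \<in> ?C))"
    by (rule card_diff_eq_sum)
      (use finite_L off_L in \<open>auto intro: finite_subset[of _ L]\<close>)
  also have "\<dots> = tot_wt n L a B"
    unfolding tot_wt_def by (rule sum.cong) (auto simp: wt_def)
  finally show ?thesis .
qed

private lemma sum_hop_basis:
  assumes "\<epsilon> \<in> {1, -1}"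
  shows "(\<Sum>l\<in>L. hop_basis n L \<epsilon> a l B) =
    (\<Sum>x\<in>(\<lambda>l. site n l a) ` {l. movable n \<epsilon> a l B}. hop_basis n L \<epsilon> a (x div int n) B)"
proof -
  have "(\<Sum>l\<in>L. hop_basis n L \<epsilon> a l B) = (\<Sum>l | movable n \<epsilon> a l B. hop_basis n L \<epsilon> a l B)"
    by (rule sum.mono_neutral_right) (use movable_level finite_L in \<open>auto simp: hop_basis_def\<close>)
  also have "\<dots> = (\<Sum>x\<in>(\<lambda>l. site n l a) ` {l. movable n \<epsilon> a l B}. hop_basis n L \<epsilon> a (x div int n) B)"
    by (subst sum.reindex) (use a_range in \<open>auto simp: inj_on_def site_eq_iff site_div\<close>)
  finally show ?thesis .
qed

lemma fock_basis_act_ladder: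
  "fock_basis_act n Fgen a B = (\<Sum>l\<in>L. hop_basis n L 1 a l B)"
  "fock_basis_act n Egen a B = (\<Sum>l\<in>L. hop_basis n L (-1) a l B)"
proof -
  have "{x. [x = int a] (mod int n) \<and> x - 1 \<in> B \<and> x \<notin> B} = (\<lambda>l. site n l a) ` {l. movable n 1 a l B}"
    using cong_site by (auto simp: movable_def hop_from_def hop_to_def site_minus_one[OF a_range(4)] image_iff
        elim!: cong_site_cases[OF a_range(2)])
  then show "fock_basis_act n Fgen a B = (\<Sum>l\<in>L. hop_basis n L 1 a l B)"
    by (simp add: sum_hop_basis, intro sum.cong refl)
      (use a_range N_gt_eq in \<open>auto simp: site_div hop_basis_def moved_def hop_from_def hop_to_def site_minus_one\<close>)
  have "{x. [x = int a] (mod int n) \<and> x \<in> B \<and> x - 1 \<notin> B} = (\<lambda>l. site n l a) ` {l. movable n (-1) a l B}"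
    using cong_site by (auto simp: movable_def hop_from_def hop_to_def site_minus_one[OF a_range(4)] image_iff
        elim!: cong_site_cases[OF a_range(2)])
  then show "fock_basis_act n Egen a B = (\<Sum>l\<in>L. hop_basis n L (-1) a l B)"
    by (simp add: sum_hop_basis, intro sum.cong refl)
      (use a_range N_lt_eq in \<open>auto simp: site_div hop_basis_def moved_def hop_from_def hop_to_def site_minus_one\<close>)
qed

end


section \<open>Iterated coproducts and exterior powers\<close>

fun level_op_basis :: "nat \<Rightarrow> int set \<Rightarrow> generator \<Rightarrow> nat \<Rightarrow> int set \<Rightarrow> (int set \<Rightarrow>\<^sub>0 Cq)" where
  "level_op_basis n L Fgen a B = (\<Sum>l\<in>L. hop_basis n L 1 a l B)"
| "level_op_basis n L Egen a B = (\<Sum>l\<in>L. hop_basis n L (-1) a l B)"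
| "level_op_basis n L Kgen a B = single B (qq powi tot_wt n L a B)"
| "level_op_basis n L Kinv a B = single B (qq powi - tot_wt n L a B)"

definition move_gen :: "int \<Rightarrow> generator" where
  "move_gen \<epsilon> = (if \<epsilon> = 1 then Fgen else Egen)"

definition cartan_gen :: "int \<Rightarrow> generator" where
  "cartan_gen \<epsilon> = (if \<epsilon> = 1 then Kgen else Kinv)"

text \<open>The term of the iterated coproduct of \<open>f\<close> or \<open>e\<close> in which the generator itself acts on level \<open>l\<close>.\<close>

definition one_move :: "int set \<Rightarrow> int \<Rightarrow> int \<Rightarrow> int \<Rightarrow> generator option" where
  "one_move L \<epsilon> l m = (if m = l then Some (move_gen \<epsilon>)
     else if m \<in> beyond L \<epsilon> l then Some (cartan_gen \<epsilon>) else None)"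

lemma iterated_coproduct_None: "iterated_coproduct ls None = [\<lambda>_. None]"
  by (induction ls) (auto simp: fun_eq_iff)

lemma iterated_coproduct_cartan:
  assumes "g \<in> {Kgen, Kinv}"
  shows "iterated_coproduct ls (Some g) = [\<lambda>l. if l \<in> set ls then Some g else None]"
  using assms by (induction ls) (auto simp: fun_eq_iff)

text \<open>The coproduct of \<open>e\<close> either lets \<open>e\<close> act on the first level, or puts \<open>K\<^sup>-\<close> there and passes \<open>e\<close> on to the
  higher levels.\<close>

lemma sum_iterated_coproduct_Egen:
  assumes "sorted_wrt (<) ls"
  shows "(\<Sum>\<gamma>\<leftarrow>iterated_coproduct ls (Some Egen). \<Phi> \<gamma>) = (\<Sum>l\<in>set ls. \<Phi> (one_move (set ls) (-1) l))"
  using assms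
proof (induction ls arbitrary: \<Phi>)
  case (Cons l ls)
  have l: "l \<notin> set ls" using Cons.prems by auto
  have 1: "(\<lambda>_. None)(l := Some Egen) = one_move (set (l # ls)) (-1) l"
    using Cons.prems by (auto simp: one_move_def move_gen_def beyond_def fun_eq_iff)
  have 2: "(one_move (set ls) (-1) m)(l := Some Kinv) = one_move (set (l # ls)) (-1) m" if "m \<in> set ls" for m
    using Cons.prems that by (auto simp: one_move_def cartan_gen_def beyond_def fun_eq_iff)
  have "(\<Sum>\<gamma>\<leftarrow>iterated_coproduct (l # ls) (Some Egen). \<Phi> \<gamma>) =
      \<Phi> (one_move (set (l # ls)) (-1) l) + (\<Sum>\<gamma>\<leftarrow>iterated_coproduct ls (Some Egen). \<Phi> (\<gamma>(l := Some Kinv)))"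
    by (simp add: iterated_coproduct_None 1 o_def)
  also have "\<dots> = (\<Sum>m\<in>set (l # ls). \<Phi> (one_move (set (l # ls)) (-1) m))"
    using Cons.prems l by (simp add: Cons.IH 2 del: set_simps) (simp add: 2)
  finally show ?case .
qed simp

text \<open>Here the coproduct either lets \<open>f\<close> act on the first level and puts \<open>K\<^sup>+\<close> on all others, or leaves
  the first level alone.\<close>

lemma sum_iterated_coproduct_Fgen:
  assumes "sorted_wrt (<) ls"
  shows "(\<Sum>\<gamma>\<leftarrow>iterated_coproduct ls (Some Fgen). \<Phi> \<gamma>) = (\<Sum>l\<in>set ls. \<Phi> (one_move (set ls) 1 l))"
  using assms
proof (induction ls arbitrary: \<Phi>)
  case (Cons l ls)
  have l: "l \<notin> set ls" using Cons.prems by auto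
  have 1: "(\<lambda>m. if m \<in> set ls then Some Kgen else None)(l := Some Fgen) = one_move (set (l # ls)) 1 l"
    using Cons.prems by (auto simp: one_move_def move_gen_def cartan_gen_def beyond_def fun_eq_iff)
  have 2: "(one_move (set ls) 1 m)(l := None) = one_move (set (l # ls)) 1 m" if "m \<in> set ls" for m
    using Cons.prems that by (auto simp: one_move_def cartan_gen_def beyond_def fun_eq_iff)
  have "(\<Sum>\<gamma>\<leftarrow>iterated_coproduct (l # ls) (Some Fgen). \<Phi> \<gamma>) =
      \<Phi> (one_move (set (l # ls)) 1 l) + (\<Sum>\<gamma>\<leftarrow>iterated_coproduct ls (Some Fgen). \<Phi> (\<gamma>(l := None)))"
    by (simp add: iterated_coproduct_cartan 1 o_def)
  also have "\<dots> = (\<Sum>m\<in>set (l # ls). \<Phi> (one_move (set (l # ls)) 1 m))"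
    using Cons.prems l by (simp add: Cons.IH 2 del: set_simps) (simp add: 2)
  finally show ?case .
qed simp

lemma iterated_coproduct_off: "\<gamma> \<in> set (iterated_coproduct ls g) \<Longrightarrow> l \<notin> set ls \<Longrightarrow> \<gamma> l = None"
  by (induction ls arbitrary: g \<gamma>) (auto split: if_splits)

lemma card_swap:
  assumes "finite X" "s \<in> X" "d \<notin> X"
  shows "card ((X - {s}) \<union> {d}) = card X"
proof -
  have "card ((X - {s}) \<union> {d}) = Suc (card (X - {s}))" using assms by simp
  also have "\<dots> = card X" using assms by (intro card_Suc_Diff1)
  finally show ?thesis .
qed

definition local_wt :: "nat \<Rightarrow> nat set \<Rightarrow> int" where
  "local_wt y X = of_bool (y - 1 \<in> X) - of_bool (y \<in> X)"

lemma wedge_basis_act_cartan: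
  assumes "\<epsilon> \<in> {1, -1}"
  shows "wedge_basis_act (cartan_gen \<epsilon>) y X = single X (qq powi (\<epsilon> * local_wt y X))"
  using assms by (auto simp: cartan_gen_def local_wt_def power_int_minus)

lemma wedge_basis_act_move_gen:
  assumes "\<epsilon> \<in> {1, -1}" "0 < y"
  shows "wedge_basis_act (move_gen \<epsilon>) y X =
    (if hop_from \<epsilon> y \<in> X \<and> hop_to \<epsilon> y \<notin> X then single ((X - {hop_from \<epsilon> y}) \<union> {hop_to \<epsilon> y}) 1 else 0)"
  using assms by (auto simp: move_gen_def hop_from_def hop_to_def intro!: arg_cong[of _ _ wedge_vec])

lemma keys_wedge_basis_act:
  assumes "X \<in> dsubsets m d" "0 < y" "y < m"
  shows "keys (wedge_basis_act g y X) \<subseteq> dsubsets m d"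
proof -
  have swap: "(X - {hop_from \<epsilon> y}) \<union> {hop_to \<epsilon> y} \<in> dsubsets m d" if "hop_from \<epsilon> y \<in> X" "hop_to \<epsilon> y \<notin> X" for \<epsilon>
  proof -
    have "finite X" using assms(1) by (auto simp: dsubsets_def intro: finite_subset)
    then have "card ((X - {hop_from \<epsilon> y}) \<union> {hop_to \<epsilon> y}) = d"
      using card_swap[OF _ that] assms(1) by (simp add: dsubsets_def)
    then show ?thesis using assms by (auto simp: dsubsets_def hop_to_def)
  qed
  have *: "keys (wedge_basis_act (move_gen \<epsilon>) y X) \<subseteq> dsubsets m d" if "\<epsilon> \<in> {1, -1}" for \<epsilon>
    using swap by (simp add: wedge_basis_act_move_gen[OF that assms(2)])
  have **: "keys (wedge_basis_act (cartan_gen \<epsilon>) y X) \<subseteq> dsubsets m d" if "\<epsilon> \<in> {1, -1}" for \<epsilon>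
    using assms(1) unfolding wedge_basis_act_cartan[OF that] by (rule keys_single_subset)
  show ?thesis
    using *[of 1] *[of "-1"] **[of 1] **[of "-1"]
    by (cases g) (simp_all add: move_gen_def cartan_gen_def del: wedge_basis_act.simps)
qed

section \<open>Sections of moved beta-sets\<close>

text \<open>A hop of an index \<open>a\<close> from the interior of block \<open>j\<close> is the hop of index \<open>y\<close> in the section
  \<open>(l, j)\<close> and leaves all other sections unchanged.\<close>

context
  fixes ns :: "nat list" and j a y n :: nat
  assumes j: "j \<in> {1..length ns}" and a: "psum ns (j - 1) < a" "a < psum ns j"
  defines "y \<equiv> a - psum ns (j - 1)" and "n \<equiv> sum_list ns"
begin

lemma y_range: "0 < y" "y < part ns j" "y - 1 < part ns j"
  using site_pos[OF a j] by (simp_all add: y_def)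

lemma site_src: "site n l (hop_from \<epsilon> a) = pos ns (l, j) (hop_from \<epsilon> y)"
  and site_dst: "site n l (hop_to \<epsilon> a) = pos ns (l, j) (hop_to \<epsilon> y)"
  using site_pos[OF a j] by (simp_all add: hop_from_def hop_to_def y_def n_def)

lemma level_in_idx: "(l, j) \<in> idx ns" using j by (simp add: idx_def)

lemma src_dst_range: "hop_from \<epsilon> y < part ns (snd (l, j))" "hop_to \<epsilon> y < part ns (snd (l, j))"
  using y_range by (auto simp: hop_from_def hop_to_def)

lemma movable_sections:
  "movable n \<epsilon> a l B \<longleftrightarrow> hop_from \<epsilon> y \<in> sections ns B (l, j) \<and> hop_to \<epsilon> y \<notin> sections ns B (l, j)"
  unfolding movable_def site_src site_dst
  using mem_sections[OF level_in_idx src_dst_range(1)] mem_sections[OF level_in_idx src_dst_range(2)] by blast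

lemma wt_sections: "wt n a l B = local_wt y (sections ns B (l, j))"
  using mem_sections[OF level_in_idx src_dst_range(1)[of 1], of B] mem_sections[OF level_in_idx src_dst_range(2)[of 1], of B]
    site_src[of l 1] site_dst[of l 1]
  by (simp add: wt_def local_wt_def hop_from_def hop_to_def)

lemma sections_moved:
  "sections ns (moved n \<epsilon> a l B) = (sections ns B)
    ((l, j) := (sections ns B (l, j) - {hop_from \<epsilon> y}) \<union> {hop_to \<epsilon> y})"
proof (rule extensionalityI[where A = "idx ns"])
  show "sections ns (moved n \<epsilon> a l B) \<in> extensional (idx ns)" by (simp add: sections_def)
  show "(sections ns B)((l, j) := (sections ns B (l, j) - {hop_from \<epsilon> y}) \<union> {hop_to \<epsilon> y}) \<in> extensional (idx ns)"
    using level_in_idx by (auto simp: sections_def extensional_def)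
  fix k assume k: "k \<in> idx ns"
  have "pos ns k z \<in> moved n \<epsilon> a l B \<longleftrightarrow>
      (pos ns k z \<in> B \<and> \<not> (k = (l, j) \<and> z = hop_from \<epsilon> y)) \<or> (k = (l, j) \<and> z = hop_to \<epsilon> y)"
    if "z < part ns (snd k)" for z
    unfolding moved_def site_src site_dst
    using pos_eq_iff[OF k that level_in_idx src_dst_range(1)] pos_eq_iff[OF k that level_in_idx src_dst_range(2)]
    by auto
  then show "sections ns (moved n \<epsilon> a l B) k =
      ((sections ns B)((l, j) := (sections ns B (l, j) - {hop_from \<epsilon> y}) \<union> {hop_to \<epsilon> y})) k"
    using k src_dst_range(2) by (auto simp: sections_apply)
qed

lemma moved_in:
  assumes t: "t \<in> types ns" and B: "B \<in> beta_sets_of_type ns t" and mov: "movable n \<epsilon> a l B"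
  shows "moved n \<epsilon> a l B \<in> beta_sets_of_type ns t"
proof (rule type_if_sections[OF _ t])
  show "sum_list ns > 0" using a psum_le[of ns j] by linarith
  have X: "sections ns B \<in> subset_families ns t" by (rule sections_in[OF B])
  then have "finite (sections ns B (l, j))"
    using level_in_idx by (auto simp: subset_families_iff intro: finite_subset)
  then have "card ((sections ns B (l, j) - {hop_from \<epsilon> y}) \<union> {hop_to \<epsilon> y}) = t (l, j)"
    using mov X level_in_idx by (subst card_swap) (auto simp: movable_sections subset_families_iff)
  moreover have "sections ns B (l, j) \<subseteq> {..<part ns j}"
    using X level_in_idx[of l] unfolding subset_families_iff by (metis snd_conv)
  ultimately show "sections ns (moved n \<epsilon> a l B) \<in> subset_families ns t"
    using X src_dst_range(2)[of \<epsilon> l] level_in_idx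
    unfolding sections_moved subset_families_iff
    by (simp add: extensional_def) (auto simp: subset_iff)
qed

end


section \<open>Theta as a relabelling of bases\<close>

locale wedge_product =
  fixes ns :: "nat list" and t :: "int \<times> nat \<Rightarrow> nat"
  assumes n_pos: "sum_list ns > 0" and t_types: "t \<in> types ns"
begin

sublocale free_tensor "idx ns" "\<lambda>k. dsubsets (part ns (snd k)) (t k)" "\<lambda>k. {..<t k}"
proof
  fix k assume "k \<in> idx ns"
  then have "t k \<le> part ns (snd k)" using t_types by (simp add: types_iff)
  then show "{..<t k} \<in> dsubsets (part ns (snd k)) (t k)" by (auto simp: dsubsets_def)
qed

abbreviation n :: nat where "n \<equiv> sum_list ns"
abbreviation L :: "int set" where "L \<equiv> level_set ns t"
abbreviation Bt :: "int set set" where "Bt \<equiv> beta_sets_of_type ns t"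

lemma finite_L: "finite L" by (rule finite_level_set[OF t_types])

lemma wedge_factors_eq: "wedge_factors ns t = W"
  by (auto simp: wedge_factors_def fun_eq_iff)

lemma wedge_units_eq: "wedge_units t = u"
  by (auto simp: wedge_units_def fun_eq_iff)

text \<open>Where \<open>t k\<close> is \<open>0\<close> or maximal there is only one subset to choose. This is the case at almost all
  places, so every family of subsets differs from the reference family at finitely many places.\<close>

lemma choices_eq: "choices = subset_families ns t"
proof -
  have "finite {k \<in> idx ns. X k \<noteq> {..<t k}}" if X: "X \<in> subset_families ns t" for X
  proof (rule finite_subset)
    show "{k \<in> idx ns. X k \<noteq> {..<t k}} \<subseteq> {k \<in> idx ns. 0 \<le> fst k \<and> t k \<noteq> 0}
        \<union> {k \<in> idx ns. fst k < 0 \<and> t k \<noteq> part ns (snd k)}"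
    proof
      fix k assume k: "k \<in> {k \<in> idx ns. X k \<noteq> {..<t k}}"
      then have Xk: "X k \<subseteq> {..<part ns (snd k)}" "card (X k) = t k"
        using X by (simp_all add: subset_families_iff)
      then have "finite (X k)" by (auto intro: finite_subset)
      then have "t k \<noteq> 0" "t k \<noteq> part ns (snd k)"
        using k Xk card_subset_eq[OF finite_lessThan Xk(1)] by auto
      then show "k \<in> {k \<in> idx ns. 0 \<le> fst k \<and> t k \<noteq> 0}
        \<union> {k \<in> idx ns. fst k < 0 \<and> t k \<noteq> part ns (snd k)}" using k by auto
    qed
    show "finite ({k \<in> idx ns. 0 \<le> fst k \<and> t k \<noteq> 0} \<union> {k \<in> idx ns. fst k < 0 \<and> t k \<noteq> part ns (snd k)})"
      using t_types by (simp add: types_iff)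
  qed
  moreover have "(\<Pi>\<^sub>E k\<in>idx ns. dsubsets (part ns (snd k)) (t k)) = subset_families ns t"
    unfolding subset_families_def by (rule PiE_cong) auto
  ultimately show ?thesis unfolding choices_def by auto
qed

lemma Wedge_eq: "Wedge ns t = tensor_space (idx ns) W u"
  by (simp add: Wedge_def wedge_factors_eq wedge_units_eq)

lemma Wedge_basis_vec_eq:
  "X \<in> subset_families ns t \<Longrightarrow> Wedge_basis_vec ns t X = fiber fams ev (single X 1)"
  using pure_tensor_basis_family[of X]
  by (simp add: Wedge_basis_vec_def wedge_factors_eq wedge_units_eq choices_eq basis_family_def)

lemma lin_bij_Wedge: "lin_bij (free_space (subset_families ns t)) (Wedge ns t) (fiber fams ev)"
  using lin_bij_tensor by (simp add: Wedge_eq choices_eq)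

definition relabel :: "(int set \<Rightarrow>\<^sub>0 Cq) \<Rightarrow> (int \<times> nat \<Rightarrow> nat set) \<Rightarrow>\<^sub>0 Cq" where
  "relabel = lin_ext (\<lambda>B. single (sections ns B) 1)"

lemma keys_relabel: "keys x \<subseteq> Bt \<Longrightarrow> keys (relabel x) \<subseteq> subset_families ns t"
  unfolding relabel_def by (rule keys_lin_ext) (auto intro: sections_in)

lemma Theta_eq:
  assumes x: "keys x \<subseteq> Bt"
  shows "Theta ns t x = fiber fams ev (relabel x)"
proof -
  interpret Wd: vectorspace CqF "Wedge ns t"
    by (rule vectorspace_transport[OF vectorspace_free_space lin_bij_Wedge])
  note h = lin_bijD[OF lin_bij_Wedge]
  have sec: "single (sections ns B) c \<in> carrier (free_space (subset_families ns t))" if "B \<in> keys x" for B and c :: Cq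
    using sections_in[of B ns t] x that by auto
  have "Theta ns t x = (\<Oplus>\<^bsub>Wedge ns t\<^esub>B\<in>keys x. fiber fams ev (single (sections ns B) (lookup x B)))"
    unfolding Theta_def
  proof (rule Wd.finsum_cong')
    show "(\<lambda>B. fiber fams ev (single (sections ns B) (lookup x B))) \<in> keys x \<rightarrow> carrier (Wedge ns t)"
      unfolding h(1) using sec by blast
    fix B assume "B \<in> keys x"
    then show "lookup x B \<odot>\<^bsub>Wedge ns t\<^esub> Wedge_basis_vec ns t (sections ns B) =
        fiber fams ev (single (sections ns B) (lookup x B))"
      using h(5)[OF sec[of B 1], of "lookup x B"] sections_in[of B ns t] x
      by (simp add: Wedge_basis_vec_eq subset_iff)
  qed simp
  also have "\<dots> = fiber fams ev (\<Oplus>\<^bsub>free_space (subset_families ns t)\<^esub>B\<in>keys x. single (sections ns B) (lookup x B))"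
    by (rule finsum_transport[OF vectorspace_free_space lin_bij_Wedge]) (use sec in blast)
  also have "(\<Oplus>\<^bsub>free_space (subset_families ns t)\<^esub>B\<in>keys x. single (sections ns B) (lookup x B)) = relabel x"
    by (subst finsum_free_space) (use sec in \<open>auto simp: relabel_def lin_ext_def\<close>)
  finally show ?thesis .
qed

lemma bij_betw_relabel: "bij_betw relabel (carrier (fock_space ns t)) (carrier (free_space (subset_families ns t)))"
proof -
  note bij = bij_betw_sections[OF n_pos t_types]
  define g where "g = lin_ext (\<lambda>X. single (inv_into Bt (sections ns) X) (1 :: Cq))"
  have inv: "inv_into Bt (sections ns) (sections ns B) = B" if "B \<in> Bt" for B
    using bij that by (simp add: bij_betw_inv_into_left)
  have inv': "sections ns (inv_into Bt (sections ns) X) = X" "inv_into Bt (sections ns) X \<in> Bt"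
    if "X \<in> subset_families ns t" for X
    using bij that by (simp_all add: bij_betw_inv_into_right bij_betw_def inv_into_into)
  show ?thesis
  proof (rule bij_betw_byWitness[where f' = g])
    show "\<forall>x\<in>carrier (fock_space ns t). g (relabel x) = x"
    proof
      fix x assume "x \<in> carrier (fock_space ns t)"
      then have "g (relabel x) = lin_ext (\<lambda>B. single B 1) x"
        unfolding g_def relabel_def lin_ext_lin_ext by (intro lin_ext_cong) (auto simp: inv subset_iff)
      then show "g (relabel x) = x" by simp
    qed
    show "\<forall>x\<in>carrier (free_space (subset_families ns t)). relabel (g x) = x"
    proof
      fix x assume "x \<in> carrier (free_space (subset_families ns t))"
      then have "relabel (g x) = lin_ext (\<lambda>B. single B 1) x"
        unfolding g_def relabel_def lin_ext_lin_ext by (intro lin_ext_cong) (auto simp: inv' subset_iff)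
      then show "relabel (g x) = x" by simp
    qed
    show "relabel ` carrier (fock_space ns t) \<subseteq> carrier (free_space (subset_families ns t))"
      using keys_relabel by auto
    show "g ` carrier (free_space (subset_families ns t)) \<subseteq> carrier (fock_space ns t)"
    proof
      fix z assume "z \<in> g ` carrier (free_space (subset_families ns t))"
      then obtain x where x: "keys x \<subseteq> subset_families ns t" "z = g x" by auto
      have "keys z \<subseteq> Bt" unfolding x(2) g_def
        by (rule keys_lin_ext, rule keys_single_subset, rule inv'(2)) (use x(1) in blast)
      then show "z \<in> carrier (fock_space ns t)" by simp
    qed
  qed
qed

lemma lin_bij_Theta: "lin_bij (fock_space ns t) (Wedge ns t) (Theta ns t)"
proof -
  note h = lin_bij_Wedge[unfolded lin_bij_def]
  have "bij_betw (\<lambda>x. fiber fams ev (relabel x)) (carrier (fock_space ns t)) (carrier (Wedge ns t))"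
    using bij_betw_trans[OF bij_betw_relabel] h by (auto simp: o_def)
  then have "bij_betw (Theta ns t) (carrier (fock_space ns t)) (carrier (Wedge ns t))"
    by (subst bij_betw_cong[where g = "\<lambda>x. fiber fams ev (relabel x)"]) (simp_all add: Theta_eq)
  moreover have "relabel (x + y) = relabel x + relabel y" "relabel (scale c x) = scale c (relabel x)" for x y c
    by (simp_all add: relabel_def lin_ext_add lin_ext_scale)
  moreover have "relabel 0 = 0" by (simp add: relabel_def)
  ultimately show ?thesis
    using h keys_relabel
    unfolding lin_bij_def free_space_sel mem_Collect_eq by (simp add: Theta_eq keys_subset)
qed

section \<open>Theta intertwines the two actions\<close>

context
  fixes a j :: nat
  assumes j: "j \<in> {1..length ns}" and a: "psum ns (j - 1) < a" "a < psum ns j"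
begin

definition ops :: "(int \<Rightarrow> generator option) \<Rightarrow> int \<times> nat \<Rightarrow> (nat set \<Rightarrow>\<^sub>0 Cq) \<Rightarrow> (nat set \<Rightarrow>\<^sub>0 Cq)" where
  "ops \<gamma> = (\<lambda>k. if snd k = j then (case \<gamma> (fst k) of None \<Rightarrow> id
     | Some g \<Rightarrow> wedge_act g (a - psum ns (j - 1))) else id)"

lemma block_iff: "psum ns (j' - 1) < a \<and> a < psum ns j' \<longleftrightarrow> j' = j"
  using block_unique[of ns j a j'] a by auto

lemma family_act_eq: "family_act ns a \<gamma> w = apply_ops (ops \<gamma>) w"
  unfolding family_act_def block_iff
  by (auto simp: apply_ops_def ops_def fun_eq_iff split: option.splits)

lemma local_ops_ops:
  assumes "\<And>l. l \<notin> L \<Longrightarrow> \<gamma> l = None"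
  shows "local_ops (ops \<gamma>)"
  unfolding local_ops_def
proof (intro conjI ballI)
  have "{k \<in> idx ns. ops \<gamma> k \<noteq> id} \<subseteq> L \<times> {1..length ns}"
    using assms by (force simp: ops_def idx_def split: if_splits)
  then show "finite {k \<in> idx ns. ops \<gamma> k \<noteq> id}" using finite_L by (auto intro: finite_subset)
  fix k
  show "\<forall>x y. ops \<gamma> k (x + y) = ops \<gamma> k x + ops \<gamma> k y" "\<forall>c x. ops \<gamma> k (scale c x) = scale c (ops \<gamma> k x)"
    by (auto simp: ops_def wedge_act_def lin_ext_add lin_ext_scale split: option.splits)
  have "keys (wedge_act g (a - psum ns (j - 1)) x) \<subseteq> dsubsets (part ns j) (t k)"
    if "keys x \<subseteq> dsubsets (part ns j) (t k)" for g x
    unfolding wedge_act_def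
    by (rule keys_lin_ext, rule keys_wedge_basis_act) (use that y_range[OF j a] in auto)
  then show "\<forall>x. keys x \<subseteq> dsubsets (part ns (snd k)) (t k) \<longrightarrow> keys (ops \<gamma> k x) \<subseteq> dsubsets (part ns (snd k)) (t k)"
    by (auto simp: ops_def split: option.splits)
qed


text \<open>A block contains no partial sum \<open>\<sigma>\<^sub>i\<close> strictly between its ends.\<close>

lemma Un_index: "a \<in> Un_indices ns"
proof -
  have "a \<notin> psum ns ` {0..<length ns}"
  proof
    assume "a \<in> psum ns ` {0..<length ns}"
    then obtain i where i: "a = psum ns i" by blast
    have "i = j - 1 \<or> Suc i \<le> j - 1 \<or> j \<le> i" by linarith
    then show False
      using a i psum_mono[of i "j - 1" ns] psum_mono[of j i ns] by auto
  qed
  then show ?thesis using a psum_le[of ns j] by (simp add: Un_indices_def)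
qed

lemma ev_apply_ops:
  assumes Y: "Y \<in> choices" and D: "finite D" "D \<subseteq> idx ns" "\<And>k. k \<in> idx ns - D \<Longrightarrow> c k = 1"
    and ops: "\<And>k. k \<in> idx ns \<Longrightarrow> ops \<gamma> k (single (X k) 1) = single (Y k) (c k)"
  shows "ev (apply_ops (ops \<gamma>) (basis_family X)) = single Y (\<Prod>k\<in>D. c k)"
proof -
  have "apply_ops (ops \<gamma>) (basis_family X) = (\<lambda>k\<in>idx ns. single (Y k) (c k))"
    using ops by (auto simp: apply_ops_def basis_family_def fun_eq_iff)
  then show ?thesis using ev_scaled_basis[OF Y D] by simp
qed

lemma prod_power_int:
  assumes "finite M" "(q :: Cq) \<noteq> 0"
  shows "(\<Prod>m\<in>M. q powi f m) = q powi (\<Sum>m\<in>M. f m)"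
  using assms(1) by (induction M) (simp_all add: power_int_add assms(2))

lemma ops_single:
  "ops \<gamma> (l, j') (single X 1) = (if j' = j then (case \<gamma> l of None \<Rightarrow> single X 1
     | Some g \<Rightarrow> wedge_basis_act g (a - psum ns (j - 1)) X) else single X 1)"
  by (simp add: ops_def wedge_act_def split: option.splits)

text \<open>On the levels beyond \<open>l\<close> the generator \<open>K\<^sup>\<plusminus>\<close> multiplies by a power of \<open>q\<close>; the exponents add up to
  \<open>hop_exp\<close>. If the hop is impossible, the entry at level \<open>l\<close> becomes \<open>0\<close>, which is recorded as the
  scalar \<open>0\<close> in front of the unchanged basis vector.\<close>

lemma ev_one_move:
  assumes B: "B \<in> Bt" and l: "l \<in> L" and \<epsilon>: "\<epsilon> \<in> {1, -1}"
  shows "ev (apply_ops (ops (one_move L \<epsilon> l)) (basis_family (sections ns B))) = relabel (hop_basis n L \<epsilon> a l B)"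
proof -
  let ?y = "a - psum ns (j - 1)" and ?X = "sections ns B"
  let ?Y = "if movable n \<epsilon> a l B then sections ns (moved n \<epsilon> a l B) else ?X"
  let ?c = "\<lambda>k. if snd k = j then if fst k = l then of_bool (movable n \<epsilon> a l B)
      else if fst k \<in> beyond L \<epsilon> l then qq powi (\<epsilon> * wt n a (fst k) B) else 1 else (1 :: Cq)"
  let ?D = "(\<lambda>m. (m, j)) ` insert l (beyond L \<epsilon> l)"
  have l_notin: "l \<notin> beyond L \<epsilon> l" by (simp add: beyond_def)
  have "ev (apply_ops (ops (one_move L \<epsilon> l)) (basis_family ?X)) = single ?Y (\<Prod>k\<in>?D. ?c k)"
  proof (rule ev_apply_ops)
    show "?Y \<in> choices"
      using sections_in[OF B] sections_in[OF moved_in[OF j a t_types B]] by (simp add: choices_eq)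
    show "finite ?D" using finite_L by simp
    show "?D \<subseteq> idx ns" using j by (auto simp: idx_def)
    show "?c k = 1" if "k \<in> idx ns - ?D" for k using that by (cases k) auto
    fix k assume "k \<in> idx ns"
    then show "ops (one_move L \<epsilon> l) k (single (?X k) 1) = single (?Y k) (?c k)"
      using y_range(1)[OF j a]
      by (cases k) (auto simp: ops_single one_move_def wedge_basis_act_move_gen[OF \<epsilon>] wedge_basis_act_cartan[OF \<epsilon>]
          wt_sections[OF j a] movable_sections[OF j a] sections_moved[OF j a] simp del: wedge_basis_act.simps)
  qed
  also have "(\<Prod>k\<in>?D. ?c k) = of_bool (movable n \<epsilon> a l B) * (\<Prod>m\<in>beyond L \<epsilon> l. qq powi (\<epsilon> * wt n a m B))"
    using finite_L l_notin by (subst prod.reindex) (auto simp: inj_on_def intro!: prod.cong)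
  also have "\<dots> = of_bool (movable n \<epsilon> a l B) * qq powi hop_exp n L \<epsilon> a l B"
    using finite_L by (simp add: prod_power_int hop_exp_def sum_distrib_left)
  also have "single ?Y \<dots> = relabel (hop_basis n L \<epsilon> a l B)"
    by (simp add: relabel_def hop_basis_def)
  finally show ?thesis .
qed

lemma ev_cartan:
  assumes B: "B \<in> Bt" and \<kappa>: "\<kappa> \<in> {1, -1}"
  shows "ev (apply_ops (ops (\<lambda>l. if l \<in> L then Some (cartan_gen \<kappa>) else None)) (basis_family (sections ns B))) =
    single (sections ns B) (qq powi (\<kappa> * tot_wt n L a B))"
proof -
  let ?X = "sections ns B"
  let ?c = "\<lambda>k. if snd k = j \<and> fst k \<in> L then qq powi (\<kappa> * wt n a (fst k) B) else 1"
  let ?D = "(\<lambda>m. (m, j)) ` L"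
  have "ev (apply_ops (ops (\<lambda>l. if l \<in> L then Some (cartan_gen \<kappa>) else None)) (basis_family ?X)) =
      single ?X (\<Prod>k\<in>?D. ?c k)"
  proof (rule ev_apply_ops)
    show "?X \<in> choices" using sections_in[OF B] by (simp add: choices_eq)
    show "finite ?D" using finite_L by simp
    show "?D \<subseteq> idx ns" using j by (auto simp: idx_def)
    show "?c k = 1" if "k \<in> idx ns - ?D" for k using that by (cases k) auto
    fix k assume "k \<in> idx ns"
    then show "ops (\<lambda>l. if l \<in> L then Some (cartan_gen \<kappa>) else None) k (single (?X k) 1) = single (?X k) (?c k)"
      by (cases k) (auto simp: ops_single wedge_basis_act_cartan[OF \<kappa>] wt_sections[OF j a]
          simp del: wedge_basis_act.simps)
  qed
  also have "(\<Prod>k\<in>?D. ?c k) = (\<Prod>m\<in>L. qq powi (\<kappa> * wt n a m B))"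
    by (subst prod.reindex) (auto simp: inj_on_def intro!: prod.cong)
  also have "\<dots> = qq powi (\<kappa> * tot_wt n L a B)"
    using finite_L by (simp add: prod_power_int tot_wt_def sum_distrib_left)
  finally show ?thesis .
qed

lemma sum_ev_coproduct:
  assumes B: "B \<in> Bt"
  shows "(\<Sum>\<gamma>\<leftarrow>iterated_coproduct (levels ns t) (Some g).
      ev (apply_ops (ops \<gamma>) (basis_family (sections ns B)))) = relabel (level_op_basis n L g a B)"
proof -
  have sorted: "sorted_wrt (<) (levels ns t)" by (simp add: levels_def)
  note L = set_levels[OF t_types]
  have gen: "cartan_gen 1 = Kgen" "cartan_gen (-1) = Kinv" by (simp_all add: cartan_gen_def)
  show ?thesis
    using ev_one_move[OF B, of _ 1] ev_one_move[OF B, of _ "-1"]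
      ev_cartan[OF B, of 1, unfolded gen] ev_cartan[OF B, of "-1", unfolded gen]
    by (cases g) (simp_all add: sum_iterated_coproduct_Egen[OF sorted] sum_iterated_coproduct_Fgen[OF sorted]
        iterated_coproduct_cartan L relabel_def lin_ext_sum)
qed

lemma keys_level_op_basis:
  assumes B: "B \<in> Bt"
  shows "keys (level_op_basis n L g a B) \<subseteq> Bt"
proof -
  have "keys (\<Sum>l\<in>L. hop_basis n L \<epsilon> a l B) \<subseteq> Bt" for \<epsilon>
    by (intro subset_trans[OF keys_sum] UN_least)
      (use moved_in[OF j a t_types B] in \<open>auto simp: hop_basis_def split: if_splits\<close>)
  then show ?thesis using B by (cases g) simp_all
qed

lemma fock_basis_act_op:
  assumes B: "B \<in> Bt"
  shows "fock_basis_act n g a B = level_op_basis n L g a B"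
  using fock_basis_act_ladder[OF t_types Un_index B] N_idx_eq[OF t_types Un_index B]
  by (cases g) (simp_all del: fock_basis_act.simps(1,2))

lemma fock_act_op:
  assumes "keys x \<subseteq> Bt"
  shows "fock_act n g a x = lin_ext (level_op_basis n L g a) x" "keys (fock_act n g a x) \<subseteq> Bt"
proof -
  show *: "fock_act n g a x = lin_ext (level_op_basis n L g a) x"
    unfolding fock_act_def by (rule lin_ext_cong) (use assms fock_basis_act_op in blast)
  show "keys (fock_act n g a x) \<subseteq> Bt"
    unfolding * by (rule keys_lin_ext, rule keys_level_op_basis) (use assms in blast)
qed

text \<open>By \<open>coset_action_ops\<close> the action on the tensor product is determined by its effect on basis
  families, where \<open>sum_ev_coproduct\<close> identifies it with the action on the Fock space.\<close>

lemma Theta_act: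
  assumes x: "keys x \<subseteq> Bt"
  shows "Theta ns t (fock_act n g a x) = Wedge_act ns t g a (Theta ns t x)"
proof -
  let ?As = "map ops (iterated_coproduct (levels ns t) (Some g))"
  have loc: "local_ops A" if "A \<in> set ?As" for A
    using that iterated_coproduct_off[of _ "levels ns t" "Some g"] set_levels[OF t_types]
    by (auto intro!: local_ops_ops)
  have "Wedge_act ns t g a (Theta ns t x) =
    (\<Union>z\<in>fiber fams ev (relabel x). a_r_coset (free_space fams) null
      (lin_ext (\<lambda>w. \<Sum>A\<leftarrow>?As. single (apply_ops A w) 1) z))"
    by (simp add: Wedge_act_def Theta_eq[OF x] wedge_factors_eq wedge_units_eq family_act_eq o_def)
  also have "\<dots> = fiber fams ev (lin_ext (\<lambda>X. \<Sum>A\<leftarrow>?As. ev (apply_ops A (basis_family X))) (relabel x))"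
    by (rule coset_action_ops[OF loc]) (use keys_relabel[OF x] in \<open>auto simp: choices_eq\<close>)
  also have "lin_ext (\<lambda>X. \<Sum>A\<leftarrow>?As. ev (apply_ops A (basis_family X))) (relabel x) =
      lin_ext (\<lambda>B. relabel (level_op_basis n L g a B)) x"
    unfolding fun_cong[OF relabel_def, of x] lin_ext_lin_ext lin_ext_single scale_simps
    by (rule lin_ext_cong) (use x sum_ev_coproduct in \<open>auto simp: o_def\<close>)
  also have "\<dots> = relabel (fock_act n g a x)"
    unfolding fock_act_op(1)[OF x] relabel_def lin_ext_lin_ext ..
  also have "fiber fams ev \<dots> = Theta ns t (fock_act n g a x)"
    by (rule Theta_eq[symmetric, OF fock_act_op(2)[OF x]])
  finally show ?thesis ..
qed

end

end


section \<open>Module structures\<close>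

definition level_op :: "nat \<Rightarrow> int set \<Rightarrow> generator \<Rightarrow> nat \<Rightarrow> (int set \<Rightarrow>\<^sub>0 Cq) \<Rightarrow> (int set \<Rightarrow>\<^sub>0 Cq)" where
  "level_op n L g a = lin_ext (level_op_basis n L g a)"

lemma level_op_eq:
  "level_op n L Fgen a x = ladder n L 1 a x" "level_op n L Egen a x = ladder n L (-1) a x"
  "level_op n L Kgen a x = torus n L 1 a x" "level_op n L Kinv a x = torus n L (-1) a x"
proof -
  have "level_op_basis n L Fgen a = (\<lambda>B. \<Sum>l\<in>L. hop_basis n L 1 a l B)"
    "level_op_basis n L Egen a = (\<lambda>B. \<Sum>l\<in>L. hop_basis n L (-1) a l B)"
    "level_op_basis n L Kgen a = (\<lambda>B. single B (qq powi tot_wt n L a B))"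
    "level_op_basis n L Kinv a = (\<lambda>B. single B (qq powi - tot_wt n L a B))"
    by (rule ext, simp)+
  then show "level_op n L Fgen a x = ladder n L 1 a x" "level_op n L Egen a x = ladder n L (-1) a x"
    "level_op n L Kgen a x = torus n L 1 a x" "level_op n L Kinv a x = torus n L (-1) a x"
    by (simp_all add: level_op_def ladder_def torus_def hop_def lin_ext_sum_fun)
qed

text \<open>The relations hold for all indices \<open>1 \<le> a, b < n\<close>, that is, they are the relations of the quantum
  group of \<open>sl\<^sub>n\<close>. Those of the subalgebra for each block and the commutation of different blocks are
  special cases.\<close>

lemma level_op_relations:
  assumes L: "finite L" and ab: "a \<in> {1..<n}" "b \<in> {1..<n}"
  shows
    "level_op n L Kgen a (level_op n L Kinv a x) = x" "level_op n L Kinv a (level_op n L Kgen a x) = x"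
    "level_op n L Kgen a (level_op n L Kgen b x) = level_op n L Kgen b (level_op n L Kgen a x)"
    "level_op n L Kgen a (level_op n L Egen b (level_op n L Kinv a x)) = scale (qq powi cartan a b) (level_op n L Egen b x)"
    "level_op n L Kgen a (level_op n L Fgen b (level_op n L Kinv a x)) = scale (qq powi - cartan a b) (level_op n L Fgen b x)"
    "level_op n L Egen a (level_op n L Fgen b x) - level_op n L Fgen b (level_op n L Egen a x) =
      (if a = b then scale (1 / (qq - inverse qq)) (level_op n L Kgen a x - level_op n L Kinv a x) else 0)"
    "g \<in> {Egen, Fgen} \<Longrightarrow> cartan a b = 0 \<Longrightarrow> level_op n L g a (level_op n L g b x) = level_op n L g b (level_op n L g a x)"
    "g \<in> {Egen, Fgen} \<Longrightarrow> cartan a b = -1 \<Longrightarrow>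
      level_op n L g a (level_op n L g a (level_op n L g b x))
        - scale (qq + inverse qq) (level_op n L g a (level_op n L g b (level_op n L g a x)))
        + level_op n L g b (level_op n L g a (level_op n L g a x)) = 0"
    "cartan a b = 0 \<Longrightarrow> level_op n L g a (level_op n L h b x) = level_op n L h b (level_op n L g a x)"
proof -
  note T = torus_ladder[OF L] and C = ladder_commute[OF L ab] and S = ladder_serre[OF L ab]
  show "level_op n L Kgen a (level_op n L Kinv a x) = x" "level_op n L Kinv a (level_op n L Kgen a x) = x"
    by (simp_all add: level_op_eq torus_inverse)
  show "level_op n L Kgen a (level_op n L Kgen b x) = level_op n L Kgen b (level_op n L Kgen a x)"
    by (simp add: level_op_eq torus_torus)
  show "level_op n L Kgen a (level_op n L Egen b (level_op n L Kinv a x)) = scale (qq powi cartan a b) (level_op n L Egen b x)"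
    "level_op n L Kgen a (level_op n L Fgen b (level_op n L Kinv a x)) = scale (qq powi - cartan a b) (level_op n L Fgen b x)"
    using ab by (simp_all add: level_op_eq T torus_inverse)
  show "level_op n L Egen a (level_op n L Fgen b x) - level_op n L Fgen b (level_op n L Egen a x) =
      (if a = b then scale (1 / (qq - inverse qq)) (level_op n L Kgen a x - level_op n L Kinv a x) else 0)"
    using ladder_commutator_same[OF L ab(1)] ladder_commutator_distinct[OF L ab] by (auto simp: level_op_eq)
  show "level_op n L g a (level_op n L g b x) = level_op n L g b (level_op n L g a x)"
    if "g \<in> {Egen, Fgen}" "cartan a b = 0" using that C by (auto simp: level_op_eq)
  show "level_op n L g a (level_op n L g a (level_op n L g b x))
        - scale (qq + inverse qq) (level_op n L g a (level_op n L g b (level_op n L g a x)))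
        + level_op n L g b (level_op n L g a (level_op n L g a x)) = 0"
    if "g \<in> {Egen, Fgen}" "cartan a b = -1"
    using that S[of 1] S[of "-1"] by (auto simp: level_op_eq serre_term_def)
  show "level_op n L g a (level_op n L h b x) = level_op n L h b (level_op n L g a x)" if c: "cartan a b = 0"
    using c C[OF _ _ c] T[OF ab] T[OF ab(2,1)] torus_torus[of n L _ a _ b x] cartan_commute[of a b]
    by (cases g; cases h) (simp_all add: level_op_eq)
qed

lemma cartan_shift: "cartan (p + a) (p + b) = cartan a b"
  by (simp add: cartan_def)

context wedge_product
begin

lemma block_index:
  assumes "j \<in> {1..length ns}" "b \<in> {1..<part ns j}"
  shows "psum ns (j - 1) < psum ns (j - 1) + b" "psum ns (j - 1) + b < psum ns j"
    "psum ns (j - 1) + b \<in> {1..<n}"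
  using assms psum_Suc[OF assms(1)] psum_le[of ns j] by auto

lemma level_op_in:
  assumes "j \<in> {1..length ns}" "psum ns (j - 1) < a" "a < psum ns j" "keys x \<subseteq> Bt"
  shows "fock_act n g a x = level_op n L g a x" "keys (level_op n L g a x) \<subseteq> Bt"
  using fock_act_op[OF assms] by (simp_all add: level_op_def)

lemma level_op_hom:
  assumes "j \<in> {1..length ns}" "psum ns (j - 1) < a" "a < psum ns j"
  shows "fock_act n g a \<in> LinearCombinations.module_hom CqF (fock_space ns t) (fock_space ns t)"
  using level_op_in[OF assms]
  by (auto simp: LinearCombinations.module_hom_def fock_act_def lin_ext_add lin_ext_scale subset_iff)

lemma Un_module_fock: "Un_module ns (fock_space ns t) (fock_act n)"
  unfolding Un_module_def
proof (intro conjI ballI impI allI)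
  show "vectorspace CqF (fock_space ns t)" by (rule vectorspace_free_space)
next
  fix j assume j: "j \<in> {1..length ns}"
  define p where "p = psum ns (j - 1)"
  have idx: "p + b \<in> {1..<n}" and act: "keys x \<subseteq> Bt \<Longrightarrow> fock_act n g (p + b) x = level_op n L g (p + b) x"
    and closed: "keys x \<subseteq> Bt \<Longrightarrow> keys (level_op n L g (p + b) x) \<subseteq> Bt"
    and hom: "fock_act n g (p + b) \<in> LinearCombinations.module_hom CqF (fock_space ns t) (fock_space ns t)"
    if "b \<in> {1..<part ns j}" for b g x
    unfolding p_def using block_index[OF j that] level_op_in[OF j block_index(1,2)[OF j that]]
      level_op_hom[OF j block_index(1,2)[OF j that]] by blast+
  show "Uq_sl_module (part ns j) (fock_space ns t) (\<lambda>g b. fock_act n g (p + b))"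
    unfolding Uq_sl_module_def p_def[symmetric]
  proof (intro conjI allI ballI impI vectorspace_free_space)
    fix g b assume b: "b \<in> {1..<part ns j}"
    show "fock_act n g (p + b) \<in> LinearCombinations.module_hom CqF (fock_space ns t) (fock_space ns t)"
      by (rule hom[OF b])
  next
    fix b x assume b: "b \<in> {1..<part ns j}" and "x \<in> carrier (fock_space ns t)"
    then have x: "keys x \<subseteq> Bt" by simp
    note [simp] = act[OF b] closed[OF b] x and rel = level_op_relations(1,2)[OF finite_L idx[OF b] idx[OF b]]
    show "fock_act n Kgen (p + b) (fock_act n Kinv (p + b) x) = x"
      "fock_act n Kinv (p + b) (fock_act n Kgen (p + b) x) = x"
      by (simp_all add: rel)
  next
    fix b c x assume b: "b \<in> {1..<part ns j}" and c: "c \<in> {1..<part ns j}" and "x \<in> carrier (fock_space ns t)"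
    then have x: "keys x \<subseteq> Bt" by simp
    note [simp] = act[OF b] act[OF c] closed[OF b] closed[OF c] x keys_subset
      and rel = level_op_relations[OF finite_L idx[OF b] idx[OF c]]
    show "fock_act n Kgen (p + b) (fock_act n Kgen (p + c) x) = fock_act n Kgen (p + c) (fock_act n Kgen (p + b) x)"
      by (simp add: rel)
    show "fock_act n Kgen (p + b) (fock_act n Egen (p + c) (fock_act n Kinv (p + b) x)) =
        qq powi cartan b c \<odot>\<^bsub>fock_space ns t\<^esub> fock_act n Egen (p + c) x"
      by (simp add: rel cartan_shift)
    show "fock_act n Kgen (p + b) (fock_act n Fgen (p + c) (fock_act n Kinv (p + b) x)) =
        qq powi - cartan b c \<odot>\<^bsub>fock_space ns t\<^esub> fock_act n Fgen (p + c) x"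
      by (simp add: rel cartan_shift)
    show "fock_act n Egen (p + b) (fock_act n Fgen (p + c) x) \<ominus>\<^bsub>fock_space ns t\<^esub>
        fock_act n Fgen (p + c) (fock_act n Egen (p + b) x) =
        (if b = c then (1 / (qq - inverse qq)) \<odot>\<^bsub>fock_space ns t\<^esub>
          (fock_act n Kgen (p + b) x \<ominus>\<^bsub>fock_space ns t\<^esub> fock_act n Kinv (p + b) x)
         else \<zero>\<^bsub>fock_space ns t\<^esub>)"
      by (simp add: rel)
  next
    fix g b c x assume g: "g \<in> {Egen, Fgen}" and b: "b \<in> {1..<part ns j}" and c: "c \<in> {1..<part ns j}"
      and "x \<in> carrier (fock_space ns t)"
    then have x: "keys x \<subseteq> Bt" by simp
    note [simp] = act[OF b] act[OF c] closed[OF b] closed[OF c] x keys_subset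
      and rel = level_op_relations[OF finite_L idx[OF b] idx[OF c], unfolded cartan_shift]
    show "fock_act n g (p + b) (fock_act n g (p + c) x) = fock_act n g (p + c) (fock_act n g (p + b) x)"
      if "cartan b c = 0" by (simp add: rel(7)[OF g that])
    show "fock_act n g (p + b) (fock_act n g (p + b) (fock_act n g (p + c) x)) \<ominus>\<^bsub>fock_space ns t\<^esub>
        (qq + inverse qq) \<odot>\<^bsub>fock_space ns t\<^esub> fock_act n g (p + b) (fock_act n g (p + c) (fock_act n g (p + b) x))
        \<oplus>\<^bsub>fock_space ns t\<^esub> fock_act n g (p + c) (fock_act n g (p + b) (fock_act n g (p + b) x)) =
        \<zero>\<^bsub>fock_space ns t\<^esub>"
      if "cartan b c = - 1" by (simp add: rel(8)[OF g that])
  qed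
next
  fix j j' a b g h x
  assume j: "j \<in> {1..length ns}" "j' \<in> {1..length ns}" "j \<noteq> j'"
    and ab: "psum ns (j - 1) < a \<and> a < psum ns j \<and> psum ns (j' - 1) < b \<and> b < psum ns j'"
    and "x \<in> carrier (fock_space ns t)"
  then have x: "keys x \<subseteq> Bt" by simp
  from ab have ab: "psum ns (j - 1) < a" "a < psum ns j" "psum ns (j' - 1) < b" "b < psum ns j'" by auto
  have "a \<in> {1..<n}" "b \<in> {1..<n}" using ab psum_le[of ns j] psum_le[of ns j'] by auto
  moreover have "cartan a b = 0"
  proof -
    \<comment> \<open>Indices from different blocks are separated by the partial sum between them, hence
      differ by at least \<open>2\<close>.\<close>
    consider "j \<le> j' - 1" | "j' \<le> j - 1" using j(3) by linarith
    then show ?thesis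
      using ab psum_mono[of j "j' - 1" ns] psum_mono[of j' "j - 1" ns] by cases (auto simp: cartan_def)
  qed
  ultimately show "fock_act n g a (fock_act n h b x) = fock_act n h b (fock_act n g a x)"
    using level_op_relations(9)[OF finite_L] by (simp add: level_op_in[OF j(1) ab(1,2)] level_op_in[OF j(2) ab(3,4)] x)
qed

end

lemma Uq_sl_module_transport:
  assumes V: "Uq_sl_module m V act" and h: "lin_bij V W h"
    and int: "\<And>g a x. a \<in> {1..<m} \<Longrightarrow> x \<in> carrier V \<Longrightarrow> act' g a (h x) = h (act g a x)"
  shows "Uq_sl_module m W act'"
proof -
  have vs: "vectorspace CqF V" using V by (simp add: Uq_sl_module_def)
  interpret linear_map CqF V W h by (rule linear_map_transport[OF vs h])
  note h' = lin_bijD[OF h]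
  have hom: "act g a \<in> LinearCombinations.module_hom CqF V V" if "a \<in> {1..<m}" for g a
    using V that by (simp add: Uq_sl_module_def)
  have cl: "act g a x \<in> carrier V" if "a \<in> {1..<m}" "x \<in> carrier V" for g a x
    using hom[OF that(1), of g] that(2) by (auto simp: LinearCombinations.module_hom_def)
  have minus: "h x \<ominus>\<^bsub>W\<^esub> h y = h (x \<ominus>\<^bsub>V\<^esub> y)" if "x \<in> carrier V" "y \<in> carrier V" for x y
    using that by simp
  have W_hom: "act' g a \<in> LinearCombinations.module_hom CqF W W" if a: "a \<in> {1..<m}" for g a
    using hom[OF a, of g] unfolding LinearCombinations.module_hom_def
    by (auto simp: h'(1,4,5) int[OF a] cl[OF a] simp del: f_add f_smult)
  note [simp] = int cl h'(3,4,5) minus and [simp del] = f_add f_smult f_minus f0_is_0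
  show ?thesis
    unfolding Uq_sl_module_def
  proof (intro conjI allI ballI impI W_hom vectorspace_transport[OF vs h])
    fix a x assume a: "a \<in> {1..<m}" and "x \<in> carrier W"
    then obtain v where v: "v \<in> carrier V" "x = h v" by (auto simp: h'(1))
    have "act Kgen a (act Kinv a v) = v" "act Kinv a (act Kgen a v) = v"
      using V a v(1) unfolding Uq_sl_module_def by blast+
    then show "act' Kgen a (act' Kinv a x) = x" "act' Kinv a (act' Kgen a x) = x"
      using a v by simp_all
  next
    fix a b x assume a: "a \<in> {1..<m}" and b: "b \<in> {1..<m}" and "x \<in> carrier W"
    then obtain v where v: "v \<in> carrier V" "x = h v" by (auto simp: h'(1))
    have "act Kgen a (act Kgen b v) = act Kgen b (act Kgen a v)"
      and "act Kgen a (act Egen b (act Kinv a v)) = (qq powi cartan a b) \<odot>\<^bsub>V\<^esub> act Egen b v"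
      and "act Kgen a (act Fgen b (act Kinv a v)) = (qq powi (- cartan a b)) \<odot>\<^bsub>V\<^esub> act Fgen b v"
      and EF: "act Egen a (act Fgen b v) \<ominus>\<^bsub>V\<^esub> act Fgen b (act Egen a v) =
          (if a = b then (1 / (qq - inverse qq)) \<odot>\<^bsub>V\<^esub> (act Kgen a v \<ominus>\<^bsub>V\<^esub> act Kinv a v) else \<zero>\<^bsub>V\<^esub>)"
      using V a b v(1) unfolding Uq_sl_module_def by blast+
    then show "act' Kgen a (act' Kgen b x) = act' Kgen b (act' Kgen a x)"
      and "act' Kgen a (act' Egen b (act' Kinv a x)) = (qq powi cartan a b) \<odot>\<^bsub>W\<^esub> act' Egen b x"
      and "act' Kgen a (act' Fgen b (act' Kinv a x)) = (qq powi (- cartan a b)) \<odot>\<^bsub>W\<^esub> act' Fgen b x"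
      using a b v by simp_all
    show "act' Egen a (act' Fgen b x) \<ominus>\<^bsub>W\<^esub> act' Fgen b (act' Egen a x) =
          (if a = b then (1 / (qq - inverse qq)) \<odot>\<^bsub>W\<^esub> (act' Kgen a x \<ominus>\<^bsub>W\<^esub> act' Kinv a x) else \<zero>\<^bsub>W\<^esub>)"
      using a b v arg_cong[OF EF, of h] by (cases "a = b") simp_all
  next
    fix g a b x assume g: "g \<in> {Egen, Fgen}" and a: "a \<in> {1..<m}" and b: "b \<in> {1..<m}" and "x \<in> carrier W"
    then obtain v where v: "v \<in> carrier V" "x = h v" by (auto simp: h'(1))
    show "act' g a (act' g b x) = act' g b (act' g a x)" if "cartan a b = 0"
    proof -
      have "act g a (act g b v) = act g b (act g a v)"
        using V g a b v(1) that unfolding Uq_sl_module_def by blast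
      then show ?thesis using a b v by simp
    qed
    show "act' g a (act' g a (act' g b x))
        \<ominus>\<^bsub>W\<^esub> (qq + inverse qq) \<odot>\<^bsub>W\<^esub> act' g a (act' g b (act' g a x))
        \<oplus>\<^bsub>W\<^esub> act' g b (act' g a (act' g a x)) = \<zero>\<^bsub>W\<^esub>" if "cartan a b = - 1"
    proof -
      have "act g a (act g a (act g b v))
          \<ominus>\<^bsub>V\<^esub> (qq + inverse qq) \<odot>\<^bsub>V\<^esub> act g a (act g b (act g a v))
          \<oplus>\<^bsub>V\<^esub> act g b (act g a (act g a v)) = \<zero>\<^bsub>V\<^esub>"
        using V g a b v(1) that unfolding Uq_sl_module_def by blast
      then show ?thesis using a b v by simp
    qed
  qed
qed

lemma Un_module_transport:
  assumes V: "Un_module ns V act" and h: "lin_bij V W h"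
    and int: "\<And>g j a x. j \<in> {1..length ns} \<Longrightarrow> psum ns (j - 1) < a \<Longrightarrow> a < psum ns j \<Longrightarrow>
      x \<in> carrier V \<Longrightarrow> act' g a (h x) = h (act g a x)"
  shows "Un_module ns W act'"
  unfolding Un_module_def
proof (intro conjI ballI impI allI)
  show "vectorspace CqF W"
    using V h vectorspace_transport by (auto simp: Un_module_def)
next
  fix j assume j: "j \<in> {1..length ns}"
  have "Uq_sl_module (part ns j) V (\<lambda>g a. act g (psum ns (j - 1) + a))"
    using V j by (simp add: Un_module_def)
  then show "Uq_sl_module (part ns j) W (\<lambda>g a. act' g (psum ns (j - 1) + a))"
    by (rule Uq_sl_module_transport[OF _ h]) (use psum_Suc[OF j] in \<open>auto intro!: int[OF j]\<close>)
next
  fix j j' a b g k x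
  assume j: "j \<in> {1..length ns}" "j' \<in> {1..length ns}" "j \<noteq> j'"
    and ab: "psum ns (j - 1) < a \<and> a < psum ns j \<and> psum ns (j' - 1) < b \<and> b < psum ns j'"
    and "x \<in> carrier W"
  then obtain v where v: "v \<in> carrier V" "x = h v" by (auto simp: lin_bijD(1)[OF h])
  have closed: "act g a v \<in> carrier V"
    if j: "j \<in> {1..length ns}" and a: "psum ns (j - 1) < a" "a < psum ns j" for g j a
  proof -
    have "a - psum ns (j - 1) \<in> {1..<part ns j}" using psum_Suc[OF j] a by auto
    then have "act g (psum ns (j - 1) + (a - psum ns (j - 1))) \<in> LinearCombinations.module_hom CqF V V"
      using V j unfolding Un_module_def Uq_sl_module_def by blast
    then show ?thesis using a v(1) by (auto simp: LinearCombinations.module_hom_def)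
  qed
  have "act g a (act k b v) = act k b (act g a v)"
    using V j ab v(1) unfolding Un_module_def by blast
  then show "act' g a (act' k b x) = act' k b (act' g a x)"
    using j ab v closed by (simp add: int)
qed

theorem lemma4p3:
  fixes n :: nat and ns :: "nat list" and t :: "int \<times> nat \<Rightarrow> nat"
  assumes "n \<ge> 1"
    and "\<forall>m\<in>set ns. m > 0"
    and "sum_list ns = n"
    and "t \<in> types ns"
  shows
    "(vectorspace CqF (Wedge ns t) \<and>
      vectorspace.basis CqF (Wedge ns t) (Wedge_basis_vec ns t ` subset_families ns t)) \<and>
     bij_betw (sections ns) (beta_sets_of_type ns t) (subset_families ns t) \<and>
     (linear_map CqF (fock_space ns t) (Wedge ns t) (Theta ns t) \<and>
      (\<forall>B\<in>beta_sets_of_type ns t.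
         Theta ns t (Poly_Mapping.single B 1) = Wedge_basis_vec ns t (sections ns B)) \<and>
      bij_betw (Theta ns t) (carrier (fock_space ns t)) (carrier (Wedge ns t)) \<and>
      Un_iso ns (fock_space ns t) (fock_act n) (Wedge ns t) (Wedge_act ns t) (Theta ns t))"
proof -
  interpret wedge_product ns t
    using assms by unfold_locales auto
  note lb = lin_bij_Theta
  have linear: "linear_map CqF (fock_space ns t) (Wedge ns t) (Theta ns t)"
    by (rule linear_map_transport[OF vectorspace_free_space lb])
  have vs: "vectorspace CqF (Wedge ns t)"
    by (rule vectorspace_transport[OF vectorspace_free_space lb])
  have "(\<lambda>X. fiber fams ev (single X 1)) ` subset_families ns t = Wedge_basis_vec ns t ` subset_families ns t"
    by (rule image_cong) (simp_all add: Wedge_basis_vec_eq)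
  then have basis: "vectorspace.basis CqF (Wedge ns t) (Wedge_basis_vec ns t ` subset_families ns t)"
    using basis_transport[OF lin_bij_Wedge] by simp
  have Theta_single: "Theta ns t (single B 1) = Wedge_basis_vec ns t (sections ns B)"
    if "B \<in> beta_sets_of_type ns t" for B
    using that sections_in[OF that] by (simp add: Theta_eq Wedge_basis_vec_eq relabel_def)
  have bij: "bij_betw (Theta ns t) (carrier (fock_space ns t)) (carrier (Wedge ns t))"
    using lb by (simp add: lin_bij_def)
  have "Un_module ns (Wedge ns t) (Wedge_act ns t)"
    by (rule Un_module_transport[OF Un_module_fock lb]) (simp add: Theta_act)
  moreover have "Theta ns t (fock_act n g a x) = Wedge_act ns t g a (Theta ns t x)"
    if a: "a \<in> Un_indices ns" and x: "x \<in> carrier (fock_space ns t)" for g a x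
  proof -
    obtain j where j: "j \<in> {1..length ns}" "psum ns (j - 1) < a" "a < psum ns j"
      using Un_index_block[OF a] by blast
    show ?thesis using Theta_act[OF j] x assms(3) by simp
  qed
  ultimately have "Un_iso ns (fock_space ns t) (fock_act n) (Wedge ns t) (Wedge_act ns t) (Theta ns t)"
    using Un_module_fock linear bij assms(3) unfolding Un_iso_def by blast
  then show ?thesis
    using vs basis bij_betw_sections[OF n_pos t_types] linear Theta_single bij by blast
qed

end
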